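(* For each positive integer $t$, let $H$ be the Hilbert function of $t$ generic double points in $\mathbb{P}^2$, and let $s(t)$ be the number of double points produced by the algorithm described in the context with input $H$ (equivalently, with input $\Delta H$). Then $$\lim_{t\to+\infty}\frac{s(t)}{t}=\frac34.$$
   Context: Let $k$ be an algebraically closed field of characteristic zero, $\mathbb{P}^2=\mathbb{P}^2_k$ and $R=k[x_0,x_1,x_2]$ with the standard grading. For distinct points $P_1,\ldots,P_s\in\mathbb{P}^2$ with homogeneous ideals $I_{P_i}$ and positive integers $m_i$, $Z=m_1P_1+\cdots+m_sP_s$ is the scheme defined by $I_Z=I_{P_1}^{m_1}\cap\cdots\cap I_{P_s}^{m_s}$; a point with $m_i=2$ is a double point of $Z$, and one with $m_i=1$ is a reduced point. The Hilbert function is $H_Z(i)=\dim_k(R/I_Z)_i$, with first difference $\Delta H_Z(i)=H_Z(i)-H_Z(i-1)$, $H_Z(-1)=0$. The Hilbert function of $t$ generic double points is $H_Z$ for $Z=2P_1+\cdots+2P_t$ with $(P_1,\ldots,P_t)$ in a suitable nonempty Zariski open subset of $(\mathbb{P}^2)^t$ on which $H_Z$ is constant. Algorithm. The input is $\Delta H=(h_0,\ldots,h_\sigma)$ (the nonzero values of the first difference of the Hilbert function of a zero-dimensional scheme in $\mathbb{P}^2$). Let $\alpha=\max_j h_j$ and let $\Delta H^\star=(h_1^\star,\ldots,h_\alpha^\star)$ with $h_i^\star=\#\{j\mid h_j\ge i\}$. Write $n_+=\max\{n,0\}$. STEP $0$: take lines $\ell_1,\ldots,\ell_\alpha$ in $\mathbb{P}^2$,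 no three meeting at a point, put $P_{i,j}=\ell_i\cap\ell_j$, and let $Z_0\subseteq\bigcup_i\ell_i$ be a set of reduced points with $|Z_0\cap\ell_i|=h_i^\star$ containing no point $\ell_i\cap\ell_j$ with $i\neq j$. STEP $n$ ($n\ge1$): let $s_n=\#\{k\mid n+1\le k\le\alpha\text{ and }h_k^\star\ge n\}$. If $s_n=0$, return $Z_{n-1}$ and stop. Otherwise let $t_n=\min\left\{\left\lfloor\frac{(h_n^\star-(n-1))_+}{2}\right\rfloor,s_n\right\}$; remove from $Z_{n-1}$ a total of $2t_n$ reduced points on $\ell_n$ and one reduced point on each $\ell_j$ for $j=n+1,\ldots,n+t_n$, add the double points $2P_{n,j}$ for $j=n+1,\ldots,n+t_n$, call the result $Z_n$, and go to STEP $n+1$. The number of double points produced is the number of double points in the returned scheme. *)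

theory Defs
  imports
    "HOL-Analysis.Analysis"
    "HOL-Computational_Algebra.Polynomial"
    "HOL-Library.Multiset"
    "HOL-Library.Poly_Mapping"
begin

section \<open>Polynomials and ideals\<close>

text \<open>
  Polynomials with variables indexed by \<open>'v\<close> are finitely supported functions from exponent
  vectors to coefficients, with the ring structure of the theory \<open>Poly_Mapping\<close>.
\<close>

type_synonym ('v, 'k) mpol = "('v \<Rightarrow>\<^sub>0 nat) \<Rightarrow>\<^sub>0 'k"

definition mpol_eval :: "('v \<Rightarrow> 'k::field) \<Rightarrow> ('v, 'k) mpol \<Rightarrow> 'k" where
  "mpol_eval x f = (\<Sum>m\<in>Poly_Mapping.keys f.
     Poly_Mapping.lookup f m * (\<Prod>v\<in>Poly_Mapping.keys m. x v ^ Poly_Mapping.lookup m v))"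

definition mpol_scale :: "'k::field \<Rightarrow> ('v, 'k) mpol \<Rightarrow> ('v, 'k) mpol" where
  "mpol_scale c f = Poly_Mapping.single 0 c * f"

text \<open>The degree-\<open>d\<close> graded piece of the polynomial ring (it contains \<open>0\<close>).\<close>

definition forms :: "nat \<Rightarrow> ('v, 'k::field) mpol set" where
  "forms d = {f. \<forall>m\<in>Poly_Mapping.keys f. (\<Sum>v\<in>Poly_Mapping.keys m. Poly_Mapping.lookup m v) = d}"

text \<open>An ideal of a commutative ring is a submodule of the ring over itself.\<close>

definition ideal_gen :: "'r::comm_ring_1 set \<Rightarrow> 'r set" where
  "ideal_gen S = module.span (*) S"

definition ideal_mult :: "'r::comm_ring_1 set \<Rightarrow> 'r set \<Rightarrow> 'r set" where
  "ideal_mult I J = ideal_gen {f * g | f g. f \<in> I \<and> g \<in> J}"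

primrec ideal_power :: "'r::comm_ring_1 set \<Rightarrow> nat \<Rightarrow> 'r set" where
  "ideal_power I 0 = UNIV"
| "ideal_power I (Suc n) = ideal_mult I (ideal_power I n)"

text \<open>
  The dimension of the quotient of a space \<open>V\<close> of polynomials by its subspace \<open>V \<inter> W\<close>: the size
  of a finite set \<open>B \<subseteq> V\<close> whose residue classes form a basis of the quotient.  Independence
  modulo \<open>W\<close> makes the residue classes of distinct elements of \<open>B\<close> distinct, so \<open>card B\<close> is the
  size of that basis.
\<close>

definition basis_modulo ::
    "('v, 'k::field) mpol set \<Rightarrow> ('v, 'k) mpol set \<Rightarrow> ('v, 'k) mpol set \<Rightarrow> bool" where
  "basis_modulo V W B \<longleftrightarrow> finite B \<and> B \<subseteq> V
     \<and> (\<forall>c. (\<Sum>b\<in>B. mpol_scale (c b) b) \<in> W \<longrightarrow> (\<forall>b\<in>B. c b = 0))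
     \<and> (\<forall>f\<in>V. \<exists>c. f - (\<Sum>b\<in>B. mpol_scale (c b) b) \<in> W)"

definition quotient_dim :: "('v, 'k::field) mpol set \<Rightarrow> ('v, 'k) mpol set \<Rightarrow> nat" where
  "quotient_dim V W = (THE n. \<exists>B. basis_modulo V W B \<and> card B = n)"


section \<open>The projective plane\<close>

definition proj_rel :: "'k::field ^ 3 \<Rightarrow> 'k ^ 3 \<Rightarrow> bool" where
  "proj_rel v w \<longleftrightarrow> v \<noteq> 0 \<and> w \<noteq> 0 \<and> (\<exists>c. w = c *s v)"

lemma part_equivp_proj_rel: "part_equivp (proj_rel :: 'k::field ^ 3 \<Rightarrow> _)"
proof (rule part_equivpI)
  have "proj_rel (axis 1 1) (axis 1 1 :: 'k ^ 3)"
    unfolding proj_rel_def by (auto simp: axis_eq_0_iff intro: exI[of _ 1])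
  then show "\<exists>v. proj_rel v (v :: 'k ^ 3)" ..
  show "symp (proj_rel :: 'k ^ 3 \<Rightarrow> _)"
  proof (rule sympI)
    fix v w :: "'k ^ 3" assume "proj_rel v w"
    then obtain c where *: "v \<noteq> 0" "w \<noteq> 0" "w = c *s v" unfolding proj_rel_def by blast
    then have "c \<noteq> 0" by auto
    then have "v = inverse c *s w" using * by (simp add: vector_smult_assoc)
    then show "proj_rel w v" using * unfolding proj_rel_def by blast
  qed
  show "transp (proj_rel :: 'k ^ 3 \<Rightarrow> _)"
    unfolding proj_rel_def by (rule transpI) (metis vector_smult_assoc)
qed

quotient_type (overloaded) 'k p2 = "'k::field ^ 3" / partial: proj_rel
  by (rule part_equivp_proj_rel)

text \<open>
  Homogeneous coordinates of a point: some representative vector.  They are only used with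
  conditions that do not depend on the representative, namely the vanishing of (multi)homogeneous
  polynomials.
\<close>

definition coords :: "'k::field p2 \<Rightarrow> 3 \<Rightarrow> 'k" where
  "coords P j = rep_p2 P $ j"

definition is_line :: "'k::field p2 set \<Rightarrow> bool" where
  "is_line L \<longleftrightarrow> (\<exists>a :: 3 \<Rightarrow> 'k. (\<exists>j. a j \<noteq> 0) \<and> L = {P. (\<Sum>j\<in>UNIV. a j * coords P j) = 0})"


section \<open>Fat points and their Hilbert functions\<close>

definition point_ideal :: "'k::field p2 \<Rightarrow> (3, 'k) mpol set" where
  "point_ideal P = ideal_gen {f. (\<exists>d. f \<in> forms d) \<and> mpol_eval (coords P) f = 0}"

text \<open>
  The fat point scheme \<open>m\<^sub>1 P\<^sub>1 + \<dots> + m\<^sub>s P\<^sub>s\<close> is the multiset in which \<open>P\<^sub>i\<close> has multiplicity \<open>m\<^sub>i\<close>.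
\<close>

definition scheme_ideal :: "'k::field p2 multiset \<Rightarrow> (3, 'k) mpol set" where
  "scheme_ideal Z = (\<Inter>P\<in>set_mset Z. ideal_power (point_ideal P) (count Z P))"

definition hilbert_function :: "'k::field p2 multiset \<Rightarrow> nat \<Rightarrow> nat" where
  "hilbert_function Z i = quotient_dim (forms i) (scheme_ideal Z)"

definition first_difference :: "(nat \<Rightarrow> nat) \<Rightarrow> nat \<Rightarrow> int" where
  "first_difference H i = int (H i) - (if i = 0 then 0 else int (H (i - 1)))"

definition reduced_points :: "'k::field p2 multiset \<Rightarrow> 'k p2 set" where
  "reduced_points Z = {P. count Z P = 1}"

definition double_points :: "'k::field p2 multiset \<Rightarrow> 'k p2 set" where
  "double_points Z = {P. count Z P = 2}"


section \<open>Generic double points\<close>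

text \<open>
  Points of the \<open>t\<close>-fold product of the projective plane are lists of length \<open>t\<close>.  Its Zariski
  closed sets are the common zero loci of multihomogeneous polynomials in the variables \<open>(i, j)\<close>,
  the \<open>j\<close>-th homogeneous coordinate of the \<open>i\<close>-th point.
\<close>

definition multihomogeneous :: "nat \<Rightarrow> (nat \<times> 3, 'k::field) mpol \<Rightarrow> bool" where
  "multihomogeneous t f \<longleftrightarrow>
     (\<forall>m\<in>Poly_Mapping.keys f. Poly_Mapping.keys m \<subseteq> {..<t} \<times> UNIV)
     \<and> (\<exists>d. \<forall>m\<in>Poly_Mapping.keys f. \<forall>i<t. (\<Sum>j\<in>UNIV. Poly_Mapping.lookup m (i, j)) = d i)"

definition zariski_closed :: "nat \<Rightarrow> 'k::field p2 list set \<Rightarrow> bool" where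
  "zariski_closed t C \<longleftrightarrow> (\<exists>F. (\<forall>f\<in>F. multihomogeneous t f) \<and>
     C = {Ps. length Ps = t \<and> (\<forall>f\<in>F. mpol_eval (\<lambda>(i, j). coords (Ps ! i) j) f = 0)})"

definition zariski_open :: "nat \<Rightarrow> 'k::field p2 list set \<Rightarrow> bool" where
  "zariski_open t U \<longleftrightarrow> U \<subseteq> {Ps. length Ps = t} \<and> zariski_closed t ({Ps. length Ps = t} - U)"

text \<open>The multiset \<open>mset Ps + mset Ps\<close> is the scheme \<open>2P\<^sub>1 + \<dots> + 2P\<^sub>t\<close>.\<close>

definition generic_double_hilbert :: "'k::field itself \<Rightarrow> nat \<Rightarrow> nat \<Rightarrow> nat" where
  "generic_double_hilbert _ t = (THE H. \<exists>U :: 'k p2 list set. zariski_open t U \<and> U \<noteq> {} \<and>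
     (\<forall>Ps\<in>U. distinct Ps \<and> hilbert_function (mset Ps + mset Ps) = H))"


section \<open>The algorithm\<close>

text \<open>
  The input is given as a function \<open>h\<close> on all of \<open>nat\<close>, zero outside a finite set.  Zero values
  affect neither the maximum \<open>alpha h\<close> nor \<open>hstar h i\<close> for \<open>i \<ge> 1\<close>.
\<close>

definition alpha :: "(nat \<Rightarrow> int) \<Rightarrow> nat" where
  "alpha h = nat (Max (range h))"

definition hstar :: "(nat \<Rightarrow> int) \<Rightarrow> nat \<Rightarrow> nat" where
  "hstar h i = card {j. h j \<ge> int i}"

definition alg_s :: "(nat \<Rightarrow> int) \<Rightarrow> nat \<Rightarrow> nat" where
  "alg_s h n = card {k. n + 1 \<le> k \<and> k \<le> alpha h \<and> hstar h k \<ge> n}"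

text \<open>The truncated subtraction of natural numbers provides the positive part.\<close>

definition alg_t :: "(nat \<Rightarrow> int) \<Rightarrow> nat \<Rightarrow> nat" where
  "alg_t h n = min ((hstar h n - (n - 1)) div 2) (alg_s h n)"

text \<open>Distinctness of the lines has to be required separately, for the case of two lines.\<close>

definition admissible_lines :: "nat \<Rightarrow> (nat \<Rightarrow> 'k::field p2 set) \<Rightarrow> bool" where
  "admissible_lines a l \<longleftrightarrow>
     (\<forall>i\<in>{1..a}. is_line (l i)) \<and> inj_on l {1..a}
     \<and> (\<forall>i\<in>{1..a}. \<forall>j\<in>{1..a}. \<forall>k\<in>{1..a}. i < j \<and> j < k \<longrightarrow> l i \<inter> l j \<inter> l k = {})"

definition meet :: "(nat \<Rightarrow> 'k::field p2 set) \<Rightarrow> nat \<Rightarrow> nat \<Rightarrow> 'k p2" where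
  "meet l i j = (THE P. P \<in> l i \<inter> l j)"

definition alg_start :: "(nat \<Rightarrow> int) \<Rightarrow> (nat \<Rightarrow> 'k::field p2 set) \<Rightarrow> 'k p2 multiset \<Rightarrow> bool" where
  "alg_start h l Z \<longleftrightarrow> (\<exists>A. finite A \<and> Z = mset_set A
     \<and> A \<subseteq> (\<Union>i\<in>{1..alpha h}. l i)
     \<and> (\<forall>i\<in>{1..alpha h}. card (A \<inter> l i) = hstar h i)
     \<and> (\<forall>i\<in>{1..alpha h}. \<forall>j\<in>{1..alpha h}. i \<noteq> j \<longrightarrow> A \<inter> (l i \<inter> l j) = {}))"

definition alg_step ::
    "(nat \<Rightarrow> int) \<Rightarrow> (nat \<Rightarrow> 'k::field p2 set) \<Rightarrow> nat \<Rightarrow> 'k p2 multiset \<Rightarrow> 'k p2 multiset \<Rightarrow> bool" where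
  "alg_step h l n Z Z' \<longleftrightarrow> (\<exists>A b. let J = {n + 1..n + alg_t h n} in
     A \<subseteq> reduced_points Z \<inter> l n \<and> card A = 2 * alg_t h n
     \<and> (\<forall>j\<in>J. b j \<in> reduced_points Z \<inter> l j)
     \<and> Z' = Z - mset_set (A \<union> b ` J) + (\<Sum>j\<in>J. {#meet l n j, meet l n j#}))"

text \<open>\<open>alg_run h l n Z\<close>: the steps \<open>0, \<dots>, n\<close> were carried out on the lines \<open>l\<close>, with \<open>Z\<^sub>n = Z\<close>.\<close>

inductive alg_run ::
    "(nat \<Rightarrow> int) \<Rightarrow> (nat \<Rightarrow> 'k::field p2 set) \<Rightarrow> nat \<Rightarrow> 'k p2 multiset \<Rightarrow> bool"
  for h l where
  start: "alg_start h l Z \<Longrightarrow> alg_run h l 0 Z"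
| step: "alg_run h l n Z \<Longrightarrow> alg_s h (Suc n) \<noteq> 0 \<Longrightarrow> alg_step h l (Suc n) Z Z'
    \<Longrightarrow> alg_run h l (Suc n) Z'"

definition alg_returns :: "(nat \<Rightarrow> int) \<Rightarrow> 'k::field p2 multiset \<Rightarrow> bool" where
  "alg_returns h Z \<longleftrightarrow> (\<exists>l n. admissible_lines (alpha h) l \<and> alg_run h l n Z \<and> alg_s h (Suc n) = 0)"

text \<open>
  The algorithm makes choices (lines, points of \<open>Z\<^sub>0\<close>, points to remove); the number of double
  points produced is the number common to all possible returned schemes.
\<close>

definition double_points_produced :: "'k::field itself \<Rightarrow> (nat \<Rightarrow> nat) \<Rightarrow> nat" where
  "double_points_produced _ H = (THE s.
     (\<exists>Z :: 'k p2 multiset. alg_returns (first_difference H) Z)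
     \<and> (\<forall>Z :: 'k p2 multiset. alg_returns (first_difference H) Z \<longrightarrow> card (double_points Z) = s))"

end

theory Submission
  imports Defs "Jordan_Normal_Form.Determinant" "HOL-Real_Asymp.Real_Asymp"
begin

text \<open>
  Put \<open>r = sqrt (6 * t)\<close>.  Except in a bounded number of degrees near \<open>r\<close>, the generic Hilbert function is the
  expected one: \<open>H d = (d + 1) * (d + 2) / 2\<close> below \<open>r\<close> and \<open>H d = 3 * t\<close> above \<open>r\<close>.  So the first difference
  is a staircase, \<open>h j = j + 1\<close> for \<open>j\<close> up to about \<open>r\<close> and \<open>h j = 0\<close> afterwards, and its conjugate
  has \<open>hstar h i\<close> about \<open>r - i\<close>.  The algorithm then adds about \<open>(r - 2 * n) / 2\<close> double points in
  step \<open>n\<close>, in total about \<open>r\<^sup>2 / 8 = 3 * t / 4\<close>.  All errors are of order \<open>r\<close>, which is negligible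
  against \<open>t\<close>, so the bounds \<open>generic_first_difference\<close> and \<open>staircase_double_points\<close> suffice.

  The Hilbert function of double points is a rank.  A form of positive degree lies in the square of the
  ideal of a point iff its partial derivatives vanish there (\<open>form_in_square_iff\<close>), so \<open>H d\<close> is the size
  of the largest nonzero minor of a matrix of partial derivatives if \<open>d \<ge> 1\<close>.  Such minors are multihomogeneous
  polynomials in the coordinates of the points, and a product of planes is irreducible.  Hence the
  generic value exists and is the maximum over all positions of the points, including
  positions where points coincide (\<open>generic_double_hilbert_max\<close>).

  To bound this maximum from below, the lattice points \<open>(x, y)\<close> with \<open>x + y \<le> d\<close>, which index the monomials
  of degree \<open>d\<close>, are cut into cells of at most three points: in each strip of two consecutive rows, run
  along the zigzag and take three points at a time.  Three consecutive points of the zigzag form a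
  triangle, and each strip has at most one incomplete cell.  A double point is assigned to each cell,
  with powers of a parameter as coordinates, the exponents being read off from an affine function that
  is minimal among all these functions exactly on its cell.  In the limit the matrix becomes block
  diagonal with a block of full column rank for each cell (\<open>cells_rank\<close>).  Since all but \<open>O(d)\<close> cells
  are complete, this gives the maximal rank outside a window of bounded length around \<open>r\<close>.

  For the algorithm, an invariant shows that every returned scheme has exactly as many double points as
  were added (\<open>alg_run_double_points\<close>), and counting the reduced points that are left on each line
  shows that a run exists (\<open>alg_run_exists\<close>).
\<close>

section \<open>Values and partial derivatives as weighted coefficient sums\<close>

definition coeff_sum :: "(('v \<Rightarrow>\<^sub>0 nat) \<Rightarrow> 'k) \<Rightarrow> ('v, 'k::field) mpol \<Rightarrow> 'k" where
  "coeff_sum w f = (\<Sum>m\<in>Poly_Mapping.keys f. Poly_Mapping.lookup f m * w m)"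

lemma coeff_sum_superset:
  assumes "finite S" "Poly_Mapping.keys f \<subseteq> S"
  shows "coeff_sum w f = (\<Sum>m\<in>S. Poly_Mapping.lookup f m * w m)"
  unfolding coeff_sum_def
  by (rule sum.mono_neutral_left) (use assms in \<open>auto simp: in_keys_iff\<close>)

lemma coeff_sum_add: "coeff_sum w (f + g) = coeff_sum w f + coeff_sum w g"
proof -
  let ?S = "Poly_Mapping.keys f \<union> Poly_Mapping.keys g"
  have "finite ?S" "Poly_Mapping.keys (f + g) \<subseteq> ?S" by (simp, rule keys_add)
  then show ?thesis
    by (simp add: coeff_sum_superset[of ?S] lookup_add distrib_right sum.distrib)
qed

lemma coeff_sum_zero [simp]: "coeff_sum w 0 = 0"
  by (simp add: coeff_sum_def)

lemma coeff_sum_sum: "coeff_sum w (\<Sum>i\<in>A. f i) = (\<Sum>i\<in>A. coeff_sum w (f i))"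
  by (induction A rule: infinite_finite_induct) (auto simp: coeff_sum_add)

lemma coeff_sum_single: "coeff_sum w (Poly_Mapping.single m c) = c * w m"
  by (simp add: coeff_sum_def)

lemma coeff_sum_one [simp]: "coeff_sum w 1 = w 0"
  by (simp add: coeff_sum_def)

lemma sum_single_keys: "(\<Sum>m\<in>Poly_Mapping.keys f. Poly_Mapping.single m (Poly_Mapping.lookup f m)) = f"
  by (rule poly_mapping_eqI)
     (auto simp: lookup_sum lookup_single when_def in_keys_iff sum.delta)

lemma coeff_sum_mult:
  "coeff_sum w (f * g) = (\<Sum>m\<in>Poly_Mapping.keys f. \<Sum>n\<in>Poly_Mapping.keys g.
     Poly_Mapping.lookup f m * Poly_Mapping.lookup g n * w (m + n))"
proof -
  have "f * g = (\<Sum>m\<in>Poly_Mapping.keys f. Poly_Mapping.single m (Poly_Mapping.lookup f m)) *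
      (\<Sum>n\<in>Poly_Mapping.keys g. Poly_Mapping.single n (Poly_Mapping.lookup g n))"
    by (simp only: sum_single_keys)
  also have "\<dots> = (\<Sum>m\<in>Poly_Mapping.keys f. \<Sum>n\<in>Poly_Mapping.keys g.
      Poly_Mapping.single (m + n) (Poly_Mapping.lookup f m * Poly_Mapping.lookup g n))"
    by (simp add: sum_product mult_single)
  finally show ?thesis by (simp add: coeff_sum_sum coeff_sum_single)
qed

lemma coeff_sum_scale: "coeff_sum w (mpol_scale c f) = c * coeff_sum w f"
  unfolding mpol_scale_def coeff_sum_mult
  by (cases "c = 0") (auto simp: coeff_sum_def sum_distrib_left mult.assoc)

lemma coeff_sum_diff: "coeff_sum w (f - g) = coeff_sum w f - coeff_sum w g"
  using coeff_sum_add[of w "f - g" g] by simp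

definition monomial_value :: "('v \<Rightarrow> 'k::field) \<Rightarrow> ('v \<Rightarrow>\<^sub>0 nat) \<Rightarrow> 'k" where
  "monomial_value x m = (\<Prod>v\<in>Poly_Mapping.keys m. x v ^ Poly_Mapping.lookup m v)"

lemma mpol_eval_eq: "mpol_eval x = coeff_sum (monomial_value x)"
  by (rule ext) (simp add: mpol_eval_def coeff_sum_def monomial_value_def)

lemma monomial_value_superset:
  assumes "finite S" "Poly_Mapping.keys m \<subseteq> S"
  shows "monomial_value x m = (\<Prod>v\<in>S. x v ^ Poly_Mapping.lookup m v)"
  unfolding monomial_value_def
  by (rule prod.mono_neutral_left) (use assms in \<open>auto simp: in_keys_iff\<close>)

lemma monomial_value_zero [simp]: "monomial_value x 0 = 1"
  by (simp add: monomial_value_def)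

lemma monomial_value_add: "monomial_value x (m + n) = monomial_value x m * monomial_value x n"
proof -
  let ?S = "Poly_Mapping.keys m \<union> Poly_Mapping.keys n"
  have "finite ?S" "Poly_Mapping.keys (m + n) \<subseteq> ?S" by (simp, rule keys_add)
  then show ?thesis
    by (simp add: monomial_value_superset[of ?S] lookup_add power_add prod.distrib)
qed

lemma monomial_value_single [simp]: "monomial_value x (Poly_Mapping.single v n) = x v ^ n"
  by (cases "n = 0") (auto simp: monomial_value_def)

lemma monomial_value_sum: "monomial_value x (\<Sum>i\<in>A. m i) = (\<Prod>i\<in>A. monomial_value x (m i))"
  by (induction A rule: infinite_finite_induct) (auto simp: monomial_value_add)

lemma mpol_eval_mult: "mpol_eval x (f * g) = mpol_eval x f * mpol_eval x g"
  by (simp add: mpol_eval_eq coeff_sum_mult monomial_value_add)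
     (simp add: coeff_sum_def sum_product mult_ac)

lemma mpol_eval_add: "mpol_eval x (f + g) = mpol_eval x f + mpol_eval x g"
  by (simp add: mpol_eval_eq coeff_sum_add)

lemma mpol_eval_one [simp]: "mpol_eval x 1 = 1"
  by (simp add: mpol_eval_eq coeff_sum_def)

lemma mpol_eval_zero [simp]: "mpol_eval x 0 = 0"
  by (simp add: mpol_eval_eq)

lemma comm_ring_hom_mpol_eval: "comm_ring_hom (mpol_eval x)"
  by unfold_locales (auto simp: mpol_eval_add mpol_eval_mult)

lemma mpol_eval_prod: "mpol_eval x (\<Prod>i\<in>A. f i) = (\<Prod>i\<in>A. mpol_eval x (f i))"
  by (induction A rule: infinite_finite_induct) (auto simp: mpol_eval_mult)

text \<open>
  The value at \<open>x\<close> of the derivative of the monomial \<open>m\<close> in the variable \<open>e\<close>.  Where the subtraction of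
  exponents truncates, the factor in front is zero.
\<close>

definition partial_weight :: "('v \<Rightarrow> 'k::field) \<Rightarrow> 'v \<Rightarrow> ('v \<Rightarrow>\<^sub>0 nat) \<Rightarrow> 'k" where
  "partial_weight x e m = of_nat (Poly_Mapping.lookup m e) *
     monomial_value x (m - Poly_Mapping.single e 1)"

definition partial_at :: "('v \<Rightarrow> 'k::field) \<Rightarrow> 'v \<Rightarrow> ('v, 'k) mpol \<Rightarrow> 'k" where
  "partial_at x e = coeff_sum (partial_weight x e)"

lemma partial_at_add: "partial_at x e (f + g) = partial_at x e f + partial_at x e g"
  by (simp add: partial_at_def coeff_sum_add)

lemma partial_at_zero [simp]: "partial_at x e 0 = 0"
  by (simp add: partial_at_def)

lemma split_off_variable:
  assumes "Poly_Mapping.lookup m e \<noteq> (0::nat)"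
  shows "m = Poly_Mapping.single e 1 + (m - Poly_Mapping.single e 1)"
  by (rule poly_mapping_eqI) (use assms in \<open>auto simp: lookup_add lookup_minus lookup_single when_def\<close>)

lemma remove_single_add:
  assumes "Poly_Mapping.lookup m e \<noteq> (0::nat)"
  shows "m + n - Poly_Mapping.single e 1 = (m - Poly_Mapping.single e 1) + n"
  by (rule poly_mapping_eqI) (use assms in \<open>auto simp: lookup_add lookup_minus lookup_single when_def\<close>)

lemma partial_weight_add:
  "partial_weight x e (m + n) =
     partial_weight x e m * monomial_value x n + monomial_value x m * partial_weight x e n"
proof -
  have 1: "of_nat (Poly_Mapping.lookup m e) * monomial_value x (m + n - Poly_Mapping.single e 1)
     = partial_weight x e m * monomial_value x n" for m n
    by (cases "Poly_Mapping.lookup m e = 0")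
       (auto simp: partial_weight_def remove_single_add[of m e n, simplified] monomial_value_add)
  have "partial_weight x e (m + n) =
      of_nat (Poly_Mapping.lookup m e) * monomial_value x (m + n - Poly_Mapping.single e 1) +
      of_nat (Poly_Mapping.lookup n e) * monomial_value x (n + m - Poly_Mapping.single e 1)"
    by (simp add: partial_weight_def lookup_add distrib_right add.commute)
  then show ?thesis by (simp only: 1) (simp add: mult.commute)
qed

lemma partial_at_mult:
  "partial_at x e (f * g) = partial_at x e f * mpol_eval x g + mpol_eval x f * partial_at x e g"
  by (simp add: partial_at_def mpol_eval_eq coeff_sum_mult partial_weight_add distrib_left sum.distrib)
     (simp add: coeff_sum_def sum_product mult_ac, rule sum.swap)

definition mdeg :: "('v \<Rightarrow>\<^sub>0 nat) \<Rightarrow> nat" where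
  "mdeg m = (\<Sum>v\<in>Poly_Mapping.keys m. Poly_Mapping.lookup m v)"

lemma mdeg_UNIV: "mdeg m = (\<Sum>v\<in>UNIV. Poly_Mapping.lookup m v)" for m :: "('v::finite) \<Rightarrow>\<^sub>0 nat"
  unfolding mdeg_def by (rule sum.mono_neutral_left) (auto simp: in_keys_iff)

lemma forms_iff: "f \<in> forms d \<longleftrightarrow> (\<forall>m\<in>Poly_Mapping.keys f. mdeg m = d)"
  by (simp add: forms_def mdeg_def)

lemma mult_partial_weight:
  "x e * partial_weight x e m = of_nat (Poly_Mapping.lookup m e) * monomial_value x m"
proof (cases "Poly_Mapping.lookup m e = 0")
  case False
  have "m = Poly_Mapping.single e 1 + (m - Poly_Mapping.single e 1)"
    by (rule split_off_variable[OF False])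
  then have "monomial_value x m = x e * monomial_value x (m - Poly_Mapping.single e 1)"
    by (metis monomial_value_add monomial_value_single power_one_right)
  then show ?thesis by (simp add: partial_weight_def)
qed (simp add: partial_weight_def)

lemma Euler_identity:
  fixes x :: "'v::finite \<Rightarrow> 'k::field"
  assumes "f \<in> forms d"
  shows "(\<Sum>e\<in>UNIV. x e * partial_at x e f) = of_nat d * mpol_eval x f"
proof -
  have "(\<Sum>e\<in>UNIV. x e * partial_at x e f) =
      (\<Sum>e\<in>UNIV. \<Sum>m\<in>Poly_Mapping.keys f. Poly_Mapping.lookup f m * (x e * partial_weight x e m))"
    by (simp add: partial_at_def coeff_sum_def sum_distrib_left algebra_simps)
  also have "\<dots> = (\<Sum>m\<in>Poly_Mapping.keys f. \<Sum>e\<in>UNIV.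
      Poly_Mapping.lookup f m * (x e * partial_weight x e m))"
    by (rule sum.swap)
  also have "\<dots> = (\<Sum>m\<in>Poly_Mapping.keys f.
      Poly_Mapping.lookup f m * (of_nat (mdeg m) * monomial_value x m))"
    by (simp add: mult_partial_weight mdeg_UNIV sum_distrib_left sum_distrib_right)
  also have "\<dots> = (\<Sum>m\<in>Poly_Mapping.keys f.
      Poly_Mapping.lookup f m * (of_nat d * monomial_value x m))"
    using assms by (auto simp: forms_iff intro!: sum.cong)
  finally show ?thesis
    by (simp add: mpol_eval_eq coeff_sum_def sum_distrib_left algebra_simps)
qed

section \<open>The ideal of a double point\<close>

lemma module_mult: "Modules.module ((*) :: 'r::comm_ring_1 \<Rightarrow> 'r \<Rightarrow> 'r)"
  by unfold_locales (auto simp: algebra_simps)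

definition is_ideal :: "'r::comm_ring_1 set \<Rightarrow> bool" where
  "is_ideal T \<longleftrightarrow> 0 \<in> T \<and> (\<forall>f\<in>T. \<forall>g\<in>T. f + g \<in> T) \<and> (\<forall>f\<in>T. \<forall>r. r * f \<in> T)"

lemma is_ideal_subspace: "is_ideal T \<longleftrightarrow> module.subspace (*) T"
  unfolding is_ideal_def module.subspace_def[OF module_mult] by blast

lemma is_ideal_ideal_gen: "is_ideal (ideal_gen S)"
  unfolding is_ideal_subspace ideal_gen_def by (rule module.subspace_span[OF module_mult])

lemma ideal_gen_base: "f \<in> S \<Longrightarrow> f \<in> ideal_gen S"
  unfolding ideal_gen_def by (rule module.span_base[OF module_mult])

lemma ideal_gen_minimal: "S \<subseteq> T \<Longrightarrow> is_ideal T \<Longrightarrow> ideal_gen S \<subseteq> T"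
  unfolding is_ideal_subspace ideal_gen_def by (rule module.span_minimal[OF module_mult])

lemma is_ideal_sum: "is_ideal T \<Longrightarrow> (\<And>i. i \<in> A \<Longrightarrow> f i \<in> T) \<Longrightarrow> (\<Sum>i\<in>A. f i) \<in> T"
  by (induction A rule: infinite_finite_induct) (auto simp: is_ideal_def)

lemma is_ideal_mult: "is_ideal T \<Longrightarrow> f \<in> T \<Longrightarrow> r * f \<in> T"
  by (auto simp: is_ideal_def)

lemma is_ideal_add: "is_ideal T \<Longrightarrow> f \<in> T \<Longrightarrow> g \<in> T \<Longrightarrow> f + g \<in> T"
  by (auto simp: is_ideal_def)

lemma is_ideal_ideal_power: "is_ideal (ideal_power I n)"
  by (cases n) (auto simp: ideal_mult_def is_ideal_ideal_gen, simp add: is_ideal_def)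

lemma mult_in_square:
  assumes "f \<in> I" "g \<in> I"
  shows "f * g \<in> ideal_power I 2"
proof -
  have "g * 1 \<in> ideal_mult I UNIV"
    unfolding ideal_mult_def by (rule ideal_gen_base) (use assms in blast)
  then show ?thesis
    unfolding numeral_2_eq_2 ideal_power.simps ideal_mult_def[of I "ideal_mult I UNIV"]
    by (intro ideal_gen_base) (use assms in auto)
qed

lemma point_ideal_value: "f \<in> point_ideal P \<Longrightarrow> mpol_eval (coords P) f = 0"
proof -
  have "is_ideal {f. mpol_eval (coords P) f = 0}"
    by (auto simp: is_ideal_def mpol_eval_add mpol_eval_mult)
  then have "point_ideal P \<subseteq> {f. mpol_eval (coords P) f = 0}"
    unfolding point_ideal_def by (intro ideal_gen_minimal) auto
  then show "f \<in> point_ideal P \<Longrightarrow> mpol_eval (coords P) f = 0" by blast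
qed

text \<open>
  By the product rule, the polynomials that vanish at a point together with a given partial derivative
  form an ideal, and it contains every product of two polynomials vanishing there.
\<close>

lemma square_vanishes:
  assumes "f \<in> ideal_power (point_ideal P) 2"
  shows "mpol_eval (coords P) f = 0" "partial_at (coords P) e f = 0"
proof -
  let ?x = "coords P"
  let ?T = "{f. mpol_eval ?x f = 0 \<and> partial_at ?x e f = 0}"
  have T: "is_ideal ?T"
    by (auto simp: is_ideal_def mpol_eval_add mpol_eval_mult partial_at_mult partial_at_add)
  have "ideal_mult (point_ideal P) UNIV \<subseteq> point_ideal P"
    unfolding ideal_mult_def
  proof (rule ideal_gen_minimal)
    show I: "is_ideal (point_ideal P)" unfolding point_ideal_def by (rule is_ideal_ideal_gen)
    have "f * g \<in> point_ideal P" if "f \<in> point_ideal P" for f g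
      using is_ideal_mult[OF I that, of g] by (simp add: mult.commute)
    then show "{f * g |f g. f \<in> point_ideal P \<and> g \<in> UNIV} \<subseteq> point_ideal P" by blast
  qed
  then have "ideal_power (point_ideal P) 2 \<subseteq> ?T"
    unfolding numeral_2_eq_2 ideal_power.simps
    by (subst ideal_mult_def, intro ideal_gen_minimal T)
       (auto simp: mpol_eval_mult partial_at_mult dest!: point_ideal_value subsetD)
  with assms show "mpol_eval ?x f = 0" "partial_at ?x e f = 0" by auto
qed

abbreviation cst :: "'k \<Rightarrow> ('v, 'k::field) mpol" where
  "cst c \<equiv> Poly_Mapping.single 0 c"

abbreviation var :: "'v \<Rightarrow> ('v, 'k::field) mpol" where
  "var v \<equiv> Poly_Mapping.single (Poly_Mapping.single v 1) 1"

lemma cst_mult: "cst (a * b) = cst a * (cst b :: ('v, 'k::field) mpol)"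
  by (simp add: mult_single)

lemma mdeg_add: "mdeg (m + n) = mdeg m + mdeg n"
proof -
  have *: "mdeg m = (\<Sum>v\<in>S. Poly_Mapping.lookup m v)"
    if "finite S" "Poly_Mapping.keys m \<subseteq> S" for S and m :: "'a \<Rightarrow>\<^sub>0 nat"
    unfolding mdeg_def by (rule sum.mono_neutral_left) (use that in \<open>auto simp: in_keys_iff\<close>)
  let ?S = "Poly_Mapping.keys m \<union> Poly_Mapping.keys n"
  have "finite ?S" "Poly_Mapping.keys (m + n) \<subseteq> ?S" by (simp, rule keys_add)
  then show ?thesis by (simp add: *[of ?S] lookup_add sum.distrib)
qed

lemma mdeg_single [simp]: "mdeg (Poly_Mapping.single v n) = n"
  by (cases "n = 0") (auto simp: mdeg_def)

lemma mdeg_zero [simp]: "mdeg 0 = 0"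
  by (simp add: mdeg_def)

lemma mdeg_eq_0 [simp]: "mdeg m = 0 \<longleftrightarrow> m = 0"
  by (auto simp: mdeg_def in_keys_iff intro!: poly_mapping_eqI)

lemma split_variable:
  assumes "mdeg m = Suc d"
  obtains u m' where "m = Poly_Mapping.single u 1 + m'" "mdeg m' = d"
proof -
  from assms have "m \<noteq> 0" by auto
  then obtain u where u: "Poly_Mapping.lookup m u \<noteq> 0"
    by (metis poly_mapping_eqI lookup_zero)
  have m: "m = Poly_Mapping.single u 1 + (m - Poly_Mapping.single u 1)"
    by (rule split_off_variable[OF u])
  with assms have "mdeg (m - Poly_Mapping.single u 1) = d"
    by (metis mdeg_add mdeg_single plus_1_eq_Suc Suc_inject)
  with m show thesis by (rule that)
qed

lemma forms_mult: "f \<in> forms d \<Longrightarrow> g \<in> forms e \<Longrightarrow> f * g \<in> forms (d + e)"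
  unfolding forms_iff using keys_mult[of f g] by (fastforce simp: mdeg_add)

lemma forms_add: "f \<in> forms d \<Longrightarrow> g \<in> forms d \<Longrightarrow> f + g \<in> forms d"
  unfolding forms_iff using keys_add[of f g] by blast

lemma forms_scale: "f \<in> forms d \<Longrightarrow> mpol_scale c f \<in> forms d"
  using forms_mult[of "cst c" 0 f d] by (auto simp: mpol_scale_def forms_iff split: if_splits)

lemma forms_zero [simp]: "0 \<in> forms d"
  by (simp add: forms_iff)

lemma var_forms: "var v \<in> forms 1"
  by (simp add: forms_iff)

text \<open>
  At a point with \<open>x a \<noteq> 0\<close> the linear forms \<open>x a \<cdot> X v - x v \<cdot> X a\<close> generate the ideal of the
  point; they are the local coordinates of the Taylor expansion below.
\<close>

definition tangent_form :: "('v \<Rightarrow> 'k::field) \<Rightarrow> 'v \<Rightarrow> 'v \<Rightarrow> ('v, 'k) mpol" where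
  "tangent_form x a v = cst (x a) * var v - cst (x v) * var a"

lemma tangent_form_in_point_ideal: "tangent_form (coords P) a v \<in> point_ideal P"
proof -
  let ?x = "coords P"
  have "cst (?x a) * var v + cst (- ?x v) * var a \<in> forms 1"
    by (intro forms_add forms_scale[unfolded mpol_scale_def] var_forms)
  then have "tangent_form ?x a v \<in> forms 1"
    by (simp add: tangent_form_def single_uminus)
  moreover have "mpol_eval ?x (tangent_form ?x a v) = 0"
    by (simp add: tangent_form_def mpol_eval_eq coeff_sum_diff mult_single coeff_sum_single)
  ultimately show ?thesis unfolding point_ideal_def by (intro ideal_gen_base) blast
qed

text \<open>
  The remainder of the first-order Taylor expansion of a form \<open>f\<close> of degree \<open>d\<close> at \<open>x\<close>, made homogeneous
  with \<open>var a\<close> and multiplied by \<open>x a ^ d\<close> to clear denominators.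
\<close>

definition taylor_remainder ::
    "('v::finite \<Rightarrow> 'k::field) \<Rightarrow> 'v \<Rightarrow> nat \<Rightarrow> ('v, 'k) mpol \<Rightarrow> ('v, 'k) mpol" where
  "taylor_remainder x a d f = cst (x a ^ d) * f - cst (mpol_eval x f) * var a ^ d
     - (\<Sum>v\<in>UNIV. cst (partial_at x v f) * var a ^ (d - 1) * tangent_form x a v)"

text \<open>
  Induction on the degree.  Multiplication by \<open>x a \<cdot> X u = L u + x u \<cdot> X a\<close>, with \<open>L\<close> the tangent forms,
  turns the remainder of \<open>f\<close> into that of \<open>X u \<cdot> f\<close> up to products \<open>L u \<cdot> L v\<close>, which lie in the square
  of the ideal.
\<close>

lemma taylor_remainder_monomial:
  fixes P :: "'k::field p2"
  shows "mdeg m = d \<Longrightarrow>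
    taylor_remainder (coords P) a d (Poly_Mapping.single m 1) \<in> ideal_power (point_ideal P) 2"
proof (induction d arbitrary: m)
  case 0
  then have "taylor_remainder (coords P) a 0 (Poly_Mapping.single m 1) = 0"
    by (simp add: taylor_remainder_def mpol_eval_eq partial_at_def partial_weight_def)
  then show ?case using is_ideal_ideal_power unfolding is_ideal_def by metis
next
  case (Suc d)
  let ?x = "coords P" and ?J = "ideal_power (point_ideal P) 2"
  let ?L = "tangent_form ?x a"
  obtain u m' where m: "m = Poly_Mapping.single u 1 + m'" and m': "mdeg m' = d"
    using split_variable[OF Suc.prems] .
  define f :: "(3, 'k) mpol" where "f = Poly_Mapping.single m' 1"
  have mf: "Poly_Mapping.single m 1 = var u * f" by (simp add: m f_def mult_single)
  have IH: "taylor_remainder ?x a d f \<in> ?J" using Suc.IH[OF m'] by (simp add: f_def)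
  have ev: "mpol_eval ?x (var u * f) = ?x u * mpol_eval ?x f"
    by (simp add: mpol_eval_mult) (simp add: mpol_eval_eq coeff_sum_single)
  have pu: "partial_at ?x v (var u) = (if v = u then 1 else 0)" for v
    unfolding partial_at_def coeff_sum_single partial_weight_def
    by (simp add: lookup_single when_def)
  have pa: "partial_at ?x v (var u * f) =
      (if v = u then mpol_eval ?x f else 0) + ?x u * partial_at ?x v f" for v
    unfolding partial_at_mult pu by (simp add: mpol_eval_eq coeff_sum_single)
  \<comment> \<open>for \<open>d = 0\<close> the exponent \<open>d - 1\<close> truncates, but then \<open>f\<close> is constant and the derivative is zero\<close>
  have d0: "cst (partial_at ?x v f) * (var a * var a ^ (d - 1)) =
      (cst (partial_at ?x v f) * var a ^ d :: (3, 'k) mpol)" for v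
    using m' by (cases d) (auto simp: f_def partial_at_def coeff_sum_single partial_weight_def
        monomial_value_def)
  have xu: "cst (?x a) * var u = ?L u + cst (?x u) * var a" by (simp add: tangent_form_def)
  have *: "taylor_remainder ?x a (Suc d) (var u * f) =
     cst (?x a) * var u * taylor_remainder ?x a d f +
     (\<Sum>v\<in>UNIV. (cst (partial_at ?x v f) * var a ^ (d - 1)) * (?L u * ?L v))"
  proof -
    have 1: "cst (?x a ^ Suc d) * (var u * f) = cst (?x a) * var u * (cst (?x a ^ d) * f)"
      by (simp add: cst_mult mult_ac)
    have 2: "cst (?x a) * var u * (cst (mpol_eval ?x f) * var a ^ d) =
       cst (mpol_eval ?x (var u * f)) * var a ^ Suc d + cst (mpol_eval ?x f) * var a ^ d * ?L u"
      unfolding xu ev by (simp add: cst_mult algebra_simps)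
    have 3: "cst (?x a) * var u * (cst (partial_at ?x v f) * var a ^ (d - 1) * ?L v) =
       (cst (partial_at ?x v f) * var a ^ (d - 1)) * (?L u * ?L v) +
       cst (?x u * partial_at ?x v f) * var a ^ d * ?L v" for v
    proof -
      have "cst (?x a) * var u * (cst (partial_at ?x v f) * var a ^ (d - 1) * ?L v) =
       (cst (partial_at ?x v f) * var a ^ (d - 1)) * (?L u * ?L v) +
       cst (?x u) * (cst (partial_at ?x v f) * (var a * var a ^ (d - 1))) * ?L v"
        unfolding xu by (simp add: algebra_simps)
      then show ?thesis unfolding d0 by (simp add: cst_mult mult_ac)
    qed
    have 4: "(\<Sum>v\<in>UNIV. cst (partial_at ?x v (var u * f)) * var a ^ d * ?L v) =
       cst (mpol_eval ?x f) * var a ^ d * ?L u +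
       (\<Sum>v\<in>UNIV. cst (?x u * partial_at ?x v f) * var a ^ d * ?L v)"
    proof -
      have "cst (partial_at ?x v (var u * f)) * var a ^ d * ?L v =
         (if v = u then cst (mpol_eval ?x f) * var a ^ d * ?L u else 0) +
         cst (?x u * partial_at ?x v f) * var a ^ d * ?L v" for v
        unfolding pa by (auto simp: single_add distrib_right)
      then show ?thesis by (simp add: sum.distrib)
    qed
    show ?thesis
      unfolding taylor_remainder_def right_diff_distrib 1 2 sum_distrib_left 3 sum.distrib
        diff_Suc_1 4
      by (simp only: algebra_simps)
  qed
  have "(\<Sum>v\<in>UNIV. (cst (partial_at ?x v f) * var a ^ (d - 1)) * (?L u * ?L v)) \<in> ?J"
    by (intro is_ideal_sum is_ideal_mult is_ideal_ideal_power mult_in_square tangent_form_in_point_ideal)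
  then show ?case unfolding mf *
    by (intro is_ideal_add is_ideal_mult IH is_ideal_ideal_power)
qed

lemma taylor_remainder_form:
  assumes "f \<in> forms d"
  shows "taylor_remainder (coords P) a d f \<in> ideal_power (point_ideal P) 2"
proof -
  let ?x = "coords P" and ?mon = "\<lambda>m. Poly_Mapping.single m 1"
  let ?K = "Poly_Mapping.keys f" and ?c = "Poly_Mapping.lookup f"
  have f: "f = (\<Sum>m\<in>?K. cst (?c m) * ?mon m)"
    by (simp add: mult_single sum_single_keys)
  have cs: "coeff_sum w f = (\<Sum>m\<in>?K. ?c m * coeff_sum w (?mon m))" for w
    by (simp add: coeff_sum_single) (simp add: coeff_sum_def)
  have cst_sum: "cst (\<Sum>i\<in>A. c i) = (\<Sum>i\<in>A. cst (c i) :: (3, 'a) mpol)" for A :: "(3 \<Rightarrow>\<^sub>0 nat) set" and c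
    by (induction A rule: infinite_finite_induct) (auto simp: single_add)
  have "taylor_remainder ?x a d f = (\<Sum>m\<in>?K. cst (?c m) * taylor_remainder ?x a d (?mon m))"
  proof -
    have 1: "cst (?x a ^ d) * f = (\<Sum>m\<in>?K. cst (?c m) * (cst (?x a ^ d) * ?mon m))"
      by (subst (1) f) (simp only: sum_distrib_left mult.left_commute)
    have 2: "cst (mpol_eval ?x f) * var a ^ d =
        (\<Sum>m\<in>?K. cst (?c m) * (cst (mpol_eval ?x (?mon m)) * var a ^ d))"
      unfolding mpol_eval_eq cs[of "monomial_value ?x"] cst_sum cst_mult sum_distrib_right mult.assoc ..
    have 3: "(\<Sum>v\<in>UNIV. cst (partial_at ?x v f) * var a ^ (d - 1) * tangent_form ?x a v) =
        (\<Sum>m\<in>?K. cst (?c m) *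
           (\<Sum>v\<in>UNIV. cst (partial_at ?x v (?mon m)) * var a ^ (d - 1) * tangent_form ?x a v))"
      unfolding partial_at_def cs[of "partial_weight ?x _"] cst_sum cst_mult sum_distrib_right
        sum_distrib_left mult.assoc
 by (rule sum.swap)
    show ?thesis
      unfolding taylor_remainder_def 1 2 3 right_diff_distrib sum_subtractf ..
  qed
  also have "\<dots> \<in> ideal_power (point_ideal P) 2"
    by (intro is_ideal_sum is_ideal_mult is_ideal_ideal_power taylor_remainder_monomial)
       (use assms in \<open>auto simp: forms_iff\<close>)
  finally show ?thesis .
qed

lemma coords_nonzero: "\<exists>j. coords P j \<noteq> 0"
proof -
  have "proj_rel (rep_p2 P) (rep_p2 P)" by (rule Quotient3_rep_reflp[OF Quotient3_p2])
  then have "rep_p2 P \<noteq> 0" by (simp add: proj_rel_def)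
  then show ?thesis by (auto simp: coords_def Finite_Cartesian_Product.vec_eq_iff)
qed

text \<open>
  In characteristic zero Euler's identity makes the value vanish as soon as the partial derivatives do,
  and then the Taylor remainder is a nonzero constant times the form.  Degree zero must be excluded,
  because all derivatives of a nonzero constant vanish.
\<close>

lemma form_in_square_iff:
  fixes P :: "'k::field_char_0 p2"
  assumes f: "f \<in> forms d" and d: "d \<ge> 1"
  shows "f \<in> ideal_power (point_ideal P) 2 \<longleftrightarrow> (\<forall>e. partial_at (coords P) e f = 0)"
proof
  assume "f \<in> ideal_power (point_ideal P) 2"
  then show "\<forall>e. partial_at (coords P) e f = 0" by (simp add: square_vanishes(2))
next
  let ?x = "coords P"
  assume 0: "\<forall>e. partial_at ?x e f = 0"
  with Euler_identity[OF f, of ?x] d have "mpol_eval ?x f = 0" by simp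
  with 0 have "taylor_remainder ?x a d f = cst (?x a ^ d) * f" for a
    by (simp add: taylor_remainder_def)
  then have *: "cst (?x a ^ d) * f \<in> ideal_power (point_ideal P) 2" for a
    using taylor_remainder_form[OF f, of P a] by simp
  obtain a where a: "?x a \<noteq> 0" using coords_nonzero by blast
  have "cst (inverse (?x a ^ d)) * (cst (?x a ^ d) * f) \<in> ideal_power (point_ideal P) 2"
    by (rule is_ideal_mult[OF is_ideal_ideal_power *])
  also have "cst (inverse (?x a ^ d)) * (cst (?x a ^ d) * f) = f"
    using a by (simp add: mult.assoc[symmetric] cst_mult[symmetric])
  finally show "f \<in> ideal_power (point_ideal P) 2" .
qed

lemma scheme_ideal_double:
  assumes "distinct Ps"
  shows "scheme_ideal (mset Ps + mset Ps) = (\<Inter>P\<in>set Ps. ideal_power (point_ideal P) 2)"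
proof -
  have "count (mset Ps + mset Ps) P = 2" if "P \<in> set Ps" for P
    using that assms by (simp add: distinct_count_atmost_1 numeral_2_eq_2)
  then show ?thesis by (simp add: scheme_ideal_def)
qed

section \<open>Dimension of a quotient space\<close>

interpretation mp: vector_space "mpol_scale :: 'k::field \<Rightarrow> ('v, 'k) mpol \<Rightarrow> ('v, 'k) mpol"
  by unfold_locales
     (simp_all add: mpol_scale_def distrib_left distrib_right single_add mult_single mult.assoc[symmetric])

definition independent_modulo :: "('v, 'k::field) mpol set \<Rightarrow> ('v, 'k) mpol set \<Rightarrow> bool" where
  "independent_modulo W B \<longleftrightarrow> (\<forall>c. (\<Sum>b\<in>B. mpol_scale (c b) b) \<in> W \<longrightarrow> (\<forall>b\<in>B. c b = 0))"

lemma independent_moduloD: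
  "independent_modulo W B \<Longrightarrow> (\<Sum>b\<in>B. mpol_scale (c b) b) \<in> W \<Longrightarrow> b \<in> B \<Longrightarrow> c b = 0"
  unfolding independent_modulo_def by blast

text \<open>
  A relation between \<open>K\<close> and \<open>B\<close> puts a combination of \<open>B\<close> into \<open>W\<close>, so its coefficients on \<open>B\<close> vanish,
  and then so do those on \<open>K\<close>.
\<close>

lemma independent_modulo_union:
  fixes W :: "('v, 'k::field) mpol set"
  assumes W: "mp.subspace W" and K: "finite K" "mp.independent K" "K \<subseteq> W"
    and B: "finite B" "independent_modulo W B"
  shows "K \<inter> B = {}" "mp.independent (K \<union> B)"
proof -
  show disj: "K \<inter> B = {}"
  proof (rule ccontr)
    assume "K \<inter> B \<noteq> {}"
    then obtain b where b: "b \<in> K" "b \<in> B" by blast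
    have "(\<Sum>v\<in>B. mpol_scale (if v = b then 1 else 0) v) = (\<Sum>v\<in>B. if v = b then b else 0)"
      by (rule sum.cong) auto
    also have "\<dots> = b" using b B(1) by simp
    finally have "(\<Sum>v\<in>B. mpol_scale (if v = b then 1 else 0) v) \<in> W" using b K(3) by auto
    from independent_moduloD[OF B(2) this b(2)] show False by simp
  qed
  show "mp.independent (K \<union> B)"
    unfolding mp.dependent_finite[OF finite_UnI[OF K(1) B(1)]]
  proof clarify
    fix u v assume 0: "(\<Sum>v\<in>K \<union> B. mpol_scale (u v) v) = 0" and v: "v \<in> K \<union> B" "u v \<noteq> 0"
    have s: "(\<Sum>v\<in>K. mpol_scale (u v) v) + (\<Sum>v\<in>B. mpol_scale (u v) v) = 0"
      using 0 by (simp add: sum.union_disjoint K(1) B(1) disj)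
    have "(\<Sum>v\<in>K. mpol_scale (u v) v) \<in> W"
      by (intro mp.subspace_sum W mp.subspace_scale) (use K in auto)
    then have "- (\<Sum>v\<in>K. mpol_scale (u v) v) \<in> W" by (rule mp.subspace_neg[OF W])
    also have "- (\<Sum>v\<in>K. mpol_scale (u v) v) = (\<Sum>v\<in>B. mpol_scale (u v) v)"
      using s by (simp add: add_eq_0_iff)
    finally have uB: "\<forall>v\<in>B. u v = 0" using independent_moduloD[OF B(2)] by blast
    then have "(\<Sum>v\<in>B. mpol_scale (u v) v) = 0" by simp
    with s have "(\<Sum>v\<in>K. mpol_scale (u v) v) = 0" by simp
    then have "\<forall>v\<in>K. u v = 0" using mp.independentD[OF K(2,1) subset_refl] by blast
    with uB v show False by auto
  qed
qed

text \<open>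
  Adjoining a basis of \<open>V \<inter> W\<close> turns the bases of \<open>V\<close> modulo \<open>W\<close> into bases of \<open>V\<close>.  So all of them have the
  same size, which makes \<open>quotient_dim\<close> well defined and gives the dimension formula.
\<close>

lemma quotient_dim_basis:
  fixes V W :: "('v, 'k::field) mpol set"
  assumes V: "mp.subspace V" and W: "mp.subspace W" and S: "finite S" "V \<subseteq> mp.span S"
  shows "\<exists>B. basis_modulo V W B \<and> card B = quotient_dim V W"
    and "quotient_dim V W + mp.dim (V \<inter> W) = mp.dim V"
    and "\<And>B. finite B \<Longrightarrow> B \<subseteq> V \<Longrightarrow> independent_modulo W B \<Longrightarrow> card B \<le> quotient_dim V W"
proof -
  obtain K where K: "K \<subseteq> V \<inter> W" "mp.independent K" "V \<inter> W \<subseteq> mp.span K" "card K = mp.dim (V \<inter> W)"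
    by (rule mp.basis_exists)
  have fin: "finite C \<and> card C \<le> mp.dim V" if C: "mp.independent C" "C \<subseteq> V" for C
  proof -
    obtain T where T: "C \<subseteq> T" "T \<subseteq> V" "mp.independent T" "V \<subseteq> mp.span T"
      using mp.maximal_independent_subset_extend[OF C(2,1)] by metis
    have "finite T" using mp.independent_span_bound[OF S(1) T(3)] T(2) S(2) by blast
    with T(1) show ?thesis
      using mp.dim_unique[OF T(2,4,3) refl] card_mono[of T C] finite_subset[of C T] by auto
  qed
  have fK: "finite K" using fin K by blast
  have KW: "K \<subseteq> W" "K \<subseteq> V" using K by auto
  have spanK: "mp.span K = V \<inter> W"
    using K(1,3) mp.span_minimal[OF K(1) mp.subspace_inter[OF V W]] by blast
  have ex: "\<exists>B. basis_modulo V W B"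
  proof -
    obtain T where T: "K \<subseteq> T" "T \<subseteq> V" "mp.independent T" "V \<subseteq> mp.span T"
      using mp.maximal_independent_subset_extend[OF KW(2) K(2)] by metis
    have fT: "finite T" using fin T by blast
    have "basis_modulo V W (T - K)" unfolding basis_modulo_def
    proof (intro conjI allI ballI impI)
      show "finite (T - K)" "T - K \<subseteq> V" using fT T by auto
    next
      fix c b assume c: "(\<Sum>b\<in>T - K. mpol_scale (c b) b) \<in> W" and b: "b \<in> T - K"
      have "(\<Sum>b\<in>T - K. mpol_scale (c b) b) \<in> V"
        by (intro mp.subspace_sum V mp.subspace_scale) (use T in auto)
      with c have "(\<Sum>b\<in>T - K. mpol_scale (c b) b) \<in> mp.span K" by (simp add: spanK)
      then obtain u where u: "(\<Sum>b\<in>T - K. mpol_scale (c b) b) = (\<Sum>b\<in>K. mpol_scale (u b) b)"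
        unfolding mp.span_finite[OF fK] by auto
      let ?w = "\<lambda>b. if b \<in> K then - u b else c b"
      have "(\<Sum>b\<in>T. mpol_scale (?w b) b) =
          (\<Sum>b\<in>T - K. mpol_scale (?w b) b) + (\<Sum>b\<in>K. mpol_scale (?w b) b)"
        by (rule sum.subset_diff[OF T(1) fT])
      also have "\<dots> = 0" by (simp add: u sum_negf)
      finally have "?w b = 0" by (rule mp.independentD[OF T(3) fT subset_refl]) (use b in blast)
      with b show "c b = 0" by auto
    next
      fix f assume "f \<in> V"
      then obtain u where u: "f = (\<Sum>b\<in>T. mpol_scale (u b) b)"
        using T(4) unfolding mp.span_finite[OF fT] by auto
      then have "f - (\<Sum>b\<in>T - K. mpol_scale (u b) b) = (\<Sum>b\<in>K. mpol_scale (u b) b)"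
        by (simp add: sum.subset_diff[OF T(1) fT])
      also have "\<dots> \<in> W" by (intro mp.subspace_sum W mp.subspace_scale) (use KW in auto)
      finally show "\<exists>c. f - (\<Sum>b\<in>T - K. mpol_scale (c b) b) \<in> W" by blast
    qed
    then show ?thesis ..
  qed
  have card: "card B + mp.dim (V \<inter> W) \<le> mp.dim V"
    if B: "finite B" "B \<subseteq> V" "independent_modulo W B" for B
  proof -
    note * = independent_modulo_union[OF W fK K(2) KW(1) B(1,3)]
    have "card (K \<union> B) \<le> mp.dim V" using fin[OF *(2)] B KW by blast
    then show ?thesis using *(1) K(4) fK B by (simp add: card_Un_disjoint)
  qed
  have card_eq: "card B + mp.dim (V \<inter> W) = mp.dim V" if bm: "basis_modulo V W B" for B
  proof -
    have B: "finite B" "B \<subseteq> V" "independent_modulo W B"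
      and sp: "\<And>f. f \<in> V \<Longrightarrow> \<exists>c. f - (\<Sum>b\<in>B. mpol_scale (c b) b) \<in> W"
      using bm by (auto simp: basis_modulo_def independent_modulo_def)
    note * = independent_modulo_union[OF W fK K(2) KW(1) B(1,3)]
    have "V \<subseteq> mp.span (K \<union> B)"
    proof
      fix f assume f: "f \<in> V"
      obtain c where c: "f - (\<Sum>b\<in>B. mpol_scale (c b) b) \<in> W" using sp[OF f] by blast
      have "(\<Sum>b\<in>B. mpol_scale (c b) b) \<in> V"
        by (intro mp.subspace_sum V mp.subspace_scale) (use B in auto)
      then have "f - (\<Sum>b\<in>B. mpol_scale (c b) b) \<in> mp.span K"
        using c f V by (simp add: spanK mp.subspace_diff)
      then have 1: "f - (\<Sum>b\<in>B. mpol_scale (c b) b) \<in> mp.span (K \<union> B)"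
        using mp.span_mono[of K "K \<union> B"] by blast
      have "(\<Sum>b\<in>B. mpol_scale (c b) b) \<in> mp.span (K \<union> B)"
        by (intro mp.span_sum mp.span_scale mp.span_base) auto
      from mp.span_add[OF 1 this] show "f \<in> mp.span (K \<union> B)" by simp
    qed
    moreover have "K \<union> B \<subseteq> V" using B KW by blast
    ultimately have "mp.dim V = card (K \<union> B)" using *(2) by (intro mp.dim_unique) auto
    then show ?thesis using *(1) K(4) fK B by (simp add: card_Un_disjoint)
  qed
  have eq: "quotient_dim V W = card B" if "basis_modulo V W B" for B
    unfolding quotient_dim_def
  proof (rule the_equality)
    show "\<exists>B'. basis_modulo V W B' \<and> card B' = card B" using that by blast
    fix n assume "\<exists>B. basis_modulo V W B \<and> card B = n"
    then show "n = card B" using card_eq[OF that] card_eq by force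
  qed
  from ex obtain B where B: "basis_modulo V W B" by blast
  from B eq[OF B] show "\<exists>B. basis_modulo V W B \<and> card B = quotient_dim V W" by auto
  show q: "quotient_dim V W + mp.dim (V \<inter> W) = mp.dim V" using eq[OF B] card_eq[OF B] by simp
  show "card B \<le> quotient_dim V W" if "finite B" "B \<subseteq> V" "independent_modulo W B" for B
    using card[OF that] q by linarith
qed

section \<open>Minors\<close>

text \<open>
  Here \<open>\<phi> r j\<close> is the value of the \<open>r\<close>-th functional on the \<open>j\<close>-th vector of a family; a list of \<open>n\<close>
  functionals is applied to the first \<open>n\<close> vectors.
\<close>

definition minor :: "('r \<Rightarrow> nat \<Rightarrow> 'k::comm_ring_1) \<Rightarrow> 'r list \<Rightarrow> 'k" where
  "minor \<phi> rs = Determinant.det (Matrix.mat (length rs) (length rs) (\<lambda>(i, j). \<phi> (rs ! i) j))"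

text \<open>
  The rows are found one at a time: expanding the next larger determinant along its new row gives
  a combination of the columns whose last coefficient is the previous minor, so by independence
  some row makes it nonzero.
\<close>

lemma nonzero_minor_exists:
  fixes \<phi> :: "'r \<Rightarrow> nat \<Rightarrow> 'k::field"
  assumes "\<And>c. (\<And>r. r \<in> R \<Longrightarrow> (\<Sum>j<n. c j * \<phi> r j) = 0) \<Longrightarrow> (\<forall>j<n. c j = 0)"
  shows "\<exists>rs. length rs = n \<and> set rs \<subseteq> R \<and> minor \<phi> rs \<noteq> 0"
  using assms
proof (induction n)
  case 0
  show ?case by (intro exI[of _ "[]"]) (simp add: minor_def)
next
  case (Suc n)
  have "\<exists>rs. length rs = n \<and> set rs \<subseteq> R \<and> minor \<phi> rs \<noteq> 0"
  proof (rule Suc.IH)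
    fix c assume c: "\<And>r. r \<in> R \<Longrightarrow> (\<Sum>j<n. c j * \<phi> r j) = 0"
    have "\<forall>j<Suc n. (if j < n then c j else 0) = 0"
      by (rule Suc.prems) (use c in simp)
    then show "\<forall>j<n. c j = 0" by (metis less_Suc_eq)
  qed
  then obtain rs where rs: "length rs = n" "set rs \<subseteq> R" "minor \<phi> rs \<noteq> 0" by blast
  define A where "A r = Matrix.mat (Suc n) (Suc n) (\<lambda>(i, j). \<phi> ((rs @ [r]) ! i) j)" for r
  define c where "c j = cofactor (A undefined) n j" for j
  have del: "mat_delete (A r) n j = mat_delete (A r') n j" for r r' j
    by (rule eq_matI) (auto simp: mat_delete_def A_def nth_append rs(1))
  have cof: "cofactor (A r) n j = c j" for r j
    by (simp add: cofactor_def c_def del[of r j undefined])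
  have exp: "minor \<phi> (rs @ [r]) = (\<Sum>j<Suc n. c j * \<phi> r j)" for r
  proof -
    have "minor \<phi> (rs @ [r]) = Determinant.det (A r)" by (simp add: minor_def A_def rs(1))
    also have "\<dots> = (\<Sum>j<Suc n. A r $$ (n, j) * cofactor (A r) n j)"
      by (rule laplace_expansion_row) (auto simp: A_def)
    also have "\<dots> = (\<Sum>j<Suc n. c j * \<phi> r j)"
    proof (rule sum.cong[OF refl])
      fix j assume "j \<in> {..<Suc n}"
      then have "A r $$ (n, j) = \<phi> r j" by (simp add: A_def nth_append rs(1))
      then show "A r $$ (n, j) * cofactor (A r) n j = c j * \<phi> r j" by (simp add: cof)
    qed
    finally show ?thesis .
  qed
  have "c n = minor \<phi> rs"
  proof -
    have "mat_delete (A undefined) n n = Matrix.mat n n (\<lambda>(i, j). \<phi> (rs ! i) j)"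
      by (rule eq_matI) (auto simp: mat_delete_def A_def nth_append rs(1))
    then show ?thesis by (simp add: c_def cofactor_def minor_def rs(1))
  qed
  with rs(3) have "\<not> (\<forall>j<Suc n. c j = 0)" by auto
  with Suc.prems[of c] obtain r where r: "r \<in> R" "(\<Sum>j<Suc n. c j * \<phi> r j) \<noteq> 0" by blast
  show ?case
    by (rule exI[of _ "rs @ [r]"]) (use rs r in \<open>simp add: exp\<close>)
qed

lemma nonzero_minor_independent:
  fixes \<phi> :: "'r \<Rightarrow> nat \<Rightarrow> 'k::field"
  assumes "minor \<phi> rs \<noteq> 0" and c: "\<And>r. r \<in> set rs \<Longrightarrow> (\<Sum>j<length rs. c j * \<phi> r j) = 0"
    and "j < length rs"
  shows "c j = 0"
proof (rule ccontr)
  assume "c j \<noteq> 0"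
  let ?n = "length rs"
  let ?A = "Matrix.mat ?n ?n (\<lambda>(i, j). \<phi> (rs ! i) j)" and ?v = "Matrix.vec ?n c"
  have "?v \<noteq> 0\<^sub>v ?n" using \<open>c j \<noteq> 0\<close> assms(3) by (metis index_vec index_zero_vec(1))
  moreover have "?A *\<^sub>v ?v = 0\<^sub>v ?n"
    by (rule eq_vecI) (auto simp: scalar_prod_def c mult.commute simp flip: lessThan_atLeast0)
  ultimately have "\<exists>v. v \<in> carrier_vec ?n \<and> v \<noteq> 0\<^sub>v ?n \<and> ?A *\<^sub>v v = 0\<^sub>v ?n"
    by (intro exI[of _ ?v]) simp
  then have "Determinant.det ?A = 0"
    using det_0_iff_vec_prod_zero_field[of ?A ?n] by simp
  with assms(1) show False by (simp add: minor_def)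
qed

lemma nonzero_minor_distinct:
  assumes "minor \<phi> rs \<noteq> 0"
  shows "distinct rs"
  unfolding distinct_conv_nth
proof (intro allI impI notI)
  fix i j assume ij: "i < length rs" "j < length rs" "i \<noteq> j" "rs ! i = rs ! j"
  have "minor \<phi> rs = 0" unfolding minor_def
    by (rule det_identical_rows[OF _ ij(3,1,2)]) (use ij in auto)
  with assms show False by simp
qed

section \<open>The space of ternary forms\<close>

lemma subspace_forms: "mp.subspace (forms d)"
  unfolding mp.subspace_def by (auto intro: forms_add forms_scale)

lemma subspace_ideal: "is_ideal W \<Longrightarrow> mp.subspace W"
  unfolding mp.subspace_def by (auto simp: is_ideal_def mpol_scale_def)

definition lattice_triangle :: "nat \<Rightarrow> (nat \<times> nat) set" where
  "lattice_triangle d = {(x, y). x + y \<le> d}"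

text \<open>Lattice points of the lattice_triangle stand for monomials of degree \<open>d\<close> in three variables.\<close>

definition exponent :: "nat \<Rightarrow> nat \<times> nat \<Rightarrow> (3 \<Rightarrow>\<^sub>0 nat)" where
  "exponent d = (\<lambda>(x, y). Poly_Mapping.single 1 (d - x - y) + Poly_Mapping.single 2 x
     + Poly_Mapping.single 3 y)"

lemma lookup_exponent:
  "Poly_Mapping.lookup (exponent d (x, y)) 1 = d - x - y"
  "Poly_Mapping.lookup (exponent d (x, y)) 2 = x"
  "Poly_Mapping.lookup (exponent d (x, y)) 3 = y"
  by (auto simp: exponent_def lookup_add lookup_single)

lemma mdeg_exponent: "p \<in> lattice_triangle d \<Longrightarrow> mdeg (exponent d p) = d"
  by (auto simp: lattice_triangle_def exponent_def mdeg_add)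

lemma exponent_image: "exponent d ` lattice_triangle d = {m. mdeg m = d}"
proof
  show "exponent d ` lattice_triangle d \<subseteq> {m. mdeg m = d}" by (auto simp: mdeg_exponent)
  show "{m. mdeg m = d} \<subseteq> exponent d ` lattice_triangle d"
  proof
    fix m :: "3 \<Rightarrow>\<^sub>0 nat" assume "m \<in> {m. mdeg m = d}"
    then have d: "Poly_Mapping.lookup m 1 + Poly_Mapping.lookup m 2 + Poly_Mapping.lookup m 3 = d"
      by (simp add: mdeg_UNIV sum_3)
    let ?p = "(Poly_Mapping.lookup m 2, Poly_Mapping.lookup m 3)"
    have "m = exponent d ?p"
    proof (rule poly_mapping_eqI)
      fix v :: 3
      show "Poly_Mapping.lookup m v = Poly_Mapping.lookup (exponent d ?p) v"
        using exhaust_3[of v] d by (auto simp: lookup_exponent)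
    qed
    moreover have "?p \<in> lattice_triangle d" using d by (auto simp: lattice_triangle_def)
    ultimately show "m \<in> exponent d ` lattice_triangle d" by blast
  qed
qed

lemma inj_exponent: "inj (exponent d)"
  by (rule injI) (metis lookup_exponent(2,3) prod.collapse)

lemma finite_triangle [simp]: "finite (lattice_triangle d)"
proof -
  have "lattice_triangle d \<subseteq> {..d} \<times> {..d}" by (auto simp: lattice_triangle_def)
  then show ?thesis by (rule finite_subset) simp
qed

lemma card_triangle: "2 * card (lattice_triangle d) = (d + 1) * (d + 2)"
proof (induction d)
  case 0
  have "lattice_triangle 0 = {(0, 0)}" by (auto simp: lattice_triangle_def)
  then show ?case by simp
next
  case (Suc d)
  have eq: "lattice_triangle (Suc d) = lattice_triangle d \<union> (\<lambda>x. (x, Suc d - x)) ` {..Suc d}"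
    by (auto simp: lattice_triangle_def image_iff)
  have "card (lattice_triangle (Suc d)) = card (lattice_triangle d) + card ((\<lambda>x. (x, Suc d - x)) ` {..Suc d})"
    unfolding eq by (rule card_Un_disjoint) (simp, simp, auto simp: lattice_triangle_def)
  also have "card ((\<lambda>x. (x, Suc d - x)) ` {..Suc d}) = d + 2"
    by (subst card_image) (auto simp: inj_on_def)
  finally show ?case using Suc by simp
qed

definition monom3 :: "nat \<Rightarrow> nat \<times> nat \<Rightarrow> (3, 'k::field) mpol" where
  "monom3 d p = Poly_Mapping.single (exponent d p) 1"

lemma monom3_forms: "p \<in> lattice_triangle d \<Longrightarrow> monom3 d p \<in> forms d"
  by (simp add: monom3_def forms_iff mdeg_exponent)

lemma inj_monom3: "inj (monom3 d :: _ \<Rightarrow> (3, 'k::field) mpol)"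
proof (rule injI)
  fix p q assume "(monom3 d p :: (3, 'k) mpol) = monom3 d q"
  then have "Poly_Mapping.keys (monom3 d p :: (3, 'k) mpol) = Poly_Mapping.keys (monom3 d q :: (3, 'k) mpol)"
    by simp
  then show "p = q" using inj_exponent[of d] by (simp add: monom3_def inj_eq)
qed

lemma forms_subset_span: "forms d \<subseteq> mp.span (monom3 d ` lattice_triangle d)"
proof
  fix f :: "(3, 'k::field) mpol" assume f: "f \<in> forms d"
  have "(\<Sum>m\<in>Poly_Mapping.keys f. mpol_scale (Poly_Mapping.lookup f m) (Poly_Mapping.single m 1))
      \<in> mp.span (monom3 d ` lattice_triangle d)"
  proof (intro mp.span_sum mp.span_scale mp.span_base)
    fix m assume "m \<in> Poly_Mapping.keys f"
    then have "m \<in> exponent d ` lattice_triangle d" using f by (simp add: exponent_image forms_iff)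
    then show "Poly_Mapping.single m 1 \<in> monom3 d ` lattice_triangle d" by (auto simp: monom3_def)
  qed
  then show "f \<in> mp.span (monom3 d ` lattice_triangle d)"
    by (simp add: mpol_scale_def mult_single sum_single_keys)
qed

lemma independent_monom3: "mp.independent (monom3 d ` lattice_triangle d :: (3, 'k::field) mpol set)"
  unfolding mp.dependent_finite[OF finite_imageI[OF finite_triangle]]
proof clarify
  fix u :: "(3, 'k) mpol \<Rightarrow> 'k" and p
  assume 0: "(\<Sum>v\<in>monom3 d ` lattice_triangle d. mpol_scale (u v) v) = 0" and p: "p \<in> lattice_triangle d"
    and u: "u (monom3 d p) \<noteq> 0"
  have "0 = Poly_Mapping.lookup (\<Sum>q\<in>lattice_triangle d. mpol_scale (u (monom3 d q)) (monom3 d q)) (exponent d p)"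
    using 0 by (simp add: sum.reindex[OF inj_on_subset[OF inj_monom3 subset_UNIV]])
  also have "\<dots> = (\<Sum>q\<in>lattice_triangle d. if q = p then u (monom3 d p) else 0)"
    unfolding lookup_sum
    by (rule sum.cong) (auto simp: mpol_scale_def monom3_def mult_single lookup_single when_def
        inj_eq[OF inj_exponent])
  also have "\<dots> = u (monom3 d p)" using p by simp
  finally show False using u by simp
qed

lemma dim_forms: "mp.dim (forms d :: (3, 'k::field) mpol set) = card (lattice_triangle d)"
proof -
  have "mp.dim (forms d :: (3, 'k) mpol set) = card (monom3 d ` lattice_triangle d :: (3, 'k) mpol set)"
    by (rule mp.dim_unique[OF _ forms_subset_span independent_monom3 refl]) (auto simp: monom3_forms)
  also have "\<dots> = card (lattice_triangle d)"
    by (rule card_image[OF inj_on_subset[OF inj_monom3 subset_UNIV]])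
  finally show ?thesis .
qed

section \<open>The Hilbert function of a set of double points\<close>

definition doubles :: "'k::field p2 list \<Rightarrow> (3, 'k) mpol set" where
  "doubles Ps = scheme_ideal (mset Ps + mset Ps)"

lemma is_ideal_doubles: "is_ideal (doubles Ps)"
  unfolding doubles_def scheme_ideal_def using is_ideal_ideal_power[unfolded is_ideal_def]
  by (auto simp: is_ideal_def)

lemma doubles_vanish:
  assumes "distinct Ps" "f \<in> doubles Ps" "P \<in> set Ps"
  shows "mpol_eval (coords P) f = 0"
  using assms square_vanishes(1) by (auto simp: doubles_def scheme_ideal_double)

lemma form_in_doubles_iff:
  fixes Ps :: "'k::field_char_0 p2 list"
  assumes "distinct Ps" "f \<in> forms d" "d \<ge> 1"
  shows "f \<in> doubles Ps \<longleftrightarrow> (\<forall>P\<in>set Ps. \<forall>e. partial_at (coords P) e f = 0)"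
  using assms by (simp add: doubles_def scheme_ideal_double form_in_square_iff)

lemmas doubles_quotient_dim =
  quotient_dim_basis[OF subspace_forms subspace_ideal[OF is_ideal_doubles]
    finite_imageI[OF finite_triangle] forms_subset_span]

abbreviation hilbert :: "'k::field p2 list \<Rightarrow> nat \<Rightarrow> nat" where
  "hilbert Ps \<equiv> hilbert_function (mset Ps + mset Ps)"

lemma hilbert_doubles: "hilbert Ps d = quotient_dim (forms d) (doubles Ps)"
  by (simp add: hilbert_function_def doubles_def)

lemma hilbert_le_triangle:
  fixes Ps :: "'k::field p2 list"
  shows "hilbert Ps d \<le> card (lattice_triangle d)"
  using doubles_quotient_dim(2)[of d Ps] by (simp add: hilbert_doubles dim_forms)

text \<open>
  A family indexed by numbers instead of a set: the columns of a minor are such a family.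
\<close>

lemma independent_family_le_hilbert:
  fixes Ps :: "'k::field p2 list"
  assumes fs: "\<And>j. j < n \<Longrightarrow> fs j \<in> forms d"
    and ind: "\<And>c j. (\<Sum>j<n. mpol_scale (c j) (fs j)) \<in> doubles Ps \<Longrightarrow> j < n \<Longrightarrow> c j = 0"
  shows "n \<le> hilbert Ps d"
proof -
  have inj: "inj_on fs {..<n}"
  proof (rule inj_onI, rule ccontr)
    fix i j assume ij: "i \<in> {..<n}" "j \<in> {..<n}" "fs i = fs j" "i \<noteq> j"
    \<comment> \<open>two equal members would satisfy this nontrivial relation\<close>
    let ?c = "\<lambda>l. (if l = i then 1 else 0) - (if l = j then 1 else 0 :: 'k)"
    have "mpol_scale (?c l) (fs l) = (if l = i then fs i else 0) - (if l = j then fs j else 0)" for l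
      by (auto simp: mp.scale_left_diff_distrib)
    then have "(\<Sum>l<n. mpol_scale (?c l) (fs l)) = fs i - fs j"
      using ij by (simp add: sum_subtractf)
    also have "\<dots> \<in> doubles Ps" using ij is_ideal_doubles by (auto simp: is_ideal_def)
    finally have "?c i = 0" using ind[of ?c i] ij by blast
    then show False using ij by simp
  qed
  have "independent_modulo (doubles Ps) (fs ` {..<n})"
    unfolding independent_modulo_def
    using ind inj by (auto simp: sum.reindex o_def)
  then have "card (fs ` {..<n}) \<le> hilbert Ps d"
    unfolding hilbert_doubles by (intro doubles_quotient_dim(3)) (use fs in auto)
  then show ?thesis by (simp add: card_image inj)
qed

lemma hilbert_family:
  fixes Ps :: "'k::field p2 list"
  shows "\<exists>fs. (\<forall>j<hilbert Ps d. fs j \<in> forms d) \<and>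
    (\<forall>c j. (\<Sum>j<hilbert Ps d. mpol_scale (c j) (fs j)) \<in> doubles Ps \<longrightarrow> j < hilbert Ps d \<longrightarrow> c j = 0)"
proof -
  obtain B where B: "basis_modulo (forms d) (doubles Ps) B" "card B = hilbert Ps d"
    unfolding hilbert_doubles using doubles_quotient_dim(1) by blast
  from B have fin: "finite B" "B \<subseteq> forms d" and ind: "independent_modulo (doubles Ps) B"
    by (auto simp: basis_modulo_def independent_modulo_def)
  obtain fs where fs: "bij_betw fs {..<hilbert Ps d} B"
    using ex_bij_betw_nat_finite[OF fin(1)] B(2) by (auto simp: lessThan_atLeast0)
  show ?thesis
  proof (intro exI[of _ fs] conjI allI impI)
    show "fs j \<in> forms d" if "j < hilbert Ps d" for j
      using fs fin(2) that by (auto simp: bij_betw_def)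
    fix c j assume c: "(\<Sum>j<hilbert Ps d. mpol_scale (c j) (fs j)) \<in> doubles Ps" and j: "j < hilbert Ps d"
    let ?g = "the_inv_into {..<hilbert Ps d} fs"
    have inv: "?g (fs i) = i" if "i < hilbert Ps d" for i
      using fs that by (intro the_inv_into_f_f) (auto simp: bij_betw_def)
    have "(\<Sum>b\<in>B. mpol_scale (c (?g b)) b) = (\<Sum>j<hilbert Ps d. mpol_scale (c (?g (fs j))) (fs j))"
      by (rule sum.reindex_bij_betw[OF fs, symmetric])
    also have "\<dots> = (\<Sum>j<hilbert Ps d. mpol_scale (c j) (fs j))"
      by (rule sum.cong) (auto simp: inv)
    finally have "c (?g (fs j)) = 0"
      using independent_moduloD[OF ind, of "\<lambda>b. c (?g b)" "fs j"] c fs j by (auto simp: bij_betw_def)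
    then show "c j = 0" by (simp add: inv j)
  qed
qed

text \<open>
  The first-order conditions at the points with coordinates \<open>x (i, _)\<close>, evaluated on a family of forms.
  The index \<open>(i, e)\<close> stands for the partial derivative in the variable \<open>e\<close> at the \<open>i\<close>-th point.
\<close>

definition jet :: "(nat \<times> 3 \<Rightarrow> 'k::field) \<Rightarrow> (nat \<Rightarrow> (3, 'k) mpol) \<Rightarrow> nat \<times> 3 \<Rightarrow> nat \<Rightarrow> 'k" where
  "jet x fs = (\<lambda>(i, e) j. partial_at (\<lambda>v. x (i, v)) e (fs j))"

definition all_coords :: "'k::field p2 list \<Rightarrow> nat \<times> 3 \<Rightarrow> 'k" where
  "all_coords Ps = (\<lambda>(i, j). coords (Ps ! i) j)"

lemma partial_at_combination:
  "partial_at x e (\<Sum>j\<in>A. mpol_scale (c j) (fs j)) = (\<Sum>j\<in>A. c j * partial_at x e (fs j))"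
  by (simp add: partial_at_def coeff_sum_sum coeff_sum_scale)

lemma forms_combination: "(\<And>j. j \<in> A \<Longrightarrow> fs j \<in> forms d) \<Longrightarrow> (\<Sum>j\<in>A. mpol_scale (c j) (fs j)) \<in> forms d"
  by (intro mp.subspace_sum subspace_forms forms_scale)

lemma minor_le_hilbert:
  fixes Ps :: "'k::field_char_0 p2 list"
  assumes Ps: "distinct Ps" "d \<ge> 1" and fs: "\<And>j. j < length rs \<Longrightarrow> fs j \<in> forms d"
    and rs: "set rs \<subseteq> {..<length Ps} \<times> UNIV" and minor: "minor (jet (all_coords Ps) fs) rs \<noteq> 0"
  shows "length rs \<le> hilbert Ps d"
proof (rule independent_family_le_hilbert[OF fs])
  fix c j assume c: "(\<Sum>j<length rs. mpol_scale (c j) (fs j)) \<in> doubles Ps" and j: "j < length rs"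
  have "(\<Sum>j<length rs. mpol_scale (c j) (fs j)) \<in> forms d"
    by (rule forms_combination) (use fs in auto)
  then have 0: "partial_at (coords (Ps ! i)) e (\<Sum>j<length rs. mpol_scale (c j) (fs j)) = 0"
    if "i < length Ps" for i e
    using c that form_in_doubles_iff[OF Ps(1) _ Ps(2)] by (metis nth_mem)
  show "c j = 0"
    by (rule nonzero_minor_independent[OF minor _ j])
       (use rs 0 in \<open>auto simp: jet_def all_coords_def partial_at_combination[symmetric]\<close>)
qed

lemma hilbert_minor:
  fixes Ps :: "'k::field_char_0 p2 list"
  assumes Ps: "distinct Ps" "d \<ge> 1"
  shows "\<exists>fs rs. (\<forall>j<length rs. fs j \<in> forms d) \<and> length rs = hilbert Ps d \<and>
    set rs \<subseteq> {..<length Ps} \<times> UNIV \<and> minor (jet (all_coords Ps) fs) rs \<noteq> 0"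
proof -
  obtain fs where fs: "\<And>j. j < hilbert Ps d \<Longrightarrow> fs j \<in> forms d"
    and ind: "\<And>c j. (\<Sum>j<hilbert Ps d. mpol_scale (c j) (fs j)) \<in> doubles Ps \<Longrightarrow>
      j < hilbert Ps d \<Longrightarrow> c j = 0"
    using hilbert_family[of Ps d] by blast
  have "\<exists>rs. length rs = hilbert Ps d \<and> set rs \<subseteq> {..<length Ps} \<times> UNIV \<and>
      minor (jet (all_coords Ps) fs) rs \<noteq> 0"
  proof (rule nonzero_minor_exists)
    fix c assume c: "\<And>r. r \<in> {..<length Ps} \<times> UNIV \<Longrightarrow>
      (\<Sum>j<hilbert Ps d. c j * jet (all_coords Ps) fs r j) = 0"
    have "(\<Sum>j<hilbert Ps d. mpol_scale (c j) (fs j)) \<in> forms d"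
      by (rule forms_combination) (use fs in auto)
    moreover have "partial_at (coords P) e (\<Sum>j<hilbert Ps d. mpol_scale (c j) (fs j)) = 0"
      if "P \<in> set Ps" for P e
      using that c[of "(_, e)"]
      by (auto simp: in_set_conv_nth jet_def all_coords_def partial_at_combination)
    ultimately have "(\<Sum>j<hilbert Ps d. mpol_scale (c j) (fs j)) \<in> doubles Ps"
      using form_in_doubles_iff[OF Ps(1) _ Ps(2)] by blast
    with ind show "\<forall>j<hilbert Ps d. c j = 0" by blast
  qed
  with fs show ?thesis by metis
qed

lemma minor_length_le:
  assumes "set rs \<subseteq> {..<t} \<times> (UNIV :: 3 set)" "minor \<phi> rs \<noteq> 0"
  shows "length rs \<le> 3 * t"
proof -
  have "length rs = card (set rs)" by (simp add: distinct_card nonzero_minor_distinct[OF assms(2)])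
  also have "\<dots> \<le> card ({..<t} \<times> (UNIV :: 3 set))" by (rule card_mono) (use assms in auto)
  finally show ?thesis by (simp add: card_cartesian_product)
qed

text \<open>
  There are three conditions for each point, and the rows of a nonzero minor are distinct.
\<close>

lemma hilbert_le_3t:
  fixes Ps :: "'k::field_char_0 p2 list"
  assumes "distinct Ps" "d \<ge> 1"
  shows "hilbert Ps d \<le> 3 * length Ps"
  using hilbert_minor[OF assms] minor_length_le by metis

lemma hilbert_0:
  fixes Ps :: "'k::field p2 list"
  assumes "distinct Ps" "Ps \<noteq> []"
  shows "hilbert Ps 0 = 1"
proof -
  have "forms 0 \<inter> doubles Ps = {0}"
  proof (intro equalityI subsetI)
    fix f assume f: "f \<in> forms 0 \<inter> doubles Ps"
    then have k: "Poly_Mapping.keys f \<subseteq> {0}" by (auto simp: forms_iff)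
    obtain P where "P \<in> set Ps" using assms by (cases Ps) auto
    then have "mpol_eval (coords P) f = 0" using doubles_vanish assms f by blast
    then have "Poly_Mapping.lookup f 0 = 0"
      by (simp add: mpol_eval_eq coeff_sum_superset[OF _ k])
    then have "0 \<notin> Poly_Mapping.keys f" by (simp add: in_keys_iff)
    with k have "Poly_Mapping.keys f = {}" by blast
    then show "f \<in> {0}" by simp
  qed (use is_ideal_doubles in \<open>auto simp: is_ideal_def\<close>)
  moreover have "lattice_triangle 0 = {(0, 0)}" by (auto simp: lattice_triangle_def)
  ultimately show ?thesis
    using doubles_quotient_dim(2)[of 0 Ps] mp.dim_unique[of "{}" "{0 :: (3, 'k) mpol}"]
    by (simp add: hilbert_doubles dim_forms mp.independent_empty)
qed

lemma var_mult_cancel: "var v * f = var v * g \<longleftrightarrow> f = (g :: (3, 'k::field) mpol)"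
proof -
  have "(var v :: (3, 'k) mpol) \<noteq> 0" by (metis keys_single keys_zero insert_not_empty one_neq_zero)
  then show ?thesis by (rule mult_left_cancel)
qed

text \<open>
  Multiplication by a variable embeds the degree \<open>d\<close> part of the ideal into the next one, while the space
  of all forms grows by \<open>d + 2\<close>.
\<close>

lemma hilbert_difference_le:
  fixes Ps :: "'k::field p2 list"
  shows "hilbert Ps (Suc d) \<le> hilbert Ps d + Suc (Suc d)"
proof -
  let ?K = "\<lambda>d. forms d \<inter> doubles Ps"
  obtain K where K: "K \<subseteq> ?K d" "mp.independent K" "?K d \<subseteq> mp.span K" "card K = mp.dim (?K d)"
    by (rule mp.basis_exists)
  have K': "(*) (var 1) ` K \<subseteq> ?K (Suc d)"
  proof (rule image_subsetI)
    fix f assume "f \<in> K"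
    with K(1) have "f \<in> forms d" "f \<in> doubles Ps" by auto
    then show "var 1 * f \<in> ?K (Suc d)"
      using forms_mult[OF var_forms[of 1], of f d] is_ideal_mult[OF is_ideal_doubles] by simp
  qed
  have inj: "inj_on ((*) (var 1 :: (3, 'k) mpol)) K"
    by (rule inj_onI) (simp only: var_mult_cancel)
  have fin: "finite K"
    using mp.independent_span_bound[OF finite_imageI[OF finite_triangle] K(2)] K(1) forms_subset_span by blast
  have ind: "mp.independent ((*) (var 1) ` K)"
    unfolding mp.dependent_finite[OF finite_imageI[OF fin]]
  proof clarify
    fix u v assume 0: "(\<Sum>w\<in>(*) (var 1) ` K. mpol_scale (u w) w) = 0" and v: "v \<in> K"
      and nz: "u (var 1 * v) \<noteq> 0"
    have "(\<Sum>w\<in>(*) (var 1) ` K. mpol_scale (u w) w) =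
        (\<Sum>w\<in>K. mpol_scale (u (var 1 * w)) (var 1 * w))"
      unfolding sum.reindex[OF inj] o_def ..
    also have "\<dots> = var 1 * (\<Sum>w\<in>K. mpol_scale (u (var 1 * w)) w)"
      by (simp only: mpol_scale_def sum_distrib_left mult.left_commute)
    finally have "var 1 * (\<Sum>w\<in>K. mpol_scale (u (var 1 * w)) w) = var 1 * 0" using 0 by simp
    then have "(\<Sum>w\<in>K. mpol_scale (u (var 1 * w)) w) = 0" by (simp only: var_mult_cancel)
    from mp.independentD[OF K(2) fin subset_refl this v] nz show False by simp
  qed
  obtain L where L: "(*) (var 1) ` K \<subseteq> L" "L \<subseteq> ?K (Suc d)" "mp.independent L" "?K (Suc d) \<subseteq> mp.span L"
    using mp.maximal_independent_subset_extend[OF K' ind] by metis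
  have "finite L"
    using mp.independent_span_bound[OF finite_imageI[OF finite_triangle] L(3)] L(2) forms_subset_span by blast
  then have "card ((*) (var 1) ` K) \<le> card L" by (intro card_mono L)
  moreover have "card ((*) (var 1) ` K) = card K"
    by (rule card_image[OF inj])
  moreover have "mp.dim (?K (Suc d)) = card L" by (rule mp.dim_unique[OF L(2,4,3) refl])
  ultimately have "mp.dim (?K d) \<le> mp.dim (?K (Suc d))" by (simp add: K(4))
  then show ?thesis
    using doubles_quotient_dim(2)[of d Ps] doubles_quotient_dim(2)[of "Suc d" Ps]
      card_triangle[of d] card_triangle[of "Suc d"]
    by (simp add: hilbert_doubles dim_forms)
qed

lemma nonroot_exists:
  fixes q :: "'k::field_char_0 poly"
  assumes "q \<noteq> 0"
  obtains s where "poly q s \<noteq> 0" "s \<noteq> 0"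
proof -
  have "finite {s. poly (q * [:0, 1:]) s = 0}" by (rule poly_roots_finite) (use assms in simp)
  then obtain s where "poly (q * [:0, 1:]) s \<noteq> 0"
    using infinite_UNIV_char_0[where 'a = 'k] by (metis (mono_tags) UNIV_eq_I mem_Collect_eq)
  then show thesis using that by auto
qed

text \<open>
  Multiplication by a linear form that vanishes at none of the points is injective modulo the ideal.
\<close>

lemma hilbert_mono:
  fixes Ps :: "'k::field_char_0 p2 list"
  assumes Ps: "distinct Ps" and d: "d \<ge> 1"
  shows "hilbert Ps d \<le> hilbert Ps (Suc d)"
proof -
  \<comment> \<open>the linear form with coefficients \<open>1, s, s * s\<close>: each point excludes the roots of one polynomial in \<open>s\<close>\<close>
  let ?q = "\<lambda>P :: 'k p2. [:coords P 1, coords P 2, coords P 3:]"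
  have "(\<Prod>P\<in>set Ps. ?q P) \<noteq> 0"
  proof
    assume "(\<Prod>P\<in>set Ps. ?q P) = 0"
    then obtain P where "?q P = 0" unfolding prod_zero_iff[OF finite_set] by blast
    then have "coords P j = 0" for j using exhaust_3[of j] by auto
    then show False using coords_nonzero[of P] by blast
  qed
  then obtain s where s: "poly (\<Prod>P\<in>set Ps. ?q P) s \<noteq> 0" by (rule nonroot_exists)
  define l where "l = var 1 + cst s * var 2 + cst (s * s) * (var 3 :: (3, 'k) mpol)"
  have l1: "l \<in> forms 1"
    unfolding l_def by (intro forms_add forms_scale[unfolded mpol_scale_def] var_forms)
  have lev: "mpol_eval (coords P) l \<noteq> 0" if "P \<in> set Ps" for P
  proof -
    have "mpol_eval (coords P) l = poly (?q P) s"
      by (simp add: l_def mpol_eval_eq coeff_sum_add mult_single coeff_sum_single algebra_simps)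
    then show ?thesis using s that by (auto simp: poly_prod)
  qed
  have cancel: "f \<in> doubles Ps" if f: "f \<in> forms d" and lf: "l * f \<in> doubles Ps" for f
    unfolding form_in_doubles_iff[OF Ps f d]
  proof (intro ballI allI)
    fix P e assume P: "P \<in> set Ps"
    have "mpol_eval (coords P) (l * f) = 0" by (rule doubles_vanish[OF Ps lf P])
    then have "mpol_eval (coords P) f = 0" using lev[OF P] by (simp add: mpol_eval_mult)
    moreover have "partial_at (coords P) e (l * f) = 0"
      using form_in_doubles_iff[OF Ps forms_mult[OF l1 f]] lf P by simp
    ultimately show "partial_at (coords P) e f = 0" using lev[OF P] by (simp add: partial_at_mult)
  qed
  obtain fs where fs: "\<And>j. j < hilbert Ps d \<Longrightarrow> fs j \<in> forms d"
    and ind: "\<And>c j. (\<Sum>j<hilbert Ps d. mpol_scale (c j) (fs j)) \<in> doubles Ps \<Longrightarrow>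
      j < hilbert Ps d \<Longrightarrow> c j = 0"
    using hilbert_family[of Ps d] by blast
  show ?thesis
  proof (rule independent_family_le_hilbert[where fs = "\<lambda>j. l * fs j"])
    show "l * fs j \<in> forms (Suc d)" if "j < hilbert Ps d" for j
      using forms_mult[OF l1 fs[OF that]] by simp
    fix c j assume c: "(\<Sum>j<hilbert Ps d. mpol_scale (c j) (l * fs j)) \<in> doubles Ps"
      and j: "j < hilbert Ps d"
    have "(\<Sum>j<hilbert Ps d. mpol_scale (c j) (l * fs j)) = l * (\<Sum>j<hilbert Ps d. mpol_scale (c j) (fs j))"
      by (simp add: mpol_scale_def sum_distrib_left mult.left_commute)
    moreover have "(\<Sum>j<hilbert Ps d. mpol_scale (c j) (fs j)) \<in> forms d"
      by (rule forms_combination) (use fs in auto)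
    ultimately have "(\<Sum>j<hilbert Ps d. mpol_scale (c j) (fs j)) \<in> doubles Ps"
      using cancel c by metis
    then show "c j = 0" using ind j by blast
  qed
qed

section \<open>Multihomogeneous polynomials\<close>

definition has_multidegree :: "nat \<Rightarrow> (nat \<Rightarrow> nat) \<Rightarrow> (nat \<times> 3, 'k::field) mpol \<Rightarrow> bool" where
  "has_multidegree t \<delta> f \<longleftrightarrow> (\<forall>m\<in>Poly_Mapping.keys f. Poly_Mapping.keys m \<subseteq> {..<t} \<times> UNIV \<and>
     (\<forall>i<t. (\<Sum>j\<in>UNIV. Poly_Mapping.lookup m (i, j)) = \<delta> i))"

lemma multihomogeneous_iff: "multihomogeneous t f \<longleftrightarrow> (\<exists>\<delta>. has_multidegree t \<delta> f)"
  unfolding multihomogeneous_def has_multidegree_def by blast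

lemma has_multidegree_zero [simp]: "has_multidegree t \<delta> 0"
  by (simp add: has_multidegree_def)

lemma has_multidegree_one: "has_multidegree t (\<lambda>_. 0) 1"
  by (simp add: has_multidegree_def)

lemma has_multidegree_add:
  "has_multidegree t \<delta> f \<Longrightarrow> has_multidegree t \<delta> g \<Longrightarrow> has_multidegree t \<delta> (f + g)"
  unfolding has_multidegree_def using keys_add[of f g] by blast

lemma has_multidegree_uminus: "has_multidegree t \<delta> f \<Longrightarrow> has_multidegree t \<delta> (- f)"
  by (simp add: has_multidegree_def in_keys_iff)

lemma has_multidegree_sum:
  "(\<And>i. i \<in> A \<Longrightarrow> has_multidegree t \<delta> (f i)) \<Longrightarrow> has_multidegree t \<delta> (\<Sum>i\<in>A. f i)"
  by (induction A rule: infinite_finite_induct) (auto simp: has_multidegree_add)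

lemma has_multidegree_mult:
  assumes "has_multidegree t \<delta> f" "has_multidegree t \<delta>' g"
  shows "has_multidegree t (\<lambda>i. \<delta> i + \<delta>' i) (f * g)"
  unfolding has_multidegree_def
proof
  fix m assume "m \<in> Poly_Mapping.keys (f * g)"
  then obtain a b where ab: "a \<in> Poly_Mapping.keys f" "b \<in> Poly_Mapping.keys g" "m = a + b"
    using keys_mult[of f g] by auto
  then have k: "Poly_Mapping.keys a \<subseteq> {..<t} \<times> UNIV" "Poly_Mapping.keys b \<subseteq> {..<t} \<times> UNIV"
    and d: "\<forall>i<t. (\<Sum>j\<in>UNIV. Poly_Mapping.lookup a (i, j)) = \<delta> i"
      "\<forall>i<t. (\<Sum>j\<in>UNIV. Poly_Mapping.lookup b (i, j)) = \<delta>' i"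
    using assms unfolding has_multidegree_def by blast+
  have "Poly_Mapping.keys m \<subseteq> {..<t} \<times> UNIV" using k keys_add[of a b] ab by blast
  moreover have "\<forall>i<t. (\<Sum>j\<in>UNIV. Poly_Mapping.lookup m (i, j)) = \<delta> i + \<delta>' i"
    using d by (simp add: ab lookup_add sum.distrib)
  ultimately show "Poly_Mapping.keys m \<subseteq> {..<t} \<times> UNIV \<and>
      (\<forall>i<t. (\<Sum>j\<in>UNIV. Poly_Mapping.lookup m (i, j)) = \<delta> i + \<delta>' i)" by blast
qed

lemma has_multidegree_prod:
  "(\<And>r. r \<in> A \<Longrightarrow> has_multidegree t (\<delta> r) (f r)) \<Longrightarrow>
    has_multidegree t (\<lambda>i. \<Sum>r\<in>A. \<delta> r i) (\<Prod>r\<in>A. f r)"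
proof (induction A rule: infinite_finite_induct)
  case (insert x F)
  then show ?case using has_multidegree_mult[of t "\<delta> x" "f x"] by simp
qed (auto simp: has_multidegree_one)

text \<open>
  Rescaling the coordinates of the \<open>i\<close>-th point multiplies every monomial by the same power of the
  factor.  So the vanishing does not depend on the representatives that \<open>coords\<close> chooses.
\<close>

lemma multihomogeneous_rescale:
  fixes f :: "(nat \<times> 3, 'k::field) mpol"
  assumes f: "multihomogeneous t f" and c: "\<And>i. i < t \<Longrightarrow> c i \<noteq> 0"
    and y: "\<And>i j. i < t \<Longrightarrow> y (i, j) = c i * x (i, j)"
  shows "mpol_eval y f = 0 \<longleftrightarrow> mpol_eval x f = 0"
proof -
  obtain \<delta> where \<delta>: "has_multidegree t \<delta> f" using f multihomogeneous_iff by blast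
  have "monomial_value y m = (\<Prod>i<t. c i ^ \<delta> i) * monomial_value x m"
    if m: "m \<in> Poly_Mapping.keys f" for m
  proof -
    let ?S = "{..<t} \<times> (UNIV :: 3 set)"
    have k: "Poly_Mapping.keys m \<subseteq> ?S" and d: "\<And>i. i < t \<Longrightarrow> (\<Sum>j\<in>UNIV. Poly_Mapping.lookup m (i, j)) = \<delta> i"
      using \<delta> m by (auto simp: has_multidegree_def)
    have "monomial_value y m = (\<Prod>v\<in>?S. y v ^ Poly_Mapping.lookup m v)"
      by (rule monomial_value_superset) (use k in auto)
    also have "\<dots> = (\<Prod>v\<in>?S. c (fst v) ^ Poly_Mapping.lookup m v * x v ^ Poly_Mapping.lookup m v)"
      by (rule prod.cong) (auto simp: y power_mult_distrib)
    also have "\<dots> = (\<Prod>v\<in>?S. c (fst v) ^ Poly_Mapping.lookup m v) * monomial_value x m"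
      unfolding prod.distrib by (subst monomial_value_superset[of ?S m x]) (use k in auto)
    also have "(\<Prod>v\<in>?S. c (fst v) ^ Poly_Mapping.lookup m v) =
        (\<Prod>i<t. \<Prod>j\<in>UNIV. c i ^ Poly_Mapping.lookup m (i, j))"
      by (simp add: prod.cartesian_product case_prod_beta)
    also have "\<dots> = (\<Prod>i<t. c i ^ \<delta> i)"
      by (rule prod.cong) (auto simp: power_sum[symmetric] d)
    finally show ?thesis .
  qed
  then have "mpol_eval y f = (\<Prod>i<t. c i ^ \<delta> i) * mpol_eval x f"
    by (simp add: mpol_eval_eq coeff_sum_def sum_distrib_left mult.left_commute)
  moreover have "(\<Prod>i<t. c i ^ \<delta> i) \<noteq> 0" using c by auto
  ultimately show ?thesis by (metis mult_eq_0_iff)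
qed

lemma point_with_coords:
  assumes "\<exists>j. v j \<noteq> (0 :: 'k::field)"
  shows "\<exists>Q. snd Q \<noteq> 0 \<and> (\<forall>j. coords (fst Q) j = snd Q * v j)"
proof -
  let ?v = "(\<chi> j. v j) :: 'k ^ 3"
  have "?v \<noteq> 0" using assms by (auto simp: Finite_Cartesian_Product.vec_eq_iff)
  then have refl: "proj_rel ?v ?v" unfolding proj_rel_def by (auto intro: exI[of _ 1])
  have "proj_rel (rep_p2 (abs_p2 ?v)) ?v"
    by (rule rep_abs_rsp_left[OF Quotient3_p2 refl])
  then have "proj_rel ?v (rep_p2 (abs_p2 ?v))"
    using part_equivp_proj_rel by (metis part_equivp_symp)
  then obtain c where c: "rep_p2 (abs_p2 ?v) = c *s ?v" "rep_p2 (abs_p2 ?v) \<noteq> 0"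
    by (auto simp: proj_rel_def)
  then have "c \<noteq> 0" "\<And>j. coords (abs_p2 ?v) j = c * v j" by (auto simp: coords_def)
  then show ?thesis by (intro exI[of _ "(abs_p2 ?v, c)"]) simp
qed

lemma points_with_coords:
  fixes x :: "nat \<times> 3 \<Rightarrow> 'k::field"
  assumes "\<And>i. i < t \<Longrightarrow> \<exists>j. x (i, j) \<noteq> 0"
  obtains Ps c where "length Ps = t" "\<And>i. i < t \<Longrightarrow> c i \<noteq> 0"
    "\<And>i j. i < t \<Longrightarrow> all_coords Ps (i, j) = c i * x (i, j)"
proof -
  have "\<forall>i. \<exists>Q. i < t \<longrightarrow> snd Q \<noteq> 0 \<and> (\<forall>j. coords (fst Q) j = snd Q * x (i, j))"
    using point_with_coords[OF assms] by simp
  from choice[OF this] obtain Q where Q: "\<forall>i. i < t \<longrightarrow>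
    snd (Q i) \<noteq> 0 \<and> (\<forall>j. coords (fst (Q i)) j = snd (Q i) * x (i, j))" ..
  let ?Ps = "map (\<lambda>i. fst (Q i)) [0..<t]"
  have "all_coords ?Ps (i, j) = snd (Q i) * x (i, j)" if "i < t" for i j
    using Q that by (simp add: all_coords_def)
  then show thesis by (intro that[of ?Ps "\<lambda>i. snd (Q i)"]) (use Q in simp_all)
qed

lemma points_with_vanishing:
  fixes x :: "nat \<times> 3 \<Rightarrow> 'k::field"
  assumes "\<And>i. i < t \<Longrightarrow> \<exists>j. x (i, j) \<noteq> 0"
  shows "\<exists>Ps. length Ps = t \<and> (\<forall>f. multihomogeneous t f \<longrightarrow>
    (mpol_eval (all_coords Ps) f = 0 \<longleftrightarrow> mpol_eval x f = 0))"
proof -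
  obtain Ps c where Ps: "length Ps = t" and c: "\<And>i. i < t \<Longrightarrow> c i \<noteq> 0"
    "\<And>i j. i < t \<Longrightarrow> all_coords Ps (i, j) = c i * x (i, j)"
    using points_with_coords[of t x] assms by auto
  have "mpol_eval (all_coords Ps) f = 0 \<longleftrightarrow> mpol_eval x f = 0" if "multihomogeneous t f" for f
    by (rule multihomogeneous_rescale[where c = c and x = x, OF that c(1) c(2)])
  with Ps show ?thesis by blast
qed

section \<open>Irreducibility of the product of projective planes\<close>

lemma eval_along_curve:
  fixes X :: "'v \<Rightarrow> 'k::field poly"
  shows "\<exists>q. \<forall>s. poly q s = mpol_eval (\<lambda>v. poly (X v) s) f"
proof (intro exI allI)
  show "poly (\<Sum>m\<in>Poly_Mapping.keys f. Polynomial.smult (Poly_Mapping.lookup f m)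
      (\<Prod>v\<in>Poly_Mapping.keys m. X v ^ Poly_Mapping.lookup m v)) s = mpol_eval (\<lambda>v. poly (X v) s) f" for s
    by (simp add: mpol_eval_def poly_sum poly_prod)
qed

text \<open>
  Along the line that joins the two coordinate vectors both polynomials become nonzero polynomials in
  one variable, and so does some coordinate of every point.  All but finitely many parameters
  avoid their roots.
\<close>

lemma nonvanishing_common_point:
  fixes f g :: "(nat \<times> 3, 'k::field_char_0) mpol"
  assumes f: "multihomogeneous t f" "length Ps = t" "mpol_eval (all_coords Ps) f \<noteq> 0"
    and g: "multihomogeneous t g" "length Qs = t" "mpol_eval (all_coords Qs) g \<noteq> 0"
  obtains Rs where "length Rs = t" "mpol_eval (all_coords Rs) f \<noteq> 0" "mpol_eval (all_coords Rs) g \<noteq> 0"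
proof -
  \<comment> \<open>the line from the coordinates of \<open>Ps\<close> at \<open>s = 0\<close> to those of \<open>Qs\<close> at \<open>s = 1\<close>\<close>
  define X where "X v = [:all_coords Ps v, all_coords Qs v - all_coords Ps v:]" for v
  have X0: "(\<lambda>v. poly (X v) 0) = all_coords Ps" and X1: "(\<lambda>v. poly (X v) 1) = all_coords Qs"
    by (auto simp: X_def)
  obtain qf where qf: "\<And>s. poly qf s = mpol_eval (\<lambda>v. poly (X v) s) f" using eval_along_curve by blast
  obtain qg where qg: "\<And>s. poly qg s = mpol_eval (\<lambda>v. poly (X v) s) g" using eval_along_curve by blast
  have "\<exists>j. all_coords Ps (i, j) \<noteq> 0" for i using coords_nonzero by (simp add: all_coords_def)
  then obtain J where J: "\<And>i. all_coords Ps (i, J i) \<noteq> 0" by metis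
  have "poly qf 0 \<noteq> 0" "poly qg 1 \<noteq> 0" using f(3) g(3) by (simp_all add: qf qg X0 X1)
  then have "qf \<noteq> 0" "qg \<noteq> 0" by auto
  moreover have "X (i, J i) \<noteq> 0" for i using J[of i] by (simp add: X_def)
  ultimately have "qf * qg * (\<Prod>i<t. X (i, J i)) \<noteq> 0" by simp
  then obtain s where s: "poly (qf * qg * (\<Prod>i<t. X (i, J i))) s \<noteq> 0" by (rule nonroot_exists)
  then have "\<exists>j. poly (X (i, j)) s \<noteq> 0" if "i < t" for i using that by (auto simp: poly_prod)
  then obtain Rs where Rs: "length Rs = t" "\<And>f. multihomogeneous t f \<Longrightarrow>
      mpol_eval (all_coords Rs) f = 0 \<longleftrightarrow> mpol_eval (\<lambda>v. poly (X v) s) f = 0"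
    using points_with_vanishing[of t "\<lambda>v. poly (X v) s"] by blast
  show thesis by (rule that[OF Rs(1)]) (use s f g in \<open>auto simp: Rs(2) qf[symmetric] qg[symmetric]\<close>)
qed

lemma nonvanishing_product:
  fixes F :: "'i \<Rightarrow> (nat \<times> 3, 'k::field_char_0) mpol"
  assumes "finite I" "\<And>i. i \<in> I \<Longrightarrow> multihomogeneous t (F i)"
    "\<And>i. i \<in> I \<Longrightarrow> \<exists>Ps. length Ps = t \<and> mpol_eval (all_coords Ps) (F i) \<noteq> 0"
  shows "multihomogeneous t (\<Prod>i\<in>I. F i) \<and>
    (\<exists>Ps. length Ps = t \<and> mpol_eval (all_coords Ps) (\<Prod>i\<in>I. F i) \<noteq> 0)"
  using assms
proof (induction I rule: finite_induct)
  case empty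
  show ?case
    using has_multidegree_one Ex_list_of_length[of t] by (auto simp: multihomogeneous_iff)
next
  case (insert i I)
  then have IH: "multihomogeneous t (\<Prod>i\<in>I. F i)"
    "\<exists>Ps. length Ps = t \<and> mpol_eval (all_coords Ps) (\<Prod>i\<in>I. F i) \<noteq> 0" by auto
  have m: "multihomogeneous t (F i * (\<Prod>i\<in>I. F i))"
    using IH(1) insert.prems(1)[of i] has_multidegree_mult unfolding multihomogeneous_iff by blast
  obtain Ps where Ps: "length Ps = t" "mpol_eval (all_coords Ps) (F i) \<noteq> 0"
    using insert.prems(2)[of i] by auto
  from IH(2) obtain Qs where Qs: "length Qs = t" "mpol_eval (all_coords Qs) (\<Prod>i\<in>I. F i) \<noteq> 0" by blast
  have "multihomogeneous t (F i)" using insert.prems(1) by simp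
  from nonvanishing_common_point[OF this Ps IH(1) Qs] obtain Rs where
    "length Rs = t" "mpol_eval (all_coords Rs) (F i) \<noteq> 0" "mpol_eval (all_coords Rs) (\<Prod>i\<in>I. F i) \<noteq> 0" .
  with m insert.hyps show ?case by (auto simp: mpol_eval_mult)
qed

lemma nonvanishing_locus_open:
  assumes "multihomogeneous t f"
  shows "zariski_open t {Ps. length Ps = t \<and> mpol_eval (all_coords Ps) f \<noteq> 0}"
  unfolding zariski_open_def zariski_closed_def
  by (intro conjI exI[of _ "{f}"]) (use assms in \<open>auto simp: all_coords_def\<close>)

lemma zariski_open_basic:
  assumes "zariski_open t U" "Ps \<in> U"
  shows "\<exists>f. multihomogeneous t f \<and> mpol_eval (all_coords Ps) f \<noteq> 0 \<and>
    (\<forall>Qs. length Qs = t \<longrightarrow> mpol_eval (all_coords Qs) f \<noteq> 0 \<longrightarrow> Qs \<in> U)"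
proof -
  from assms obtain F where F: "\<And>f. f \<in> F \<Longrightarrow> multihomogeneous t f" and
    eq: "{Ps. length Ps = t} - U = {Ps. length Ps = t \<and> (\<forall>f\<in>F. mpol_eval (all_coords Ps) f = 0)}"
    unfolding zariski_open_def zariski_closed_def all_coords_def by blast
  have "Ps \<notin> {Ps. length Ps = t \<and> (\<forall>f\<in>F. mpol_eval (all_coords Ps) f = 0)}" "length Ps = t"
    using eq assms unfolding zariski_open_def by blast+
  then obtain f where f: "f \<in> F" "mpol_eval (all_coords Ps) f \<noteq> 0" by blast
  show ?thesis
  proof (intro exI[of _ f] conjI allI impI F[OF f(1)] f(2))
    fix Qs assume "length Qs = t" "mpol_eval (all_coords Qs) f \<noteq> 0"
    then show "Qs \<in> U" using eq f(1) by blast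
  qed
qed

lemma zariski_open_intersect:
  fixes U :: "'k::field_char_0 p2 list set"
  assumes "zariski_open t U" "U \<noteq> {}" "zariski_open t V" "V \<noteq> {}"
  shows "U \<inter> V \<noteq> {}"
proof -
  from assms obtain Ps Qs where PQ: "Ps \<in> U" "Qs \<in> V" by blast
  obtain f where f: "multihomogeneous t f" "mpol_eval (all_coords Ps) f \<noteq> 0"
    "\<And>Qs. length Qs = t \<Longrightarrow> mpol_eval (all_coords Qs) f \<noteq> 0 \<Longrightarrow> Qs \<in> U"
    using zariski_open_basic[OF assms(1) PQ(1)] by blast
  obtain g where g: "multihomogeneous t g" "mpol_eval (all_coords Qs) g \<noteq> 0"
    "\<And>Ps. length Ps = t \<Longrightarrow> mpol_eval (all_coords Ps) g \<noteq> 0 \<Longrightarrow> Ps \<in> V"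
    using zariski_open_basic[OF assms(3) PQ(2)] by blast
  have "length Ps = t" "length Qs = t" using assms(1,3) PQ by (auto simp: zariski_open_def)
  from nonvanishing_common_point[OF f(1) this(1) f(2) g(1) this(2) g(2)] obtain Rs where
    "length Rs = t" "mpol_eval (all_coords Rs) f \<noteq> 0" "mpol_eval (all_coords Rs) g \<noteq> 0" .
  with f(3) g(3) show ?thesis by blast
qed

section \<open>The Hilbert function of generic double points\<close>

text \<open>
  The monomial \<open>m\<close> in the coordinates of the \<open>i\<close>-th point.
\<close>

definition block_monomial :: "nat \<Rightarrow> (3 \<Rightarrow>\<^sub>0 nat) \<Rightarrow> (nat \<times> 3 \<Rightarrow>\<^sub>0 nat)" where
  "block_monomial i m = (\<Sum>v\<in>UNIV. Poly_Mapping.single (i, v) (Poly_Mapping.lookup m v))"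

definition partial_poly :: "nat \<Rightarrow> 3 \<Rightarrow> (3, 'k::field) mpol \<Rightarrow> (nat \<times> 3, 'k) mpol" where
  "partial_poly i e f = (\<Sum>m\<in>Poly_Mapping.keys f. Poly_Mapping.single
     (block_monomial i (m - Poly_Mapping.single e 1))
     (Poly_Mapping.lookup f m * of_nat (Poly_Mapping.lookup m e)))"

lemma eval_partial_poly: "mpol_eval x (partial_poly i e f) = partial_at (\<lambda>v. x (i, v)) e f"
proof -
  have "monomial_value x (block_monomial i m) = monomial_value (\<lambda>v. x (i, v)) m" for m
    by (simp add: block_monomial_def monomial_value_sum monomial_value_superset[of UNIV m])
  then show ?thesis
    by (simp add: partial_poly_def mpol_eval_eq coeff_sum_sum coeff_sum_single)
       (simp add: partial_at_def partial_weight_def coeff_sum_def mult.assoc)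
qed

lemma lookup_block_monomial:
  "Poly_Mapping.lookup (block_monomial i m) (i', v) = (if i' = i then Poly_Mapping.lookup m v else 0)"
  by (auto simp: block_monomial_def lookup_sum lookup_single when_def sum.delta)

lemma has_multidegree_partial_poly:
  assumes f: "f \<in> forms d" and i: "i < t"
  shows "has_multidegree t (\<lambda>i'. if i' = i then d - 1 else 0) (partial_poly i e f)"
  unfolding partial_poly_def
proof (rule has_multidegree_sum)
  fix m assume m: "m \<in> Poly_Mapping.keys f"
  let ?m = "m - Poly_Mapping.single e 1"
  show "has_multidegree t (\<lambda>i'. if i' = i then d - 1 else 0) (Poly_Mapping.single (block_monomial i ?m)
      (Poly_Mapping.lookup f m * of_nat (Poly_Mapping.lookup m e)))"
  proof (cases "Poly_Mapping.lookup m e = 0")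
    case False
    have "m = Poly_Mapping.single e 1 + ?m"
      by (rule split_off_variable[OF False])
    then have "mdeg m = 1 + mdeg ?m" by (metis mdeg_add mdeg_single)
    then have "mdeg ?m = d - 1" using f m by (simp add: forms_iff)
    then have "(\<Sum>v\<in>UNIV. Poly_Mapping.lookup ?m v) = d - 1" by (simp only: mdeg_UNIV)
    moreover have "Poly_Mapping.keys (block_monomial i ?m) \<subseteq> {..<t} \<times> UNIV"
      using i by (auto simp: in_keys_iff lookup_block_monomial split: if_splits)
    ultimately show ?thesis
      by (auto simp: has_multidegree_def lookup_block_monomial)
  qed simp
qed

definition jet_poly :: "(nat \<Rightarrow> (3, 'k::field) mpol) \<Rightarrow> nat \<times> 3 \<Rightarrow> nat \<Rightarrow> (nat \<times> 3, 'k) mpol" where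
  "jet_poly fs = (\<lambda>(i, e) j. partial_poly i e (fs j))"

lemma eval_minor_jet_poly: "mpol_eval x (minor (jet_poly fs) rs) = minor (jet x fs) rs"
proof -
  have "mpol_eval x (minor (jet_poly fs) rs) = Determinant.det (map_mat (mpol_eval x)
      (Matrix.mat (length rs) (length rs) (\<lambda>(i, j). jet_poly fs (rs ! i) j)))"
    unfolding minor_def by (rule comm_ring_hom.hom_det[OF comm_ring_hom_mpol_eval, symmetric])
  also have "map_mat (mpol_eval x) (Matrix.mat (length rs) (length rs) (\<lambda>(i, j). jet_poly fs (rs ! i) j)) =
      Matrix.mat (length rs) (length rs) (\<lambda>(i, j). jet x fs (rs ! i) j)"
    by (rule eq_matI) (auto simp: jet_poly_def jet_def eval_partial_poly split: prod.split)
  finally show ?thesis by (simp add: minor_def)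
qed

text \<open>
  The row \<open>(i, e)\<close> has degree \<open>d - 1\<close> in the coordinates of the \<open>i\<close>-th point and degree \<open>0\<close> in the others.
  Every term of the determinant takes one entry of each row, so all terms have the same multidegree.
\<close>

lemma multihomogeneous_minor:
  assumes fs: "\<And>j. j < length rs \<Longrightarrow> fs j \<in> forms d" and rs: "set rs \<subseteq> {..<t} \<times> UNIV"
  shows "multihomogeneous t (minor (jet_poly fs) rs)"
proof -
  let ?n = "length rs"
  let ?A = "Matrix.mat ?n ?n (\<lambda>(i, j). jet_poly fs (rs ! i) j)"
  let ?\<delta> = "\<lambda>r i'. if i' = fst (rs ! r) then d - 1 else 0"
  have entry: "has_multidegree t (?\<delta> r) (?A $$ (r, j))" if "r < ?n" "j < ?n" for r j
  proof -
    have "rs ! r \<in> {..<t} \<times> UNIV" using rs that by auto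
    then show ?thesis
      using has_multidegree_partial_poly[OF fs[OF that(2)]] that
      by (auto simp: jet_poly_def split: prod.split)
  qed
  have "has_multidegree t (\<lambda>i. \<Sum>r\<in>{0..<?n}. ?\<delta> r i) (minor (jet_poly fs) rs)"
    unfolding minor_def det_def'[OF mat_carrier]
  proof (rule has_multidegree_sum)
    fix p assume p: "p \<in> {p. p permutes {0..<?n}}"
    have "has_multidegree t (\<lambda>i. \<Sum>r\<in>{0..<?n}. ?\<delta> r i) (\<Prod>r = 0..<?n. ?A $$ (r, p r))"
      by (rule has_multidegree_prod) (use p entry permutes_in_image[of p "{0..<?n}"] in auto)
    then show "has_multidegree t (\<lambda>i. \<Sum>r\<in>{0..<?n}. ?\<delta> r i)
        (signof p * (\<Prod>r = 0..<?n. ?A $$ (r, p r)))"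
      by (cases "sign p = 1") (auto simp: sign_def has_multidegree_uminus)
  qed
  then show ?thesis by (auto simp: multihomogeneous_iff)
qed

text \<open>
  The numbers \<open>n\<close> for which some \<open>t\<close> points have a nonzero minor of size \<open>n\<close> in degree \<open>d\<close>.  Coinciding
  points are allowed: a minor that is nonzero somewhere is also nonzero at some tuple of distinct points.
\<close>

definition attained_ranks :: "'k::field itself \<Rightarrow> nat \<Rightarrow> nat \<Rightarrow> nat set" where
  "attained_ranks _ t d = {n. \<exists>(Ps :: 'k p2 list) fs rs. length Ps = t \<and> length rs = n \<and>
     set rs \<subseteq> {..<t} \<times> UNIV \<and> (\<forall>j<n. fs j \<in> forms d) \<and> minor (jet (all_coords Ps) fs) rs \<noteq> 0}"

lemma attained_ranks_bound: "attained_ranks TYPE('k::field) t d \<subseteq> {..3 * t}"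
  using minor_length_le by (auto simp: attained_ranks_def)

lemma zero_attained_rank: "0 \<in> attained_ranks TYPE('k::field) t d"
  using Ex_list_of_length[of t] by (auto simp: attained_ranks_def minor_def)

lemma hilbert_attained:
  fixes Ps :: "'k::field_char_0 p2 list"
  assumes "distinct Ps" "d \<ge> 1"
  shows "hilbert Ps d \<in> attained_ranks TYPE('k) (length Ps) d"
proof -
  obtain fs rs where "\<forall>j<length rs. fs j \<in> forms d" "length rs = hilbert Ps d"
    "set rs \<subseteq> {..<length Ps} \<times> UNIV" "minor (jet (all_coords Ps) fs) rs \<noteq> 0"
    using hilbert_minor[OF assms] by blast
  then show ?thesis unfolding attained_ranks_def mem_Collect_eq by metis
qed

text \<open>
  The product of the minors \<open>x\<^sub>a\<^sub>1 x\<^sub>b\<^sub>2 - x\<^sub>a\<^sub>2 x\<^sub>b\<^sub>1\<close>, one for each pair of points.  It separates the points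
  \<open>(1, i, i)\<close>, and it vanishes where two points agree.
\<close>

lemma distinctness_poly:
  "\<exists>f :: (nat \<times> 3, 'k::field_char_0) mpol. multihomogeneous t f \<and>
    (\<forall>Ps. length Ps = t \<longrightarrow> mpol_eval (all_coords Ps) f \<noteq> 0 \<longrightarrow> distinct Ps) \<and>
    (\<exists>Ps. length Ps = t \<and> mpol_eval (all_coords Ps) f \<noteq> 0)"
proof -
  define F :: "nat \<times> nat \<Rightarrow> (nat \<times> 3, 'k) mpol" where
    "F = (\<lambda>(a, b). var (a, 1) * var (b, 2) - var (a, 2) * var (b, 1))"
  let ?I = "{(a, b). a < b \<and> b < t}"
  have fin: "finite ?I" by (rule finite_subset[of _ "{..<t} \<times> {..<t}"]) auto
  have ev: "mpol_eval x (F (a, b)) = x (a, 1) * x (b, 2) - x (a, 2) * x (b, 1)" for x a b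
    by (simp add: F_def mpol_eval_eq coeff_sum_diff mult_single coeff_sum_single monomial_value_add
        del: One_nat_def)
  have vd: "has_multidegree t (\<lambda>i. if i = a then 1 else 0) (var (a, v))" if "a < t" for a v
    using that by (auto simp: has_multidegree_def lookup_single when_def sum.delta)
  have hom: "multihomogeneous t (F p)" if "p \<in> ?I" for p
  proof -
    obtain a b where p: "p = (a, b)" by (cases p)
    with that have ab: "a < t" "b < t" by auto
    have "has_multidegree t (\<lambda>i. (if i = a then 1 else 0) + (if i = b then 1 else 0))
        (var (a, 1) * var (b, 2) + - (var (a, 2) * var (b, 1)) :: (nat \<times> 3, 'k) mpol)"
      by (intro has_multidegree_add has_multidegree_uminus has_multidegree_mult vd ab)
    then show ?thesis unfolding multihomogeneous_iff p F_def by auto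
  qed
  have ex: "\<exists>Ps. length Ps = t \<and> mpol_eval (all_coords Ps) (F p) \<noteq> 0" if p: "p \<in> ?I" for p
  proof -
    let ?x = "\<lambda>(i, j). if j = 1 then 1 else of_nat i :: 'k"
    have "\<And>i. i < t \<Longrightarrow> \<exists>j. ?x (i, j) \<noteq> 0" by (auto intro: exI[of _ 1])
    then obtain Ps where Ps: "length Ps = t"
      "\<And>f. multihomogeneous t f \<Longrightarrow> mpol_eval (all_coords Ps) f = 0 \<longleftrightarrow> mpol_eval ?x f = 0"
      using points_with_vanishing[of t ?x] by blast
    obtain a b where ab: "p = (a, b)" by (cases p)
    with p have "a \<noteq> b" by auto
    with ab have "mpol_eval ?x (F p) \<noteq> 0" by (simp add: ev)
    then show ?thesis using Ps hom[OF p] by auto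
  qed
  have main: "multihomogeneous t (\<Prod>p\<in>?I. F p) \<and>
    (\<exists>Ps. length Ps = t \<and> mpol_eval (all_coords Ps) (\<Prod>p\<in>?I. F p) \<noteq> 0)"
    by (rule nonvanishing_product[OF fin hom ex])
  show ?thesis
  proof (intro exI[of _ "\<Prod>p\<in>?I. F p"] conjI allI impI)
    fix Ps :: "'k p2 list" assume Ps: "length Ps = t" "mpol_eval (all_coords Ps) (\<Prod>p\<in>?I. F p) \<noteq> 0"
    have "Ps ! a \<noteq> Ps ! b" if "a < b" "b < t" for a b
    proof
      assume "Ps ! a = Ps ! b"
      then have "mpol_eval (all_coords Ps) (F (a, b)) = 0" by (simp add: ev all_coords_def)
      moreover have "mpol_eval (all_coords Ps) (F (a, b)) \<noteq> 0"
        using Ps(2) that fin by (auto simp: mpol_eval_prod)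
      ultimately show False by blast
    qed
    then show "distinct Ps" unfolding distinct_conv_nth Ps(1) by (metis linorder_neqE_nat)
  qed (use main in auto)
qed

text \<open>
  In each of finitely many degrees a largest nonzero minor cuts out an open set on which the
  Hilbert function attains its maximum; from the degree where that maximum reaches \<open>3 * t\<close> on, the
  Hilbert function of every member is constant.
\<close>

theorem generic_double_hilbert_max:
  assumes t: "t \<ge> 1" and D: "D \<ge> 1" "3 * t \<in> attained_ranks TYPE('k::field_char_0) t D"
  shows "\<exists>Ps :: 'k p2 list. distinct Ps \<and> length Ps = t \<and>
    hilbert Ps = generic_double_hilbert TYPE('k) t"
    and "\<And>d n. d \<ge> 1 \<Longrightarrow> n \<in> attained_ranks TYPE('k) t d \<Longrightarrow> n \<le> generic_double_hilbert TYPE('k) t d"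
proof -
  let ?R = "attained_ranks TYPE('k) t"
  define r where "r d = Max (?R d)" for d
  have fin: "finite (?R d)" for d using attained_ranks_bound finite_subset by blast
  have r: "r d \<in> ?R d" for d unfolding r_def using fin zero_attained_rank by (intro Max_in) blast+
  have r_max: "n \<le> r d" if "n \<in> ?R d" for d n unfolding r_def using fin that by simp
  have "\<forall>d. \<exists>f. multihomogeneous t f \<and> (\<exists>Ps. length Ps = t \<and> mpol_eval (all_coords Ps) f \<noteq> 0) \<and>
      (\<forall>Ps :: 'k p2 list. length Ps = t \<longrightarrow> distinct Ps \<longrightarrow> d \<ge> 1 \<longrightarrow> mpol_eval (all_coords Ps) f \<noteq> 0 \<longrightarrow>
         hilbert Ps d \<ge> r d)"
  proof
    fix d
    obtain Ps :: "'k p2 list" and fs rs where *: "length Ps = t" "length rs = r d"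
      "set rs \<subseteq> {..<t} \<times> UNIV" "\<forall>j<r d. fs j \<in> forms d" "minor (jet (all_coords Ps) fs) rs \<noteq> 0"
      using r[of d] unfolding attained_ranks_def mem_Collect_eq by blast
    show "\<exists>f. multihomogeneous t f \<and> (\<exists>Ps. length Ps = t \<and> mpol_eval (all_coords Ps) f \<noteq> 0) \<and>
      (\<forall>Ps :: 'k p2 list. length Ps = t \<longrightarrow> distinct Ps \<longrightarrow> d \<ge> 1 \<longrightarrow> mpol_eval (all_coords Ps) f \<noteq> 0 \<longrightarrow>
         hilbert Ps d \<ge> r d)"
    proof (intro exI[of _ "minor (jet_poly fs) rs"] conjI allI impI)
      show "multihomogeneous t (minor (jet_poly fs) rs)"
        by (rule multihomogeneous_minor) (use * in auto)
      show "\<exists>Ps. length Ps = t \<and> mpol_eval (all_coords Ps) (minor (jet_poly fs) rs) \<noteq> 0"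
        using * by (auto simp: eval_minor_jet_poly)
      fix Qs :: "'k p2 list" assume Qs: "length Qs = t" "distinct Qs" "d \<ge> 1"
        "mpol_eval (all_coords Qs) (minor (jet_poly fs) rs) \<noteq> 0"
      have "length rs \<le> hilbert Qs d"
        by (rule minor_le_hilbert[OF Qs(2,3)]) (use Qs * in \<open>auto simp: eval_minor_jet_poly\<close>)
      then show "r d \<le> hilbert Qs d" using * by simp
    qed
  qed
  from choice[OF this] obtain G where "\<forall>d. multihomogeneous t (G d) \<and>
    (\<exists>Ps. length Ps = t \<and> mpol_eval (all_coords Ps) (G d) \<noteq> 0) \<and>
    (\<forall>Ps :: 'k p2 list. length Ps = t \<longrightarrow> distinct Ps \<longrightarrow> d \<ge> 1 \<longrightarrow>
       mpol_eval (all_coords Ps) (G d) \<noteq> 0 \<longrightarrow> hilbert Ps d \<ge> r d)" ..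
  then have G: "\<And>d. multihomogeneous t (G d)"
    "\<And>d. \<exists>Ps. length Ps = t \<and> mpol_eval (all_coords Ps) (G d) \<noteq> 0"
    "\<And>d Ps. length Ps = t \<Longrightarrow> distinct Ps \<Longrightarrow> d \<ge> 1 \<Longrightarrow> mpol_eval (all_coords Ps) (G d) \<noteq> 0 \<Longrightarrow>
       hilbert (Ps :: 'k p2 list) d \<ge> r d"
    by blast+
  obtain f0 :: "(nat \<times> 3, 'k) mpol" where f0: "multihomogeneous t f0"
    "\<And>Ps :: 'k p2 list. length Ps = t \<Longrightarrow> mpol_eval (all_coords Ps) f0 \<noteq> 0 \<Longrightarrow> distinct Ps"
    "\<exists>Ps. length Ps = t \<and> mpol_eval (all_coords Ps) f0 \<noteq> 0"
    using distinctness_poly by metis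
  \<comment> \<open>degree \<open>0\<close> needs no minor, so its slot holds the distinctness condition\<close>
  define F where "F = (\<lambda>d. if d = 0 then f0 else G d)"
  define f where "f = (\<Prod>d\<le>D. F d)"
  have f: "multihomogeneous t f \<and> (\<exists>Ps. length Ps = t \<and> mpol_eval (all_coords Ps) f \<noteq> 0)"
    unfolding f_def by (rule nonvanishing_product) (auto simp: F_def G f0)
  define U where "U = {Ps. length Ps = t \<and> mpol_eval (all_coords Ps) f \<noteq> 0}"
  define H where "H d = (if d = 0 then 1 else if d \<le> D then r d else 3 * t)" for d
  have U: "zariski_open t U" "U \<noteq> {}"
    using f nonvanishing_locus_open[of t f] by (auto simp: U_def)
  have rD: "r D = 3 * t" using r_max[OF D(2)] r[of D] attained_ranks_bound[of t D] by auto
  have UH: "distinct Ps \<and> hilbert Ps = H" if Ps: "Ps \<in> U" for Ps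
  proof -
    have Pt: "length Ps = t" and nz: "\<And>d. d \<le> D \<Longrightarrow> mpol_eval (all_coords Ps) (F d) \<noteq> 0"
      using Ps by (auto simp: U_def f_def mpol_eval_prod)
    have dist: "distinct Ps" using f0(2)[OF Pt] nz[of 0] by (simp add: F_def)
    have eq: "hilbert Ps d = r d" if "d \<ge> 1" "d \<le> D" for d
    proof (rule antisym)
      show "hilbert Ps d \<le> r d" using r_max hilbert_attained[OF dist that(1)] Pt by simp
      show "r d \<le> hilbert Ps d" using G(3)[OF Pt dist that(1)] nz[OF that(2)] that(1) by (simp add: F_def)
    qed
    have big: "3 * t \<le> hilbert Ps (D + k)" for k
    proof (induction k)
      case (Suc k)
      then show ?case using hilbert_mono[OF dist, of "D + k"] D(1) by simp
    next
      case 0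
      then show ?case using eq[of D] D(1) rD by simp
    qed
    have "hilbert Ps d = H d" for d
    proof -
      consider "d = 0" | "d \<ge> 1" "d \<le> D" | "d > D" by linarith
      then show ?thesis
      proof cases
        case 1
        moreover have "Ps \<noteq> []" using Pt t by auto
        ultimately show ?thesis using hilbert_0[OF dist] by (simp add: H_def)
      next
        case 3
        then show ?thesis using big[of "d - D"] hilbert_le_3t[OF dist, of d] Pt by (simp add: H_def)
      qed (simp add: H_def eq)
    qed
    with dist show ?thesis by blast
  qed
  have gen: "generic_double_hilbert TYPE('k) t = H"
    unfolding generic_double_hilbert_def
  proof (rule the_equality)
    show "\<exists>U :: 'k p2 list set. zariski_open t U \<and> U \<noteq> {} \<and> (\<forall>Ps\<in>U. distinct Ps \<and> hilbert Ps = H)"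
      using U UH by blast
    fix H' assume "\<exists>U :: 'k p2 list set. zariski_open t U \<and> U \<noteq> {} \<and> (\<forall>Ps\<in>U. distinct Ps \<and> hilbert Ps = H')"
    then obtain V :: "'k p2 list set" where V: "zariski_open t V" "V \<noteq> {}"
      "\<forall>Ps\<in>V. hilbert Ps = H'" by blast
    obtain Ps where "Ps \<in> U" "Ps \<in> V" using zariski_open_intersect[OF U V(1,2)] by blast
    then show "H' = H" using UH V(3) by metis
  qed
  show "\<exists>Ps :: 'k p2 list. distinct Ps \<and> length Ps = t \<and> hilbert Ps = generic_double_hilbert TYPE('k) t"
    using U(2) UH unfolding gen by (auto simp: U_def)
  show "n \<le> generic_double_hilbert TYPE('k) t d" if "d \<ge> 1" "n \<in> ?R d" for d n
    using r_max[OF that(2)] attained_ranks_bound[of t d] that unfolding gen H_def by auto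
qed

section \<open>Triangular cells\<close>

text \<open>
  The strip \<open>k\<close> consists of the rows \<open>2 * k\<close> and \<open>2 * k + 1\<close>.  The number \<open>2 * x + y mod 2\<close> enumerates its
  points along the zigzag without gaps, and every three consecutive ones make a cell.
\<close>

definition cell_of :: "nat \<times> nat \<Rightarrow> nat \<times> nat" where
  "cell_of = (\<lambda>(x, y). (y div 2, (2 * x + y mod 2) div 3))"

definition cell :: "nat \<Rightarrow> nat \<times> nat \<Rightarrow> (nat \<times> nat) set" where
  "cell d \<kappa> = {p \<in> lattice_triangle d. cell_of p = \<kappa>}"

text \<open>
  The three points of a complete cell, in zigzag order.
\<close>

definition cell_point :: "nat \<times> nat \<Rightarrow> nat \<Rightarrow> nat \<times> nat" where
  "cell_point = (\<lambda>(k, c) j. ((3 * c + j) div 2, 2 * k + (3 * c + j) mod 2))"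

lemma lookup_exponent_pair:
  "Poly_Mapping.lookup (exponent d p) 2 = fst p" "Poly_Mapping.lookup (exponent d p) 3 = snd p"
  by (cases p; simp add: lookup_exponent)+

lemma cell_point_inj: "cell_point \<kappa> i = cell_point \<kappa> j \<Longrightarrow> i = j"
proof -
  assume "cell_point \<kappa> i = cell_point \<kappa> j"
  then have "(3 * snd \<kappa> + i) div 2 = (3 * snd \<kappa> + j) div 2" "(3 * snd \<kappa> + i) mod 2 = (3 * snd \<kappa> + j) mod 2"
    by (auto simp: cell_point_def split: prod.splits)
  then have "3 * snd \<kappa> + i = 3 * snd \<kappa> + j" by (metis mult_div_mod_eq)
  then show ?thesis by simp
qed

lemma cell_of_cell_point: "j < 3 \<Longrightarrow> cell_of (cell_point \<kappa> j) = \<kappa>"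
  by (cases \<kappa>) (auto simp: cell_of_def cell_point_def)

lemma cell_point_cases:
  assumes "cell_of p = \<kappa>"
  shows "\<exists>j<3. p = cell_point \<kappa> j"
proof -
  obtain x y where p: "p = (x, y)" by (cases p)
  let ?u = "2 * x + y mod 2"
  have \<kappa>: "\<kappa> = (y div 2, ?u div 3)" using assms by (simp add: p cell_of_def)
  have "3 * (?u div 3) + ?u mod 3 = ?u" by simp
  then have "p = cell_point \<kappa> (?u mod 3)" unfolding p \<kappa> cell_point_def prod.case
    by (simp only:) simp
  then show ?thesis by (intro exI[of _ "?u mod 3"]) simp
qed

lemma cell_subset: "cell d \<kappa> \<subseteq> cell_point \<kappa> ` {..<3}"
  using cell_point_cases by (fastforce simp: cell_def)

lemma finite_cell [simp]: "finite (cell d \<kappa>)"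
  by (simp add: cell_def)

lemma card_cell_le: "card (cell d \<kappa>) \<le> 3"
  using card_mono[OF _ cell_subset[of d \<kappa>]] card_image_le[of "{..<3}" "cell_point \<kappa>"] by simp

text \<open>
  Three consecutive lattice points of the zigzag in a strip of two rows are not collinear, so a
  function on a cell is determined by its moments against the three exponents.
\<close>

lemma cell_independent:
  fixes v :: "nat \<times> nat \<Rightarrow> 'k::field_char_0"
  assumes d: "d \<ge> 1"
    and v: "\<And>e. (\<Sum>p\<in>cell d \<kappa>. v p * of_nat (Poly_Mapping.lookup (exponent d p) e)) = 0"
    and p: "p \<in> cell d \<kappa>"
  shows "v p = 0"
proof -
  obtain k c where \<kappa>: "\<kappa> = (k, c)" by (cases \<kappa>)
  define w where "w j = (if cell_point \<kappa> j \<in> cell d \<kappa> then v (cell_point \<kappa> j) else 0)" for j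
  have inj: "inj_on (cell_point \<kappa>) {..<3}" by (rule inj_onI) (rule cell_point_inj)
  have sum: "(\<Sum>p\<in>cell d \<kappa>. v p * g p) =
      w 0 * g (cell_point \<kappa> 0) + w 1 * g (cell_point \<kappa> 1) + w 2 * g (cell_point \<kappa> 2)" for g :: "_ \<Rightarrow> 'k"
  proof -
    have "(\<Sum>p\<in>cell d \<kappa>. v p * g p) = (\<Sum>p\<in>cell_point \<kappa> ` {..<3}. if p \<in> cell d \<kappa> then v p * g p else 0)"
      using cell_subset[of d \<kappa>] by (intro sum.mono_neutral_cong_left) auto
    also have "\<dots> = (\<Sum>j<3. w j * g (cell_point \<kappa> j))"
      by (simp add: sum.reindex[OF inj] w_def if_distrib[of "\<lambda>x. x * _"] cong: if_cong)
    finally show ?thesis by (simp add: eval_nat_numeral)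
  qed
  have x: "(\<Sum>p\<in>cell d \<kappa>. v p * of_nat (fst p)) = 0"
    using v[of 2] by (simp add: lookup_exponent_pair)
  have y: "(\<Sum>p\<in>cell d \<kappa>. v p * of_nat (snd p)) = 0"
    using v[of 3] by (simp add: lookup_exponent_pair)
  \<comment> \<open>the three exponents add up to \<open>d\<close>, so the moments give the sum of the weights as well\<close>
  have "of_nat d * (\<Sum>p\<in>cell d \<kappa>. v p) = (\<Sum>p\<in>cell d \<kappa>. v p * of_nat d)"
    by (simp add: sum_distrib_left mult.commute)
  also have "\<dots> = (\<Sum>p\<in>cell d \<kappa>. \<Sum>e\<in>UNIV. v p * of_nat (Poly_Mapping.lookup (exponent d p) e))"
  proof (rule sum.cong[OF refl])
    fix p assume "p \<in> cell d \<kappa>"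
    then have "mdeg (exponent d p) = d" by (simp add: cell_def mdeg_exponent)
    then have "(\<Sum>e\<in>UNIV. Poly_Mapping.lookup (exponent d p) e) = d" by (simp only: mdeg_UNIV)
    then show "v p * of_nat d = (\<Sum>e\<in>UNIV. v p * of_nat (Poly_Mapping.lookup (exponent d p) e))"
      by (metis of_nat_sum sum_distrib_left)
  qed
  also have "\<dots> = (\<Sum>e\<in>UNIV. \<Sum>p\<in>cell d \<kappa>. v p * of_nat (Poly_Mapping.lookup (exponent d p) e))"
    by (rule sum.swap)
  also have "\<dots> = 0" by (simp add: v)
  finally have one: "(\<Sum>p\<in>cell d \<kappa>. v p) = 0" using d by simp
  have 1: "w 0 + w 1 + w 2 = 0" using one sum[of "\<lambda>_. 1"] by simp
  have 2: "w 0 * of_nat (3 * c div 2) + w 1 * of_nat ((3 * c + 1) div 2) + w 2 * of_nat ((3 * c + 2) div 2) = 0"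
    using x sum[of "\<lambda>p. of_nat (fst p)"] by (simp add: \<kappa> cell_point_def)
  have 3: "w 0 * of_nat (2 * k + 3 * c mod 2) + w 1 * of_nat (2 * k + (3 * c + 1) mod 2) +
      w 2 * of_nat (2 * k + (3 * c + 2) mod 2) = 0"
    using y sum[of "\<lambda>p. of_nat (snd p)"] by (simp add: \<kappa> cell_point_def)
  have "w 0 = 0 \<and> w 1 = 0 \<and> w 2 = 0"
  proof (cases "even c")
    case True
    then obtain b where c: "c = 2 * b" by blast
    have q: "3 * c div 2 = 3 * b" "(3 * c + 1) div 2 = 3 * b" "(3 * c + 2) div 2 = 3 * b + 1"
      "3 * c mod 2 = 0" "(3 * c + 1) mod 2 = 1" "(3 * c + 2) mod 2 = 0" unfolding c by presburger+
    have "(w 0 + w 1 + w 2) * of_nat (3 * b) + w 2 = 0"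
      using 2 unfolding q by (simp add: algebra_simps)
    moreover have "(w 0 + w 1 + w 2) * of_nat (2 * k) + w 1 = 0"
      using 3 unfolding q by (simp add: algebra_simps)
    ultimately show ?thesis using 1 by simp
  next
    case False
    then obtain b where c: "c = 2 * b + 1" by (blast elim: oddE)
    have q: "3 * c div 2 = 3 * b + 1" "(3 * c + 1) div 2 = 3 * b + 2" "(3 * c + 2) div 2 = 3 * b + 2"
      "3 * c mod 2 = 1" "(3 * c + 1) mod 2 = 0" "(3 * c + 2) mod 2 = 1" unfolding c by presburger+
    have "(w 0 + w 1 + w 2) * of_nat (3 * b + 1) + (w 1 + w 2) = 0"
      using 2 unfolding q by (simp add: algebra_simps)
    then have a: "w 1 + w 2 = 0" using 1 by simp
    have "(w 0 + w 1 + w 2) * of_nat (2 * k) + (w 0 + w 2) = 0"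
      using 3 unfolding q by (simp add: algebra_simps)
    then have "w 0 + w 2 = 0" using 1 by simp
    with a 1 show ?thesis by (simp add: add.assoc)
  qed
  moreover obtain j where "j < 3" "p = cell_point \<kappa> j"
    using cell_subset p by blast
  ultimately have "w j = 0" by (auto simp: less_Suc_eq eval_nat_numeral)
  then show ?thesis using p \<open>p = cell_point \<kappa> j\<close> by (simp add: w_def)
qed

text \<open>
  For a fixed cell this is an affine function of \<open>(x, y)\<close>.  At a fixed point, \<open>4 * k\<^sup>2 + 2 * k - 4 * k * y\<close>
  is the squared distance of \<open>y - 1/2\<close> from \<open>2 * k\<close>, up to a term that is the same for all strips.  The
  other summands are the squared distance of the zigzag number \<open>u = 2 * x + y - 2 * k\<close> from \<open>3 * c + 1\<close>,
  up to a term that is the same for all cells of a strip.  The large factor lets the choice of the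
  strip dominate the choice within a strip.
\<close>

definition height :: "nat \<Rightarrow> nat \<times> nat \<Rightarrow> nat \<times> nat \<Rightarrow> int" where
  "height d = (\<lambda>(k, c) (x, y). let k = int k; c = int c; x = int x; y = int y in
     (2 * int d + 2)\<^sup>2 * (4 * k\<^sup>2 + 2 * k - 4 * k * y) + 9 * c\<^sup>2 + 6 * c - 6 * c * (2 * x + y - 2 * k))"

text \<open>
  Within a strip, the middle of the own cell is at distance at most \<open>1\<close> and every other one at distance
  at least \<open>2\<close>.  Another strip costs at least \<open>2\<close> in the first summand, before multiplication by the large
  factor, which outweighs anything that the other summands can gain.
\<close>

lemma height_separates:
  assumes p: "p \<in> lattice_triangle d" and \<kappa>: "cell_of p = \<kappa>"
    and \<kappa>': "\<kappa>' \<in> cell_of ` lattice_triangle d" "\<kappa>' \<noteq> \<kappa>"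
  shows "height d \<kappa> p < height d \<kappa>' p"
proof -
  obtain x y where xy: "p = (x, y)" by (cases p)
  obtain k' c' where k'c': "\<kappa>' = (k', c')" by (cases \<kappa>')
  define b where "b = int (y mod 2)"
  define K where "K = int (y div 2)"
  define U where "U = 2 * int x + b"
  define C where "C = int ((2 * x + y mod 2) div 3)"
  define K' where "K' = int k'"
  define C' where "C' = int c'"
  define D where "D = int d"
  have y: "int y = 2 * K + b" unfolding K_def b_def by presburger
  have b: "b = 0 \<or> b = 1" unfolding b_def by linarith
  have C: "3 * C \<le> U" "U \<le> 3 * C + 2" unfolding C_def U_def b_def by linarith+
  have D: "int x + 2 * K + b \<le> D" using p y by (simp add: xy lattice_triangle_def D_def)
  have pos: "K \<ge> 0" "C \<ge> 0" "K' \<ge> 0" "C' \<ge> 0" "int x \<ge> 0" by (auto simp: K_def C_def K'_def C'_def)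
  have K'D: "2 * K' \<le> D"
    using \<kappa>'(1) by (auto simp: k'c' cell_of_def lattice_triangle_def K'_def D_def)
  have h: "height d \<kappa> p = (2 * D + 2)\<^sup>2 * (4 * K\<^sup>2 + 2 * K - 4 * K * (2 * K + b)) + ((3 * C + 1 - U)\<^sup>2 - (U - 1)\<^sup>2)"
  proof -
    have "height d \<kappa> p = (2 * D + 2)\<^sup>2 * (4 * K\<^sup>2 + 2 * K - 4 * K * int y) + 9 * C\<^sup>2 + 6 * C -
        6 * C * (2 * int x + int y - 2 * K)"
      unfolding \<kappa>[symmetric] by (simp add: height_def xy cell_of_def Let_def K_def C_def D_def)
    then show ?thesis unfolding y U_def by (simp add: power2_eq_square algebra_simps)
  qed
  define U' where "U' = 2 * int x + int y - 2 * K'"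
  have h': "height d \<kappa>' p = (2 * D + 2)\<^sup>2 * (4 * K'\<^sup>2 + 2 * K' - 4 * K' * (2 * K + b)) + ((3 * C' + 1 - U')\<^sup>2 - (U' - 1)\<^sup>2)"
  proof -
    have "height d \<kappa>' p = (2 * D + 2)\<^sup>2 * (4 * K'\<^sup>2 + 2 * K' - 4 * K' * int y) + 9 * C'\<^sup>2 + 6 * C' - 6 * C' * U'"
      by (simp add: height_def xy k'c' Let_def K'_def C'_def D_def U'_def)
    then show ?thesis unfolding y by (simp add: power2_eq_square algebra_simps)
  qed
  have own: "(3 * C + 1 - U)\<^sup>2 \<le> 1"
    using C by (intro abs_square_le_1[THEN iffD2]) linarith
  show ?thesis
  proof (cases "K' = K")
    case True
    have "C' \<noteq> C"
    proof
      assume "C' = C"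
      then have "\<kappa>' = \<kappa>" using True unfolding \<kappa>[symmetric]
        by (simp add: k'c' xy cell_of_def C_def C'_def K_def K'_def)
      then show False using \<kappa>'(2) by simp
    qed
    then have "C' \<ge> C + 1 \<or> C' \<le> C - 1" by linarith
    then have "2 \<le> \<bar>3 * C' + 1 - U\<bar>" using C by linarith
    then have "2\<^sup>2 \<le> (3 * C' + 1 - U)\<^sup>2" by (metis power2_abs power_mono zero_le_numeral)
    moreover have "U' = U" unfolding U'_def U_def y True by simp
    ultimately show ?thesis using own unfolding h h' True by simp
  next
    case False
    define \<delta> where "\<delta> = K' - K"
    have "\<delta> \<ge> 1 \<or> \<delta> \<le> - 1" using False unfolding \<delta>_def by linarith
    then have gap: "2 * \<delta> * (2 * \<delta> + 1 - 2 * b) \<ge> 2"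
    proof
      assume "\<delta> \<ge> 1"
      then have "1 * 1 \<le> \<delta> * (2 * \<delta> + 1 - 2 * b)" using b by (intro mult_mono) auto
      then show ?thesis by simp
    next
      assume "\<delta> \<le> - 1"
      then have "1 * 1 \<le> (- \<delta>) * (- (2 * \<delta> + 1 - 2 * b))" using b by (intro mult_mono) auto
      then have "1 \<le> \<delta> * (2 * \<delta> + 1 - 2 * b)" by (simp only: minus_mult_minus mult_1)
      then show ?thesis by simp
    qed
    have "4 * K'\<^sup>2 + 2 * K' - 4 * K' * (2 * K + b) =
        4 * K\<^sup>2 + 2 * K - 4 * K * (2 * K + b) + 2 * \<delta> * (2 * \<delta> + 1 - 2 * b)"
      by (simp add: \<delta>_def power2_eq_square algebra_simps)
    with gap have "4 * K'\<^sup>2 + 2 * K' - 4 * K' * (2 * K + b) \<ge> 4 * K\<^sup>2 + 2 * K - 4 * K * (2 * K + b) + 2"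
      by linarith
    then have "(2 * D + 2)\<^sup>2 * (4 * K\<^sup>2 + 2 * K - 4 * K * (2 * K + b) + 2) \<le>
        (2 * D + 2)\<^sup>2 * (4 * K'\<^sup>2 + 2 * K' - 4 * K' * (2 * K + b))"
      by (intro mult_left_mono) auto
    then have gain: "(2 * D + 2)\<^sup>2 * (4 * K\<^sup>2 + 2 * K - 4 * K * (2 * K + b)) + 2 * (2 * D + 2)\<^sup>2 \<le>
        (2 * D + 2)\<^sup>2 * (4 * K'\<^sup>2 + 2 * K' - 4 * K' * (2 * K + b))"
      by (simp only: distrib_left[of "(2 * D + 2)\<^sup>2" _ 2] mult.commute[of "(2 * D + 2)\<^sup>2" 2])
    have loss: "(U' - 1)\<^sup>2 \<le> (2 * D + 2)\<^sup>2"
    proof -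
      have "\<bar>U' - 1\<bar> \<le> 2 * D + 2" using D K'D pos b unfolding U'_def y by linarith
      then show ?thesis using pos D by (intro abs_le_square_iff[THEN iffD1]) linarith
    qed
    have large: "2\<^sup>2 \<le> (2 * D + 2)\<^sup>2" using pos D b by (intro power_mono) linarith+
    have "A + (w - z) < B + (w' - z')"
      if "A + 2 * m \<le> B" "z' \<le> m" "2\<^sup>2 \<le> m" "0 \<le> w'" "0 \<le> z" "w \<le> 1" for A B m w w' z z' :: int
      using that by simp
    from this[OF gain loss large zero_le_power2 zero_le_power2 own]
    show ?thesis unfolding h h' .
  qed
qed

section \<open>Degeneration of double points to the cells\<close>

text \<open>
  Nonzero coordinate vectors can be used in place of points.
\<close>

lemma attained_rank_of_coordinates:
  fixes x :: "nat \<times> 3 \<Rightarrow> 'k::field"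
  assumes x: "\<And>i. i < t \<Longrightarrow> \<exists>j. x (i, j) \<noteq> 0"
    and fs: "\<And>j. j < length rs \<Longrightarrow> fs j \<in> forms d" and rs: "set rs \<subseteq> {..<t} \<times> UNIV"
    and minor: "minor (jet x fs) rs \<noteq> 0"
  shows "length rs \<in> attained_ranks TYPE('k) t d"
proof -
  obtain Ps where Ps: "length Ps = t" "\<And>f. multihomogeneous t f \<Longrightarrow>
      mpol_eval (all_coords Ps) f = 0 \<longleftrightarrow> mpol_eval x f = 0"
    using points_with_vanishing[of t x] x by blast
  have "minor (jet (all_coords Ps) fs) rs \<noteq> 0"
    using Ps(2)[OF multihomogeneous_minor[OF fs rs]] minor by (simp add: eval_minor_jet_poly)
  then show ?thesis unfolding attained_ranks_def using Ps(1) fs rs by blast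
qed

lemma poly_minor: "poly (minor \<Phi> rs) s = minor (\<lambda>r j. poly (\<Phi> r j) s) rs"
proof -
  interpret comm_ring_hom "\<lambda>q. poly q s" by unfold_locales auto
  have "poly (minor \<Phi> rs) s = Determinant.det (map_mat (\<lambda>q. poly q s)
      (Matrix.mat (length rs) (length rs) (\<lambda>(i, j). \<Phi> (rs ! i) j)))"
    unfolding minor_def by (rule hom_det[symmetric])
  also have "map_mat (\<lambda>q. poly q s) (Matrix.mat (length rs) (length rs) (\<lambda>(i, j). \<Phi> (rs ! i) j)) =
      Matrix.mat (length rs) (length rs) (\<lambda>(i, j). poly (\<Phi> (rs ! i) j) s)"
    by (rule eq_matI) auto
  finally show ?thesis by (simp add: minor_def)
qed

text \<open>
  Points whose coordinates are suitable powers of a parameter: after rescaling rows and columns the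
  matrix of jets becomes polynomial in the parameter, and at the value \<open>0\<close> it is block diagonal
  with one block for each cell.
\<close>

lemma cells_rank:
  assumes d: "d \<ge> 1" and D: "\<D> \<subseteq> cell_of ` lattice_triangle d" "card \<D> \<le> t"
  shows "(\<Sum>\<kappa>\<in>\<D>. card (cell d \<kappa>)) \<in> attained_ranks TYPE('k::field_char_0) t d"
proof -
  have finD: "finite \<D>" by (rule finite_subset[OF D(1)]) simp
  obtain h where h: "bij_betw h {..<card \<D>} \<D>"
    using ex_bij_betw_nat_finite[OF finD] by (auto simp: lessThan_atLeast0)
  let ?m = "card \<D>"
  define S where "S = (\<Union>\<kappa>\<in>\<D>. cell d \<kappa>)"
  have finS: "finite S" by (simp add: S_def finD)
  have cardS: "card S = (\<Sum>\<kappa>\<in>\<D>. card (cell d \<kappa>))"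
    unfolding S_def by (rule card_UN_disjoint) (auto simp: finD cell_def)
  let ?n = "card S"
  obtain q where q: "bij_betw q {..<?n} S"
    using ex_bij_betw_nat_finite[OF finS] by (auto simp: lessThan_atLeast0)
  have qS: "q j \<in> S" if "j < ?n" for j using q that by (auto simp: bij_betw_def)
  have qT: "q j \<in> lattice_triangle d" if "j < ?n" for j using qS[OF that] by (auto simp: S_def cell_def)
  have hD: "h i \<in> \<D>" if "i < ?m" for i using h that by (auto simp: bij_betw_def)
  define \<alpha> :: "nat \<Rightarrow> 3 \<Rightarrow> 'k" where "\<alpha> j e = of_nat (Poly_Mapping.lookup (exponent d (q j)) e)" for j e
  define \<gamma> where "\<gamma> i j = height d (h i) (q j) - height d (cell_of (q j)) (q j)" for i j
  define N where "N = (\<lambda>(i, e) j. Polynomial.monom (\<alpha> j e) (nat (\<gamma> i j)))"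
  have \<gamma>_pos: "\<gamma> i j > 0" if "i < ?m" "j < ?n" "cell_of (q j) \<noteq> h i" for i j
    using height_separates[OF qT[OF that(2)] refl, of "h i"] hD[OF that(1)] D(1) that(3)
    unfolding \<gamma>_def by auto
  have \<gamma>_0: "\<gamma> i j = 0" if "cell_of (q j) = h i" for i j using that by (simp add: \<gamma>_def)
  have \<gamma>_nonneg: "\<gamma> i j \<ge> 0" if "i < ?m" "j < ?n" for i j
    using \<gamma>_pos[OF that] \<gamma>_0[of j i] by linarith
  have N0: "poly (N (i, e) j) 0 = (if cell_of (q j) = h i then \<alpha> j e else 0)"
    if "i < ?m" "j < ?n" for i e j
    using \<gamma>_pos[OF that] \<gamma>_0[of j i] by (auto simp: N_def poly_monom power_0_left)
  have "\<exists>rs. length rs = ?n \<and> set rs \<subseteq> {..<?m} \<times> UNIV \<and> minor (\<lambda>r j. poly (N r j) 0) rs \<noteq> 0"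
  proof (rule nonzero_minor_exists)
    fix c assume c: "\<And>r. r \<in> {..<?m} \<times> UNIV \<Longrightarrow> (\<Sum>j<?n. c j * poly (N r j) 0) = 0"
    define v where "v p = c (the_inv_into {..<?n} q p)" for p
    have vq: "v (q j) = c j" if "j < ?n" for j
      using q that by (simp add: v_def the_inv_into_f_f bij_betw_def)
    have cell_sum: "(\<Sum>p\<in>cell d \<kappa>. v p * of_nat (Poly_Mapping.lookup (exponent d p) e)) = 0"
      if \<kappa>: "\<kappa> \<in> \<D>" for \<kappa> e
    proof -
      obtain i where i: "i < ?m" "h i = \<kappa>"
        using h \<kappa> unfolding bij_betw_def by (metis imageE lessThan_iff)
      have "0 = (\<Sum>j<?n. c j * poly (N (i, e) j) 0)" using c[of "(i, e)"] i by simp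
      also have "\<dots> = (\<Sum>j<?n. (\<lambda>p. if cell_of p = \<kappa> then
          v p * of_nat (Poly_Mapping.lookup (exponent d p) e) else 0) (q j))"
        by (rule sum.cong) (auto simp: N0 i vq \<alpha>_def)
      also have "\<dots> = (\<Sum>p\<in>S. if cell_of p = \<kappa> then
          v p * of_nat (Poly_Mapping.lookup (exponent d p) e) else 0)"
        by (rule sum.reindex_bij_betw[OF q])
      also have "\<dots> = (\<Sum>p\<in>cell d \<kappa>. v p * of_nat (Poly_Mapping.lookup (exponent d p) e))"
        by (rule sum.mono_neutral_cong_right) (use finS \<kappa> in \<open>auto simp: S_def cell_def\<close>)
      finally show ?thesis by simp
    qed
    show "\<forall>j<?n. c j = 0"
    proof (intro allI impI)
      fix j assume j: "j < ?n"
      obtain \<kappa> where \<kappa>: "\<kappa> \<in> \<D>" "q j \<in> cell d \<kappa>" using qS[OF j] unfolding S_def by blast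
      from cell_independent[OF d cell_sum[OF \<kappa>(1)] \<kappa>(2)] show "c j = 0" by (simp add: vq j)
    qed
  qed
  then obtain rs where rs: "length rs = ?n" "set rs \<subseteq> {..<?m} \<times> UNIV"
    "poly (minor N rs) 0 \<noteq> 0" by (auto simp: poly_minor)
  then have "minor N rs \<noteq> 0" by auto
  then obtain s where s: "poly (minor N rs) s \<noteq> 0" "s \<noteq> 0" by (rule nonroot_exists)
  \<comment> \<open>the exponents of the coordinates are the negated coefficients of \<open>height\<close>, and \<open>\<beta>\<close> is its constant term\<close>
  define k c where "k i = fst (h i)" and "c i = snd (h i)" for i
  define M where "M = (2 * d + 2)\<^sup>2"
  define \<beta> where "\<beta> i = int M * (4 * (int (k i))\<^sup>2 + 2 * int (k i)) + 9 * (int (c i))\<^sup>2 + 6 * int (c i)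
      + 12 * int (c i) * int (k i)" for i
  define x :: "nat \<times> 3 \<Rightarrow> 'k" where "x = (\<lambda>(i, e). if e = 1 then 1 else if e = 2 then
      inverse s ^ (12 * c i) else inverse s ^ (4 * k i * M + 6 * c i))"
  have x0: "x (i, e) \<noteq> 0" for i e using s(2) by (simp add: x_def)
  have coord_power: "monomial_value (\<lambda>e. x (i, e)) (exponent d (q j)) =
      s powi (\<gamma> i j) * s powi (height d (cell_of (q j)) (q j)) * s powi (- \<beta> i)" for i j
  proof -
    have neg_power: "inverse s ^ l = s powi (- int l)" for l
      by (simp add: power_int_minus power_inverse)
    obtain a b where ab: "q j = (a, b)" by (cases "q j")
    have "monomial_value (\<lambda>e. x (i, e)) (exponent d (q j)) =
        inverse s ^ (12 * c i * a + (4 * k i * M + 6 * c i) * b)"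
      by (simp add: ab exponent_def monomial_value_add x_def power_mult power_add)
    also have "\<dots> = s powi (- int (12 * c i * a + (4 * k i * M + 6 * c i) * b))"
      by (rule neg_power)
    also have "- int (12 * c i * a + (4 * k i * M + 6 * c i) * b) = height d (h i) (q j) - \<beta> i"
      by (simp add: ab height_def Let_def case_prod_unfold \<beta>_def k_def c_def M_def power2_eq_square algebra_simps)
    also have "s powi \<dots> = s powi (\<gamma> i j + height d (cell_of (q j)) (q j) + - \<beta> i)"
      by (simp add: \<gamma>_def)
    finally show ?thesis using s(2) by (simp only: power_int_add simp_thms)
  qed
  define fs :: "nat \<Rightarrow> (3, 'k) mpol" where "fs j = monom3 d (q j)" for j
  have jet: "jet x fs (i, e) j = inverse (x (i, e)) * s powi (- \<beta> i) *
      (s powi (height d (cell_of (q j)) (q j)) * poly (N (i, e) j) s)" if "i < ?m" "j < ?n" for i e j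
  proof -
    have "x (i, e) * jet x fs (i, e) j = \<alpha> j e * monomial_value (\<lambda>e. x (i, e)) (exponent d (q j))"
      using mult_partial_weight[of "\<lambda>e. x (i, e)" e "exponent d (q j)"]
      by (simp add: jet_def fs_def monom3_def partial_at_def coeff_sum_single \<alpha>_def)
    moreover have "s powi (\<gamma> i j) = s ^ nat (\<gamma> i j)"
      using \<gamma>_nonneg[OF that] by (simp add: power_int_def)
    ultimately have "x (i, e) * jet x fs (i, e) j =
        s powi (- \<beta> i) * (s powi (height d (cell_of (q j)) (q j)) * poly (N (i, e) j) s)"
      by (simp add: coord_power N_def poly_monom mult_ac)
    then show ?thesis using x0[of i e] by (simp add: field_simps)
  qed
  have "\<exists>rs. length rs = ?n \<and> set rs \<subseteq> {..<t} \<times> UNIV \<and> minor (jet x fs) rs \<noteq> 0"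
  proof (rule nonzero_minor_exists)
    fix u assume u: "\<And>r. r \<in> {..<t} \<times> UNIV \<Longrightarrow> (\<Sum>j<?n. u j * jet x fs r j) = 0"
    let ?w = "\<lambda>j. u j * s powi (height d (cell_of (q j)) (q j))"
    have "(\<Sum>j<length rs. ?w j * poly (N r j) s) = 0" if r: "r \<in> set rs" for r
    proof -
      obtain i e where ie: "r = (i, e)" "i < ?m" using r rs(2) by (cases r) auto
      have "0 = (\<Sum>j<?n. u j * jet x fs r j)" using u[of r] ie D(2) by simp
      also have "\<dots> = inverse (x (i, e)) * s powi (- \<beta> i) * (\<Sum>j<?n. ?w j * poly (N r j) s)"
        unfolding sum_distrib_left by (rule sum.cong) (auto simp: ie jet)
      finally show ?thesis using x0 s(2) rs(1) by simp
    qed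
    then have "?w j = 0" if "j < ?n" for j
      using nonzero_minor_independent[of "\<lambda>r j. poly (N r j) s" rs ?w j] s(1) rs(1) that
      by (simp add: poly_minor)
    then show "\<forall>j<?n. u j = 0" using s(2) by simp
  qed
  then obtain rs' where rs': "length rs' = ?n" "set rs' \<subseteq> {..<t} \<times> UNIV" "minor (jet x fs) rs' \<noteq> 0"
    by blast
  have "length rs' \<in> attained_ranks TYPE('k) t d"
  proof (rule attained_rank_of_coordinates[OF _ _ rs'(2,3)])
    show "\<exists>e. x (i, e) \<noteq> 0" for i using x0 by blast
    show "fs j \<in> forms d" if "j < length rs'" for j
      using qT that by (simp add: rs'(1) fs_def monom3_forms)
  qed
  then show ?thesis by (simp add: rs'(1) cardS)
qed

section \<open>Counting cells\<close>

text \<open>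
  The strip \<open>k\<close> has the zigzag numbers \<open>0, \<dots>, 2 * (d - 2 * k)\<close>, so only its last cell can be incomplete.
\<close>

lemma incomplete_cell:
  assumes "\<kappa> \<in> cell_of ` lattice_triangle d" "card (cell d \<kappa>) \<noteq> 3"
  shows "\<kappa> \<in> (\<lambda>k. (k, 2 * (d - 2 * k) div 3)) ` {..d div 2}"
proof -
  obtain k c where \<kappa>: "\<kappa> = (k, c)" by (cases \<kappa>)
  obtain x y where xy: "x + y \<le> d" "k = y div 2" "c = (2 * x + y mod 2) div 3"
    using assms(1) by (auto simp: \<kappa> cell_of_def lattice_triangle_def)
  have k: "2 * k \<le> d" using xy by linarith
  have "2 * x + y mod 2 \<le> 2 * (d - 2 * k)" 
    using xy(1) mult_div_mod_eq[of 2 y] unfolding xy(2) by linarith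
  then have c: "c \<le> 2 * (d - 2 * k) div 3" unfolding xy(3) by (rule div_le_mono)
  have half: "u \<le> 2 * n \<Longrightarrow> u div 2 + u mod 2 \<le> n" for u n :: nat by presburger
  have third: "b \<le> n div 3 \<Longrightarrow> 3 * b \<le> n" for b n :: nat by presburger
  have "c = 2 * (d - 2 * k) div 3"
  proof (rule ccontr)
    assume "c \<noteq> 2 * (d - 2 * k) div 3"
    with c have "Suc c \<le> 2 * (d - 2 * k) div 3" by simp
    then have "3 * Suc c \<le> 2 * (d - 2 * k)" by (rule third)
    moreover have "u div 2 + (2 * k + u mod 2) \<le> d" if "u \<le> 2 * (d - 2 * k)" for u
    proof -
      have "u div 2 + u mod 2 \<le> d - 2 * k" using that by (rule half)
      then show ?thesis using k by linarith
    qed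
    ultimately have "cell_point \<kappa> j \<in> lattice_triangle d" if "j < 3" for j
      using that by (simp add: \<kappa> cell_point_def lattice_triangle_def)
    then have "cell_point \<kappa> ` {..<3} \<subseteq> cell d \<kappa>" by (auto simp: cell_def cell_of_cell_point)
    then have "cell d \<kappa> = cell_point \<kappa> ` {..<3}" using cell_subset by blast
    moreover have "inj_on (cell_point \<kappa>) {..<3}" by (rule inj_onI) (rule cell_point_inj)
    ultimately have "card (cell d \<kappa>) = 3" by (simp add: card_image)
    with assms(2) show False by simp
  qed
  then show ?thesis using k by (auto simp: \<kappa> image_iff) 
qed

text \<open>
  There are at most \<open>d div 2 + 1\<close> incomplete cells, each with one or two points.
\<close>

lemma cell_counts:
  fixes d :: nat
  defines "\<C> \<equiv> cell_of ` lattice_triangle d"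
  defines "\<F> \<equiv> {\<kappa> \<in> \<C>. card (cell d \<kappa>) = 3}"
  shows "3 * card \<C> \<le> card (lattice_triangle d) + d + 2"
    and "card (lattice_triangle d) \<le> 3 * card \<F> + d + 2"
    and "(\<Sum>\<kappa>\<in>\<C>. card (cell d \<kappa>)) = card (lattice_triangle d)"
proof -
  have fin: "finite \<C>" by (simp add: \<C>_def)
  let ?E = "\<C> - \<F>"
  have "?E \<subseteq> (\<lambda>k. (k, 2 * (d - 2 * k) div 3)) ` {..d div 2}"
    using incomplete_cell by (auto simp: \<F>_def \<C>_def)
  then have "card ?E \<le> card ((\<lambda>k. (k, 2 * (d - 2 * k) div 3)) ` {..d div 2})"
    by (intro card_mono) auto
  also have "\<dots> \<le> d div 2 + 1" using card_image_le[of "{..d div 2}"] by simp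
  finally have E: "2 * card ?E \<le> d + 2" by linarith
  have "card (lattice_triangle d) = (\<Sum>\<kappa>\<in>\<C>. \<Sum>p\<in>cell d \<kappa>. 1)"
    unfolding \<C>_def cell_def card_eq_sum by (rule sum.image_gen) simp
  then show sum: "(\<Sum>\<kappa>\<in>\<C>. card (cell d \<kappa>)) = card (lattice_triangle d)" by simp
  have FC: "\<F> \<subseteq> \<C>" by (auto simp: \<F>_def)
  have split: "card (lattice_triangle d) = (\<Sum>\<kappa>\<in>?E. card (cell d \<kappa>)) + 3 * card \<F>"
  proof -
    have "(\<Sum>\<kappa>\<in>\<F>. card (cell d \<kappa>)) = (\<Sum>\<kappa>\<in>\<F>. 3)" by (rule sum.cong) (auto simp: \<F>_def)
    then show ?thesis using sum.subset_diff[OF FC fin, of "\<lambda>\<kappa>. card (cell d \<kappa>)"] sum by simp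
  qed
  have "cell d \<kappa> \<noteq> {}" if "\<kappa> \<in> \<C>" for \<kappa> using that by (auto simp: \<C>_def cell_def)
  then have "1 \<le> card (cell d \<kappa>)" if "\<kappa> \<in> ?E" for \<kappa> using that by (simp add: Suc_le_eq card_gt_0_iff)
  then have lo: "card ?E \<le> (\<Sum>\<kappa>\<in>?E. card (cell d \<kappa>))"
    using sum_mono[of ?E "\<lambda>_. 1" "\<lambda>\<kappa>. card (cell d \<kappa>)"] by simp
  have "card (cell d \<kappa>) \<le> 2" if "\<kappa> \<in> ?E" for \<kappa> using that card_cell_le[of d \<kappa>] by (auto simp: \<F>_def)
  then have hi: "(\<Sum>\<kappa>\<in>?E. card (cell d \<kappa>)) \<le> 2 * card ?E"
    using sum_mono[of ?E "\<lambda>\<kappa>. card (cell d \<kappa>)" "\<lambda>_. 2"] by simp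
  have "card \<C> = card ?E + card \<F>" using card_Diff_subset[OF finite_subset[OF FC fin] FC] card_mono[OF fin FC] by simp
  then show "3 * card \<C> \<le> card (lattice_triangle d) + d + 2" using split lo E by linarith
  show "card (lattice_triangle d) \<le> 3 * card \<F> + d + 2" using split hi E by linarith
qed

lemma full_rank_attained:
  assumes "d \<ge> 1" "card (lattice_triangle d) + d + 2 \<le> 3 * t"
  shows "card (lattice_triangle d) \<in> attained_ranks TYPE('k::field_char_0) t d"
  using cells_rank[OF assms(1) subset_refl, of t, where 'k = 'k] cell_counts(1,3)[of d] assms(2) by simp

lemma maximal_rank_attained:
  assumes "d \<ge> 1" "3 * t + d + 2 \<le> card (lattice_triangle d)"
  shows "3 * t \<in> attained_ranks TYPE('k::field_char_0) t d"
proof -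
  let ?F = "{\<kappa> \<in> cell_of ` lattice_triangle d. card (cell d \<kappa>) = 3}"
  have "t \<le> card ?F" using cell_counts(2)[of d] assms(2) by linarith
  then obtain D where D: "D \<subseteq> ?F" "card D = t" by (meson obtain_subset_with_card_n)
  have "(\<Sum>\<kappa>\<in>D. card (cell d \<kappa>)) = (\<Sum>\<kappa>\<in>D. 3)" by (rule sum.cong) (use D(1) in auto)
  then show ?thesis using cells_rank[OF assms(1), of D t, where 'k = 'k] D by (auto simp: mult.commute)
qed

section \<open>Lines in the projective plane\<close>

definition cross_product :: "(3 \<Rightarrow> 'k::field) \<Rightarrow> (3 \<Rightarrow> 'k) \<Rightarrow> 3 \<Rightarrow> 'k" where
  "cross_product u v j = (if j = 1 then u 2 * v 3 - u 3 * v 2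
     else if j = 2 then u 3 * v 1 - u 1 * v 3 else u 1 * v 2 - u 2 * v 1)"

lemma cross_product_zero_proportional:
  assumes u: "u j \<noteq> 0" and 0: "\<And>i. cross_product u v i = 0"
  shows "\<exists>c. \<forall>i. v i = c * u i"
proof (intro exI allI)
  fix i
  have "u 2 * v 3 = u 3 * v 2" "u 3 * v 1 = u 1 * v 3" "u 1 * v 2 = u 2 * v 1"
    using 0[of 1] 0[of 2] 0[of 3] by (simp_all add: cross_product_def)
  then have "u j * v i = v j * u i" using exhaust_3[of i] exhaust_3[of j] by (auto simp: mult.commute)
  then show "v i = v j / u j * u i" using u by (simp add: field_simps)
qed

lemma cross_product_twice:
  "(\<Sum>i\<in>UNIV. u i * w i) = 0 \<Longrightarrow> (\<Sum>i\<in>UNIV. v i * w i) = 0 \<Longrightarrow> cross_product (cross_product u v) w j = 0"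
proof -
  assume "(\<Sum>i\<in>UNIV. u i * w i) = 0" "(\<Sum>i\<in>UNIV. v i * w i) = 0"
  then have uv: "u 1 * w 1 + u 2 * w 2 + u 3 * w 3 = 0" "v 1 * w 1 + v 2 * w 2 + v 3 * w 3 = 0"
    by (simp_all add: sum_3)
  have *: "cross_product (cross_product u v) w j = v j * (u 1 * w 1 + u 2 * w 2 + u 3 * w 3) -
      u j * (v 1 * w 1 + v 2 * w 2 + v 3 * w 3)"
    using exhaust_3[of j] by (auto simp: cross_product_def algebra_simps)
  show ?thesis unfolding * uv by simp
qed

lemma p2_eqI:
  assumes "\<And>j. coords Q j = c * coords P j"
  shows "P = (Q :: 'k::field p2)"
proof -
  have nz: "rep_p2 P \<noteq> 0" "rep_p2 Q \<noteq> 0"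
    using coords_nonzero[of P] coords_nonzero[of Q] by (auto simp: coords_def)
  have "rep_p2 Q = c *s rep_p2 P"
    using assms by (simp add: coords_def Finite_Cartesian_Product.vec_eq_iff)
  with nz have "proj_rel (rep_p2 P) (rep_p2 Q)" unfolding proj_rel_def by blast
  then have "abs_p2 (rep_p2 P) = abs_p2 (rep_p2 Q)" by (rule Quotient3_rel_abs[OF Quotient3_p2])
  then show ?thesis by (simp add: Quotient3_abs_rep[OF Quotient3_p2])
qed

text \<open>
  The common points of two lines are the multiples of the cross product of their coefficient vectors,
  which is nonzero unless the coefficient vectors are proportional and the lines agree.
\<close>

lemma lines_meet_once:
  assumes "is_line L" "is_line L'" "L \<noteq> (L' :: 'k::field p2 set)"
  shows "\<exists>!P. P \<in> L \<inter> L'"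
proof -
  obtain a j where a: "a j \<noteq> 0" "L = {P. (\<Sum>j\<in>UNIV. a j * coords P j) = 0}"
    using assms(1) unfolding is_line_def by blast
  obtain b i where b: "b i \<noteq> 0" "L' = {P. (\<Sum>j\<in>UNIV. b j * coords P j) = 0}"
    using assms(2) unfolding is_line_def by blast
  have "\<exists>i. cross_product a b i \<noteq> 0"
  proof (rule ccontr)
    assume "\<not> (\<exists>i. cross_product a b i \<noteq> 0)"
    with cross_product_zero_proportional[of a j b] a(1) obtain c where c: "\<forall>i. b i = c * a i" by blast
    then have "c \<noteq> 0" using b(1) by auto
    have "(\<Sum>j\<in>UNIV. b j * coords P j) = c * (\<Sum>j\<in>UNIV. a j * coords P j)" for P
      by (simp add: c sum_distrib_left mult.assoc)
    with \<open>c \<noteq> 0\<close> have "L = L'" by (simp add: a(2) b(2))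
    with assms(3) show False by simp
  qed
  then obtain r where r: "cross_product a b r \<noteq> 0" ..
  have proportional: "\<exists>c. \<forall>i. coords P i = c * cross_product a b i" if "P \<in> L \<inter> L'" for P
    using that cross_product_zero_proportional[of "cross_product a b" r "coords P", OF r] cross_product_twice[of a "coords P" b]
    by (simp add: a(2) b(2))
  obtain Q where Q: "snd Q \<noteq> 0" "\<forall>j. coords (fst Q) j = snd Q * cross_product a b j"
    using point_with_coords[of "cross_product a b"] r by blast
  have "fst Q \<in> L \<inter> L'"
    by (simp add: a(2) b(2) Q(2) sum_3 cross_product_def algebra_simps)
  moreover have "P = fst Q" if P: "P \<in> L \<inter> L'" for P
  proof -
    obtain c where c: "\<forall>i. coords P i = c * cross_product a b i" using proportional[OF P] by blast
    have "coords P i = (c / snd Q) * coords (fst Q) i" for i using Q c by simp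
    then show ?thesis by (rule p2_eqI[symmetric])
  qed
  ultimately show ?thesis by blast
qed

text \<open>
  The coefficient vectors \<open>(1, i, i\<^sup>2)\<close> lie on a conic of the dual plane.  A line meets a conic at most
  twice, so no three of these lines are concurrent.
\<close>

definition conic_line :: "nat \<Rightarrow> 'k::field p2 set" where
  "conic_line i = {P. coords P 1 + of_nat i * coords P 2 + of_nat i * of_nat i * coords P 3 = 0}"

lemma is_line_conic_line: "is_line (conic_line i :: 'k::field p2 set)"
  unfolding is_line_def
  by (rule exI[of _ "\<lambda>j. if j = 1 then 1 else if j = 2 then of_nat i else of_nat i * of_nat i"])
     (auto simp: conic_line_def sum_3 intro: exI[of _ 1])

lemma conic_lines_not_concurrent:
  fixes P :: "'k::field_char_0 p2"
  assumes P: "P \<in> conic_line i" "P \<in> conic_line j" "P \<in> conic_line k"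
    and d: "i \<noteq> j" "j \<noteq> k" "i \<noteq> k"
  shows False
proof -
  let ?p = "coords P"
  define I J K :: 'k where "I = of_nat i" and "J = of_nat j" and "K = of_nat k"
  have nz: "J - I \<noteq> 0" "K - I \<noteq> 0" "J - K \<noteq> 0" using d by (auto simp: I_def J_def K_def)
  have e: "?p 1 + I * ?p 2 + I * I * ?p 3 = 0" "?p 1 + J * ?p 2 + J * J * ?p 3 = 0"
    "?p 1 + K * ?p 2 + K * K * ?p 3 = 0"
    using P by (simp_all add: conic_line_def I_def J_def K_def)
  have "(J - I) * (?p 2 + (I + J) * ?p 3) =
      (?p 1 + J * ?p 2 + J * J * ?p 3) - (?p 1 + I * ?p 2 + I * I * ?p 3)" by (simp add: algebra_simps)
  then have 1: "?p 2 + (I + J) * ?p 3 = 0" using nz(1) e by simp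
  have "(K - I) * (?p 2 + (I + K) * ?p 3) =
      (?p 1 + K * ?p 2 + K * K * ?p 3) - (?p 1 + I * ?p 2 + I * I * ?p 3)" by (simp add: algebra_simps)
  then have 2: "?p 2 + (I + K) * ?p 3 = 0" using nz(2) e by simp
  have "(J - K) * ?p 3 = (?p 2 + (I + J) * ?p 3) - (?p 2 + (I + K) * ?p 3)" by (simp add: algebra_simps)
  then have "?p 3 = 0" using nz(3) 1 2 by simp
  then have "?p r = 0" for r using 1 e exhaust_3[of r] by auto
  then show False using coords_nonzero[of P] by blast
qed

text \<open>The points with coordinates \<open>(- i - i\<^sup>2 c, 1, c)\<close> lie on the line and determine \<open>c\<close>.\<close>

lemma infinite_conic_line: "infinite (conic_line i :: 'k::field_char_0 p2 set)"
proof
  assume fin: "finite (conic_line i :: 'k p2 set)"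
  have "c \<in> (\<lambda>P. coords P 3 / coords P 2) ` conic_line i" for c :: 'k
  proof -
    define v :: "3 \<Rightarrow> 'k" where "v j = (if j = 1 then - of_nat i - of_nat i * of_nat i * c
      else if j = 2 then 1 else c)" for j
    have "v 2 \<noteq> 0" by (simp add: v_def)
    then obtain Q where Q: "snd Q \<noteq> 0" "\<forall>j. coords (fst Q) j = snd Q * v j"
      using point_with_coords[of v] by blast
    have "fst Q \<in> conic_line i" by (simp add: conic_line_def Q(2) v_def algebra_simps)
    moreover have "c = coords (fst Q) 3 / coords (fst Q) 2" using Q by (simp add: v_def)
    ultimately show ?thesis by blast
  qed
  then have "(UNIV :: 'k set) \<subseteq> (\<lambda>P. coords P 3 / coords P 2) ` conic_line i" by blast
  then have "finite (UNIV :: 'k set)" by (rule finite_subset) (use fin in simp)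
  then show False using infinite_UNIV_char_0 by blast
qed

lemma conic_lines_distinct: "i \<noteq> j \<Longrightarrow> conic_line i \<noteq> (conic_line j :: 'k::field_char_0 p2 set)"
proof
  assume ij: "i \<noteq> j" and eq: "conic_line i = (conic_line j :: 'k p2 set)"
  define v :: "3 \<Rightarrow> 'k" where "v r = (if r = 1 then - of_nat i else if r = 2 then 1 else 0)" for r
  have "v 2 \<noteq> 0" by (simp add: v_def)
  then obtain Q where Q: "snd Q \<noteq> 0" "\<forall>r. coords (fst Q) r = snd Q * v r"
    using point_with_coords[of v] by blast
  have "fst Q \<in> conic_line i" by (simp add: conic_line_def Q(2) v_def algebra_simps)
  then have "fst Q \<in> conic_line j" by (simp add: eq)
  then have "snd Q * (of_nat j - of_nat i) = 0" by (simp add: conic_line_def Q(2) v_def algebra_simps)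
  then show False using Q(1) ij by simp
qed

lemma admissible_conic_lines: "admissible_lines a (conic_line :: nat \<Rightarrow> 'k::field_char_0 p2 set)"
  unfolding admissible_lines_def
proof (intro conjI ballI impI)
  show "inj_on (conic_line :: nat \<Rightarrow> 'k p2 set) {1..a}"
    using conic_lines_distinct by (intro inj_onI) blast
  fix i j k :: nat assume "i < j \<and> j < k"
  then show "conic_line i \<inter> conic_line j \<inter> conic_line k = ({} :: 'k p2 set)"
    using conic_lines_not_concurrent[of _ i j k] by (auto simp: disjoint_iff)
qed (rule is_line_conic_line)

lemma admissible_not_concurrent:
  assumes "admissible_lines a l" "{i, j, k} \<subseteq> {1..a}" "P \<in> l i" "P \<in> l j" "P \<in> l k"
  shows "i = j \<or> j = k \<or> i = k"
proof -
  have *: False if "i < j" "j < k" "{i, j, k} \<subseteq> {1..a}" "P \<in> l i" "P \<in> l j" "P \<in> l k" for i j k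
    using assms(1) that unfolding admissible_lines_def by blast
  consider "i < j" "j < k" | "i < k" "k < j" | "j < i" "i < k" | "j < k" "k < i" | "k < i" "i < j"
    | "k < j" "j < i" | "i = j \<or> j = k \<or> i = k" by linarith
  then show ?thesis
    by cases (use *[of i j k] *[of i k j] *[of j i k] *[of j k i] *[of k i j] *[of k j i] assms in auto)
qed

lemma meet_in_lines:
  assumes "admissible_lines a l" "i \<in> {1..a}" "j \<in> {1..a}" "i \<noteq> j"
  shows "l i \<inter> l j = {Defs.meet l i j}"
proof -
  have "is_line (l i)" "is_line (l j)" "l i \<noteq> l j"
    using assms unfolding admissible_lines_def inj_on_def by blast+
  then have ex1: "\<exists>!P. P \<in> l i \<inter> l j" by (rule lines_meet_once)
  have "Defs.meet l i j \<in> l i \<inter> l j" unfolding Defs.meet_def by (rule theI'[OF ex1])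
  with ex1 show ?thesis by blast
qed

section \<open>The invariant of the algorithm\<close>

text \<open>The pairs \<open>(m, j)\<close> for which steps \<open>1, \<dots>, n\<close> put a double point at the meet of lines \<open>m\<close> and \<open>j\<close>.\<close>

definition double_pairs :: "(nat \<Rightarrow> int) \<Rightarrow> nat \<Rightarrow> (nat \<times> nat) set" where
  "double_pairs h n = (SIGMA m:{1..n}. {m + 1..m + alg_t h m})"

lemma finite_double_pairs [simp]: "finite (double_pairs h n)"
  by (simp add: double_pairs_def)

lemma card_double_pairs: "card (double_pairs h n) = (\<Sum>m=1..n. alg_t h m)"
  by (simp add: double_pairs_def)

lemma alg_s_le: "alg_s h n \<le> alpha h - n"
proof -
  have "alg_s h n \<le> card {n + 1..alpha h}" unfolding alg_s_def by (rule card_mono) auto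
  then show ?thesis by simp
qed

lemma alg_t_le: "alg_t h n \<le> alg_s h n"
  by (simp add: alg_t_def)

lemma double_pairs_range:
  assumes "(m, j) \<in> double_pairs h n"
  shows "m \<in> {1..alpha h}" "j \<in> {1..alpha h}" "m < j"
  using assms alg_t_le[of h m] alg_s_le[of h m] by (auto simp: double_pairs_def)

lemma meet_inj_on_pairs:
  assumes "admissible_lines (alpha h) l"
  shows "inj_on (\<lambda>(m, j). Defs.meet l m j) (double_pairs h n)"
proof (rule inj_onI, clarify)
  fix m j m' j' assume p: "(m, j) \<in> double_pairs h n" "(m', j') \<in> double_pairs h n"
    and eq: "Defs.meet l m j = Defs.meet l m' j'"
  note r = double_pairs_range[OF p(1)] and r' = double_pairs_range[OF p(2)]
  have "Defs.meet l m j \<in> l m \<inter> l j" "Defs.meet l m j \<in> l m' \<inter> l j'"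
    using meet_in_lines[OF assms r(1,2)] meet_in_lines[OF assms r'(1,2)] r(3) r'(3) eq by auto
  then have "m = j \<or> j = m' \<or> m = m'" "m = j \<or> j = j' \<or> m = j'" "m = m' \<or> m' = j' \<or> m = j'"
    "j = m' \<or> m' = j' \<or> j = j'"
    using admissible_not_concurrent[OF assms, of m j m' "Defs.meet l m j"]
      admissible_not_concurrent[OF assms, of m j j' "Defs.meet l m j"]
      admissible_not_concurrent[OF assms, of m m' j' "Defs.meet l m j"]
      admissible_not_concurrent[OF assms, of j m' j' "Defs.meet l m j"] r r' by auto
  then show "m = m' \<and> j = j'" using r(3) r'(3) by linarith
qed

definition avoids_meets :: "nat \<Rightarrow> (nat \<Rightarrow> 'k::field p2 set) \<Rightarrow> 'k p2 set \<Rightarrow> bool" where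
  "avoids_meets a l A \<longleftrightarrow> (\<forall>i\<in>{1..a}. \<forall>j\<in>{1..a}. i \<noteq> j \<longrightarrow> A \<inter> (l i \<inter> l j) = {})"

text \<open>
  The shape of the scheme after step \<open>n\<close>: reduced points \<open>A\<close> left over from the start, and the double
  points added so far.
\<close>

definition alg_state ::
    "(nat \<Rightarrow> int) \<Rightarrow> (nat \<Rightarrow> 'k::field p2 set) \<Rightarrow> nat \<Rightarrow> 'k p2 set \<Rightarrow> 'k p2 multiset" where
  "alg_state h l n A = mset_set A + (\<Sum>(m, j)\<in>double_pairs h n. {#Defs.meet l m j, Defs.meet l m j#})"

text \<open>
  The meets are pairwise distinct, because no three lines are concurrent, and none of them is in \<open>A\<close>.
  So every multiplicity is \<open>0\<close>, \<open>1\<close> or \<open>2\<close>.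
\<close>

lemma count_alg_state:
  assumes adm: "admissible_lines (alpha h) l" and A: "finite A" "avoids_meets (alpha h) l A"
  shows "reduced_points (alg_state h l n A) = A"
    and "double_points (alg_state h l n A) = (\<lambda>(m, j). Defs.meet l m j) ` double_pairs h n"
proof -
  let ?M = "(\<lambda>(m, j). Defs.meet l m j) ` double_pairs h n"
  have disj: "P \<notin> A" if P: "P \<in> ?M" for P
  proof -
    obtain r where r: "r \<in> double_pairs h n" "P = (\<lambda>(m, j). Defs.meet l m j) r" using P by blast
    obtain m j where "r = (m, j)" by (cases r)
    with r have mj: "(m, j) \<in> double_pairs h n" "P = Defs.meet l m j" by auto
    note r = double_pairs_range[OF mj(1)]
    have "A \<inter> (l m \<inter> l j) = {}" using A(2) r unfolding avoids_meets_def by (metis nat_neq_iff)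
    then show ?thesis using meet_in_lines[OF adm r(1,2)] r(3) mj(2) by auto
  qed
  have "count (\<Sum>(m, j)\<in>double_pairs h n. {#Defs.meet l m j, Defs.meet l m j#}) P =
      (\<Sum>r\<in>double_pairs h n. if P = (\<lambda>(m, j). Defs.meet l m j) r then 2 else 0)" for P
    by (auto simp: count_sum intro!: sum.cong)
  also have "\<dots> P = (\<Sum>Q\<in>?M. if P = Q then 2 else 0)" for P
    by (simp add: sum.reindex[OF meet_inj_on_pairs[OF adm]])
  also have "\<dots> P = (if P \<in> ?M then 2 else 0)" for P by simp
  finally have c: "count (alg_state h l n A) P = (if P \<in> A then 1 else 0) + (if P \<in> ?M then 2 else 0)" for P
    using A(1) by (simp add: alg_state_def)
  show "reduced_points (alg_state h l n A) = A"
    unfolding reduced_points_def c using disj by auto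
  show "double_points (alg_state h l n A) = ?M"
    unfolding double_points_def c using disj by auto
qed

lemma double_pairs_Suc:
  "double_pairs h (Suc n) = double_pairs h n \<union> Pair (Suc n) ` {Suc n + 1..Suc n + alg_t h (Suc n)}"
  by (auto simp: double_pairs_def le_Suc_eq)

lemma alg_state_step:
  assumes X: "X \<subseteq> A" "finite A"
  shows "alg_state h l n A - mset_set X + (\<Sum>j\<in>{Suc n + 1..Suc n + alg_t h (Suc n)}.
      {#Defs.meet l (Suc n) j, Defs.meet l (Suc n) j#}) = alg_state h l (Suc n) (A - X)"
proof -
  let ?J = "{Suc n + 1..Suc n + alg_t h (Suc n)}"
  let ?S = "\<lambda>n. \<Sum>(m, j)\<in>double_pairs h n. {#Defs.meet l m j, Defs.meet l m j#}"
  have "mset_set ((A - X) \<union> X) = mset_set (A - X) + mset_set X"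
    by (rule mset_set_Union) (use X finite_subset in auto)
  moreover have "(A - X) \<union> X = A" using X by blast
  ultimately have "mset_set A = mset_set (A - X) + mset_set X" by simp
  moreover have "?S (Suc n) = ?S n + (\<Sum>j\<in>?J. {#Defs.meet l (Suc n) j, Defs.meet l (Suc n) j#})"
  proof -
    have "?S (Suc n) = ?S n + (\<Sum>(m, j)\<in>Pair (Suc n) ` ?J. {#Defs.meet l m j, Defs.meet l m j#})"
      unfolding double_pairs_Suc by (rule sum.union_disjoint) (auto simp: double_pairs_def)
    then show ?thesis by (simp add: sum.reindex inj_on_def)
  qed
  ultimately show ?thesis by (simp add: alg_state_def)
qed

text \<open>
  The invariant of a run, together with the fact that the run did not stop early.
\<close>

lemma alg_run_state:
  assumes "alg_run h l n Z" and adm: "admissible_lines (alpha h) l"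
  shows "(\<exists>A. finite A \<and> avoids_meets (alpha h) l A \<and> Z = alg_state h l n A) \<and> (\<forall>m\<in>{1..n}. alg_s h m \<noteq> 0)"
  using assms(1)
proof (induction rule: alg_run.induct)
  case (start Z)
  then show ?case by (auto simp: alg_start_def alg_state_def avoids_meets_def double_pairs_def)
next
  case (step n Z Z')
  obtain A where A: "finite A" "avoids_meets (alpha h) l A" "Z = alg_state h l n A"
    using step.IH by blast
  let ?J = "{Suc n + 1..Suc n + alg_t h (Suc n)}"
  have red: "reduced_points Z = A" by (simp add: A(3) count_alg_state(1)[OF adm A(1,2)])
  obtain B b where B: "B \<subseteq> A" "b ` ?J \<subseteq> A"
    "Z' = Z - mset_set (B \<union> b ` ?J) + (\<Sum>j\<in>?J. {#Defs.meet l (Suc n) j, Defs.meet l (Suc n) j#})"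
    using step.hyps(3) unfolding alg_step_def Let_def red by blast
  have "Z' = alg_state h l (Suc n) (A - (B \<union> b ` ?J))"
    unfolding B(3) A(3) by (rule alg_state_step) (use A(1) B(1,2) in auto)
  moreover have "avoids_meets (alpha h) l (A - (B \<union> b ` ?J))"
    using A(2) unfolding avoids_meets_def by blast
  moreover have "\<forall>m\<in>{1..Suc n}. alg_s h m \<noteq> 0" using step.IH step.hyps(2) by (auto simp: le_Suc_eq)
  ultimately show ?case using A(1) by blast
qed

lemma alg_run_double_points:
  assumes "alg_run h l n Z" "admissible_lines (alpha h) l"
  shows "card (double_points Z) = (\<Sum>m=1..n. alg_t h m)"
proof -
  obtain A where A: "finite A" "avoids_meets (alpha h) l A" "Z = alg_state h l n A"
    using alg_run_state[OF assms] by blast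
  show ?thesis
    by (simp only: A(3) count_alg_state(2)[OF assms(2) A(1,2)] card_image[OF meet_inj_on_pairs[OF assms(2)]]
        card_double_pairs)
qed

section \<open>The algorithm can always proceed\<close>

lemma hstar_antimono:
  assumes "finite {j. h j \<ge> 1}" "1 \<le> i" "i \<le> k"
  shows "hstar h k \<le> hstar h i"
  unfolding hstar_def
proof (rule card_mono)
  show "finite {j. int i \<le> h j}" by (rule finite_subset[OF _ assms(1)]) (use assms(2) in auto)
qed (use assms(3) in auto)

text \<open>
  Since \<open>hstar h\<close> is decreasing, the lines counted by \<open>alg_s h n\<close> are the ones that follow line \<open>n\<close>
  immediately.
\<close>

lemma hstar_ge_of_alg_s:
  assumes fin: "finite {j. h j \<ge> 1}" and j: "n + 1 \<le> j" "j \<le> n + alg_s h n"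
  shows "n \<le> hstar h j"
proof (rule ccontr)
  assume "\<not> n \<le> hstar h j"
  then have "hstar h k < n" if "j \<le> k" for k
    using hstar_antimono[OF fin _ that] j(1) by simp
  then have "{k. n + 1 \<le> k \<and> k \<le> alpha h \<and> n \<le> hstar h k} \<subseteq> {n + 1..<j}"
    by (auto simp: not_le[symmetric])
  then have "alg_s h n \<le> card {n + 1..<j}" unfolding alg_s_def by (intro card_mono) auto
  then show False using j by simp
qed

text \<open>
  The lines are infinite and there are only finitely many meets to avoid.
\<close>

lemma alg_start_exists:
  fixes l :: "nat \<Rightarrow> 'k::field p2 set"
  assumes adm: "admissible_lines (alpha h) l" and inf: "\<And>i. i \<in> {1..alpha h} \<Longrightarrow> infinite (l i)"
  shows "\<exists>A. finite A \<and> alg_start h l (mset_set A) \<and> avoids_meets (alpha h) l A \<and>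
    (\<forall>i\<in>{1..alpha h}. card (A \<inter> l i) = hstar h i)"
proof -
  let ?a = "alpha h"
  define M where "M = (\<lambda>(i, j). Defs.meet l i j) ` ({1..?a} \<times> {1..?a})"
  have M: "l i \<inter> l j \<subseteq> M" if "i \<in> {1..?a}" "j \<in> {1..?a}" "i \<noteq> j" for i j
    using meet_in_lines[OF adm that] that by (auto simp: M_def)
  have "finite M" by (simp add: M_def)
  then have "\<exists>B. B \<subseteq> l i - M \<and> finite B \<and> card B = hstar h i" if "i \<in> {1..?a}" for i
    using infinite_arbitrarily_large[of "l i - M" "hstar h i"] inf[OF that] by auto
  then obtain B where B: "\<And>i. i \<in> {1..?a} \<Longrightarrow> B i \<subseteq> l i - M \<and> finite (B i) \<and> card (B i) = hstar h i"
    by metis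
  define A where "A = (\<Union>i\<in>{1..?a}. B i)"
  have finA: "finite A" using B by (auto simp: A_def)
  have AM: "A \<inter> M = {}" using B by (fastforce simp: A_def)
  have avoid: "A \<inter> (l i \<inter> l j) = {}" if "i \<in> {1..?a}" "j \<in> {1..?a}" "i \<noteq> j" for i j
    using M[OF that] AM by blast
  have Al: "A \<inter> l i = B i" if i: "i \<in> {1..?a}" for i
  proof
    show "B i \<subseteq> A \<inter> l i" using B[OF i] i by (auto simp: A_def)
    show "A \<inter> l i \<subseteq> B i"
    proof
      fix P assume P: "P \<in> A \<inter> l i"
      then obtain j where j: "j \<in> {1..?a}" "P \<in> B j" by (auto simp: A_def)
      then have "P \<in> l j" using B by blast
      then have "j = i" using avoid[OF i j(1)] P by blast
      then show "P \<in> B i" using j by simp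
    qed
  qed
  have "A \<subseteq> (\<Union>i\<in>{1..?a}. l i)" using B by (fastforce simp: A_def)
  then have "alg_start h l (mset_set A)"
    unfolding alg_start_def using finA Al B avoid by (intro exI[of _ A]) auto
  then show ?thesis using finA Al B avoid unfolding avoids_meets_def by (intro exI[of _ A]) auto
qed

text \<open>
  A line that has not been processed loses at most one point in each step, so after \<open>n\<close> steps at
  least \<open>hstar h i - n\<close> of its points remain.
\<close>

lemma alg_run_exists:
  fixes l :: "nat \<Rightarrow> 'k::field p2 set"
  assumes adm: "admissible_lines (alpha h) l" and inf: "\<And>i. i \<in> {1..alpha h} \<Longrightarrow> infinite (l i)"
    and fin: "finite {j. h j \<ge> 1}"
  shows "(\<And>m. m \<in> {1..n} \<Longrightarrow> alg_s h m \<noteq> 0) \<Longrightarrow>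
    \<exists>A. finite A \<and> avoids_meets (alpha h) l A \<and> alg_run h l n (alg_state h l n A) \<and>
      (\<forall>i. n < i \<longrightarrow> i \<le> alpha h \<longrightarrow> hstar h i \<le> card (A \<inter> l i) + n)"
proof (induction n)
  case 0
  obtain A where A: "finite A" "alg_start h l (mset_set A)" "avoids_meets (alpha h) l A"
    "\<forall>i\<in>{1..alpha h}. card (A \<inter> l i) = hstar h i"
    using alg_start_exists[OF adm inf] by blast
  have "alg_run h l 0 (alg_state h l 0 A)"
    using alg_run.start[OF A(2)] by (simp add: alg_state_def double_pairs_def)
  then show ?case using A by (intro exI[of _ A]) auto
next
  case (Suc n)
  let ?n = "Suc n"
  let ?t = "alg_t h ?n"
  let ?J = "{?n + 1..?n + ?t}"
  obtain A where A: "finite A" "avoids_meets (alpha h) l A" "alg_run h l n (alg_state h l n A)"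
    and many: "\<And>i. n < i \<Longrightarrow> i \<le> alpha h \<Longrightarrow> hstar h i \<le> card (A \<inter> l i) + n"
    using Suc.IH Suc.prems by auto
  have s: "alg_s h ?n \<noteq> 0" using Suc.prems by simp
  then have na: "?n < alpha h" using alg_s_le[of h ?n] by linarith
  have "2 * ?t \<le> hstar h ?n - n" by (simp add: alg_t_def)
  then have "2 * ?t \<le> card (A \<inter> l ?n)" using many[of ?n] na by linarith
  then obtain B where B: "B \<subseteq> A \<inter> l ?n" "card B = 2 * ?t" by (meson obtain_subset_with_card_n)
  have Ja: "j \<in> {1..alpha h}" if "j \<in> ?J" for j
    using that alg_t_le[of h ?n] alg_s_le[of h ?n] by auto
  have "\<exists>P. P \<in> A \<inter> l j" if j: "j \<in> ?J" for j
  proof -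
    have "?n \<le> hstar h j" using hstar_ge_of_alg_s[OF fin, of ?n j] j alg_t_le[of h ?n] by simp
    then have "card (A \<inter> l j) \<noteq> 0" using many[of j] Ja[OF j] j by auto
    then show ?thesis by (metis card.empty ex_in_conv)
  qed
  then obtain b where b: "\<And>j. j \<in> ?J \<Longrightarrow> b j \<in> A \<inter> l j" by metis
  let ?X = "B \<union> b ` ?J"
  have X: "?X \<subseteq> A" using B b by blast
  have red: "reduced_points (alg_state h l n A) = A" by (rule count_alg_state(1)[OF adm A(1,2)])
  have "alg_step h l ?n (alg_state h l n A) (alg_state h l ?n (A - ?X))"
    unfolding alg_step_def Let_def red
    by (rule exI[of _ B], rule exI[of _ b]) (use B b alg_state_step[OF X A(1), of h l n] in auto)
  then have run: "alg_run h l ?n (alg_state h l ?n (A - ?X))" by (rule alg_run.step[OF A(3) s])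
  have "hstar h i \<le> card ((A - ?X) \<inter> l i) + ?n" if i: "?n < i" "i \<le> alpha h" for i
  proof -
    have "i \<in> {1..alpha h}" using i by simp
    then have no_meet: "A \<inter> (l i \<inter> l j) = {}" if "j \<in> {1..alpha h}" "j \<noteq> i" for j
      using A(2) that unfolding avoids_meets_def by blast
    have "A \<inter> l i - {b i} \<subseteq> (A - ?X) \<inter> l i"
    proof
      fix P assume P: "P \<in> A \<inter> l i - {b i}"
      have "P \<notin> B" using no_meet[of ?n] na B(1) P i by auto
      moreover have "P \<noteq> b j" if j: "j \<in> ?J" for j
      proof (cases "j = i")
        case False
        then show ?thesis using no_meet[OF Ja[OF j] False] b[OF j] P by blast
      qed (use P in auto)
      ultimately show "P \<in> (A - ?X) \<inter> l i" using P by blast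
    qed
    then have "card (A \<inter> l i - {b i}) \<le> card ((A - ?X) \<inter> l i)" using A(1) by (intro card_mono) auto
    moreover have "card (A \<inter> l i) \<le> Suc (card (A \<inter> l i - {b i}))"
    proof -
      have "x \<le> Suc (if c then x - 1 else x)" for x c by (cases x) auto
      then show ?thesis unfolding card_Diff_singleton_if .
    qed
    ultimately show ?thesis using many[of i] i by simp
  qed
  moreover have "avoids_meets (alpha h) l (A - ?X)" using A(2) unfolding avoids_meets_def by blast
  ultimately show ?case using run A(1) by (intro exI[of _ "A - ?X"]) auto
qed

lemma alg_s_antimono: "alg_s h (Suc n) \<le> alg_s h n"
  unfolding alg_s_def by (rule card_mono) auto

text \<open>
  The step at which a run stops depends only on \<open>alg_s\<close>, so all runs stop at the same step.  The later
  summands vanish, which allows a sum over all lines.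
\<close>

theorem double_points_produced_eq:
  assumes fin: "finite {j. first_difference H j \<ge> 1}"
  shows "double_points_produced TYPE('k::field_char_0) H =
    (\<Sum>m=1..alpha (first_difference H). alg_t (first_difference H) m)"
proof -
  let ?h = "first_difference H"
  let ?a = "alpha ?h"
  define N where "N = (LEAST n. alg_s ?h (Suc n) = 0)"
  have end0: "alg_s ?h (Suc ?a) = 0" using alg_s_le[of ?h "Suc ?a"] by simp
  have N: "alg_s ?h (Suc N) = 0" unfolding N_def by (rule LeastI[of _ ?a]) (rule end0)
  have Na: "N \<le> ?a" unfolding N_def by (rule Least_le) (rule end0)
  have below: "alg_s ?h m \<noteq> 0" if "m \<in> {1..N}" for m
    using not_less_Least[of "m - 1" "\<lambda>n. alg_s ?h (Suc n) = 0"] that unfolding N_def by auto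
  have above: "alg_s ?h m = 0" if "Suc N \<le> m" for m
    using that
  proof (induction m rule: dec_induct)
    case (step m)
    then show ?case using alg_s_antimono[of ?h m] by simp
  qed (rule N)
  have sum: "(\<Sum>m=1..?a. alg_t ?h m) = (\<Sum>m=1..N. alg_t ?h m)"
  proof (rule sum.mono_neutral_right)
    show "\<forall>m\<in>{1..?a} - {1..N}. alg_t ?h m = 0"
    proof
      fix m assume "m \<in> {1..?a} - {1..N}"
      then have "alg_s ?h m = 0" by (intro above) auto
      then show "alg_t ?h m = 0" using alg_t_le[of ?h m] by simp
    qed
  qed (use Na in auto)
  have ret: "card (double_points Z) = (\<Sum>m=1..N. alg_t ?h m)" if ret: "alg_returns ?h Z" for Z :: "'k p2 multiset"
  proof -
    obtain l n where l: "admissible_lines ?a l" "alg_run ?h l n Z" "alg_s ?h (Suc n) = 0"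
      using ret unfolding alg_returns_def by blast
    have "\<not> Suc N \<le> n"
    proof
      assume "Suc N \<le> n"
      then have "alg_s ?h n = 0" "n \<in> {1..n}" by (rule above) (use \<open>Suc N \<le> n\<close> in simp)
      then show False using alg_run_state[OF l(2,1)] by blast
    qed
    moreover have "\<not> Suc n \<le> N" using below[of "Suc n"] l(3) by auto
    ultimately have "n = N" by linarith
    then show ?thesis using alg_run_double_points[OF l(2,1)] by simp
  qed
  have "\<exists>Z :: 'k p2 multiset. alg_returns ?h Z"
  proof -
    obtain A where "alg_run ?h (conic_line :: nat \<Rightarrow> 'k p2 set) N (alg_state ?h conic_line N A)"
      using alg_run_exists[OF admissible_conic_lines infinite_conic_line fin below] by blast
    then show ?thesis unfolding alg_returns_def using admissible_conic_lines N by blast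
  qed
  then have "double_points_produced TYPE('k) H = (\<Sum>m=1..N. alg_t ?h m)"
    unfolding double_points_produced_def using ret by (intro the_equality) auto
  then show ?thesis by (simp only: sum)
qed

section \<open>The first difference of the generic Hilbert function\<close>

text \<open>
  Here \<open>q\<close> is the integer part of \<open>sqrt (6 * t)\<close>.  Degrees \<open>d \<le> q - 3\<close> have so few monomials that \<open>t\<close>
  double points leave no form, and in degrees \<open>d \<ge> q + 2\<close> the \<open>3 * t\<close> conditions are independent.  In the
  degrees between them only the upper bound is claimed.
\<close>

lemma generic_first_difference:
  fixes t q :: nat
  assumes t: "t \<ge> 1" and q: "q * q \<le> 6 * t" "6 * t < (q + 1) * (q + 1)"
  defines "h \<equiv> first_difference (generic_double_hilbert TYPE('k::field_char_0) t)"
  shows "h j \<le> int j + 1"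
    and "j + 3 \<le> q \<Longrightarrow> h j = int j + 1"
    and "q + 3 \<le> j \<Longrightarrow> h j = 0"
proof -
  let ?H = "generic_double_hilbert TYPE('k) t"
  have tri: "2 * card (lattice_triangle d) = (d + 1) * (d + 2)" for d by (rule card_triangle)
  have above: "3 * t \<in> attained_ranks TYPE('k) t d" if "q + 2 \<le> d" for d
  proof (rule maximal_rank_attained)
    have "(q + 1) * (q + 1) \<le> (d - 1) * (d + 2)" using that by (intro mult_mono) auto
    moreover have "(d - 1) * (d + 2) + 2 * (d + 2) = (d + 1) * (d + 2)"
      using that by (cases d) (simp_all add: algebra_simps)
    moreover have "3 * t + d + 2 \<le> c"
      if "X \<le> Y" "Y + 2 * (d + 2) = Z" "6 * t < X" "2 * c = Z" for X Y Z c :: nat using that by presburger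
    ultimately show "3 * t + d + 2 \<le> card (lattice_triangle d)" using q(2) tri[of d] by blast
  qed (use that in simp)
  have D: "q + 2 \<ge> 1" "3 * t \<in> attained_ranks TYPE('k) t (q + 2)" using above by simp_all
  obtain Ps :: "'k p2 list" where Ps: "distinct Ps" "length Ps = t" "hilbert Ps = ?H"
    using generic_double_hilbert_max(1)[OF t D] by blast
  have H_ge: "n \<le> ?H d" if "d \<ge> 1" "n \<in> attained_ranks TYPE('k) t d" for d n
    by (rule generic_double_hilbert_max(2)[OF t D that])
  have "Ps \<noteq> []" using Ps(2) t by auto
  then have H0: "?H 0 = 1" using hilbert_0[OF Ps(1)] Ps(3) by simp
  have low: "2 * ?H d = (d + 1) * (d + 2)" if "d + 3 \<le> q" for d
  proof (cases "d = 0")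
    case False
    have "(d + 3) * (d + 3) \<le> q * q" using that by (intro mult_mono) auto
    moreover have "(d + 1) * (d + 2) + 2 * (d + 2) \<le> (d + 3) * (d + 3)" by (simp add: algebra_simps)
    moreover have "c + d + 2 \<le> 3 * t"
      if "Y \<le> X" "Z + 2 * (d + 2) \<le> Y" "X \<le> 6 * t" "2 * c = Z" for X Y Z c :: nat using that by presburger
    ultimately have "card (lattice_triangle d) + d + 2 \<le> 3 * t" using q(1) tri[of d] by blast
    then have "card (lattice_triangle d) \<le> ?H d"
      using H_ge full_rank_attained[of d t, where 'k = 'k] False by simp
    moreover have "?H d \<le> card (lattice_triangle d)" using hilbert_le_triangle[of Ps d] Ps(3) by simp
    ultimately show ?thesis using tri[of d] by linarith
  qed (simp add: H0)
  have high: "?H d = 3 * t" if "q + 2 \<le> d" for d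
    using H_ge[OF _ above[OF that]] hilbert_le_3t[OF Ps(1), of d] Ps that by simp
  show "h j \<le> int j + 1"
  proof (cases j)
    case 0
    then show ?thesis by (simp add: h_def first_difference_def H0)
  next
    case (Suc d)
    then show ?thesis using hilbert_difference_le[of Ps d] Ps(3) by (simp add: h_def first_difference_def)
  qed
  show "h j = int j + 1" if "j + 3 \<le> q"
  proof (cases j)
    case 0
    then show ?thesis by (simp add: h_def first_difference_def H0)
  next
    case (Suc d)
    have "2 * ?H (Suc d) = (Suc d + 1) * (Suc d + 2)" "2 * ?H d = (d + 1) * (d + 2)"
      by (rule low; use that Suc in simp)+
    moreover have "(Suc d + 1) * (Suc d + 2) = (d + 1) * (d + 2) + 2 * (d + 2)" by (simp add: algebra_simps eval_nat_numeral)
    ultimately have "2 * ?H (Suc d) = 2 * ?H d + 2 * (d + 2)" by (simp only:)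
    then show ?thesis by (simp add: h_def first_difference_def Suc)
  qed
  show "h j = 0" if "q + 3 \<le> j"
    using high[of j] high[of "j - 1"] that by (simp add: h_def first_difference_def)
qed

section \<open>Counting the double points\<close>

lemma sum_truncated_differences: "2 * (\<Sum>m=1..B. Q - m) = Q * (Q - 1)" if "Q \<le> B" for B Q :: nat
proof -
  have "(\<Sum>m=1..B. Q - m) = (\<Sum>m=1..Q. Q - m)"
    by (rule sum.mono_neutral_right) (use that in auto)
  also have "\<dots> = (\<Sum>m<Q. m)"
    by (rule sum.reindex_bij_witness[of _ "\<lambda>m. Q - m" "\<lambda>m. Q - m"]) auto
  also have "2 * \<dots> = Q * (Q - 1)"
  proof (induction Q)
    case (Suc Q)
    then show ?case by (cases Q) (simp_all add: algebra_simps)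
  qed simp
  finally show ?thesis .
qed

text \<open>
  For \<open>i \<ge> 1\<close> the number \<open>hstar h i\<close> lies between \<open>q - 1 - i\<close> and \<open>q + 4 - i\<close>.  Hence step \<open>m\<close> adds between
  \<open>(q - 1) div 2 - m\<close> and \<open>(q + 5) div 2 - m\<close> double points, and these numbers sum to triangular numbers.
\<close>

lemma staircase_double_points:
  fixes h :: "nat \<Rightarrow> int" and q :: nat
  assumes q: "q \<ge> 5" and up: "\<And>j. h j \<le> int j + 1" and eq: "\<And>j. j + 3 \<le> q \<Longrightarrow> h j = int j + 1"
    and zero: "\<And>j. q + 3 \<le> j \<Longrightarrow> h j = 0"
  shows "((q - 1) div 2) * ((q - 1) div 2 - 1) \<le> 2 * (\<Sum>m=1..alpha h. alg_t h m)"
    and "2 * (\<Sum>m=1..alpha h. alg_t h m) \<le> ((q + 5) div 2) * ((q + 5) div 2 - 1)"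
    and "finite {j. h j \<ge> 1}"
proof -
  have pos: "j < q + 3" if "h j \<ge> 1" for j 
  proof (rule ccontr)
    assume "\<not> j < q + 3"
    with zero[of j] that show False by simp
  qed
  show fin: "finite {j. h j \<ge> 1}" by (rule finite_subset[of _ "{..<q + 3}"]) (use pos in auto)
  have finrange: "finite (range h)"
  proof (rule finite_subset)
    show "range h \<subseteq> insert 0 (h ` {..<q + 3})"
    proof (rule image_subsetI)
      fix j show "h j \<in> insert 0 (h ` {..<q + 3})" using zero[of j] by (cases "j < q + 3") auto
    qed
  qed simp
  have alpha: "q - 2 \<le> alpha h"
  proof -
    have "h (q - 3) = int (q - 2)" using eq[of "q - 3"] q by simp
    moreover have "h (q - 3) \<le> Max (range h)" using finrange by (intro Max_ge) auto
    ultimately show ?thesis by (simp add: alpha_def)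
  qed
  have hs_up: "hstar h i \<le> q + 4 - i" if "i \<ge> 1" for i
  proof -
    have "{j. int i \<le> h j} \<subseteq> {i - 1..<q + 3}"
    proof
      fix j assume "j \<in> {j. int i \<le> h j}"
      then have "int i \<le> h j" by simp
      then have "int i \<le> int j + 1" "j < q + 3" using up[of j] pos[of j] that by linarith+
      then show "j \<in> {i - 1..<q + 3}" by auto
    qed
    then have "hstar h i \<le> card {i - 1..<q + 3}" unfolding hstar_def by (intro card_mono) auto
    then show ?thesis using that by simp
  qed
  have hs_lo: "q - 1 - i \<le> hstar h i" if "i \<ge> 1" for i
  proof -
    have "{i - 1..<q - 2} \<subseteq> {j. int i \<le> h j}"
    proof
      fix j assume j: "j \<in> {i - 1..<q - 2}"
      then have "h j = int j + 1" by (intro eq) auto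
      with j show "j \<in> {j. int i \<le> h j}" by auto
    qed
    moreover have "finite {j. int i \<le> h j}" by (rule finite_subset[OF _ fin]) (use that in auto)
    ultimately have "card {i - 1..<q - 2} \<le> hstar h i" unfolding hstar_def by (intro card_mono)
    then show ?thesis using that by simp
  qed
  have t_up: "alg_t h m \<le> (q + 5) div 2 - m" if "m \<ge> 1" for m
  proof -
    have "alg_t h m \<le> (hstar h m - (m - 1)) div 2" by (simp add: alg_t_def)
    also have "\<dots> \<le> (q + 5 - 2 * m) div 2" by (rule div_le_mono) (use hs_up[OF that] that in linarith)
    also have "\<dots> = (q + 5) div 2 - m" by linarith
    finally show ?thesis .
  qed
  have t_lo: "(q - 1) div 2 - m \<le> alg_t h m" if "m \<ge> 1" for m
  proof -
    have "{m + 1..q - 1 - m} \<subseteq> {k. m + 1 \<le> k \<and> k \<le> alpha h \<and> m \<le> hstar h k}"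
    proof
      fix k assume k: "k \<in> {m + 1..q - 1 - m}"
      then have "m \<le> q - 1 - k" "k \<le> alpha h" using alpha that by auto
      then show "k \<in> {k. m + 1 \<le> k \<and> k \<le> alpha h \<and> m \<le> hstar h k}"
        using hs_lo[of k] k by auto
    qed
    then have "card {m + 1..q - 1 - m} \<le> alg_s h m"
      unfolding alg_s_def by (rule card_mono[rotated]) (rule finite_subset[of _ "{..alpha h}"], auto)
    then have s: "q - 1 - 2 * m \<le> alg_s h m" by simp
    have "q - 2 * m \<le> hstar h m - (m - 1)" using hs_lo[OF that] that by linarith
    then have half: "(q - 2 * m) div 2 \<le> (hstar h m - (m - 1)) div 2" by (rule div_le_mono)
    have "x div 2 - m \<le> (x + 1 - 2 * m) div 2" "x div 2 - m \<le> x - 2 * m" for x by presburger+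
    from this[of "q - 1"] have "(q - 1) div 2 - m \<le> (q - 2 * m) div 2" "(q - 1) div 2 - m \<le> q - 1 - 2 * m"
      using q by simp_all
    from order.trans[OF this(1) half] order.trans[OF this(2) s] show ?thesis
      unfolding alg_t_def by (rule min.boundedI)
  qed
  have "(q - 1) div 2 * ((q - 1) div 2 - 1) = 2 * (\<Sum>m=1..alpha h. (q - 1) div 2 - m)"
    by (rule sum_truncated_differences[symmetric]) (use alpha q in linarith)
  also have "\<dots> \<le> 2 * (\<Sum>m=1..alpha h. alg_t h m)"
    by (intro mult_left_mono sum_mono) (use t_lo in auto)
  finally show "(q - 1) div 2 * ((q - 1) div 2 - 1) \<le> 2 * (\<Sum>m=1..alpha h. alg_t h m)" .
  have "2 * (\<Sum>m=1..alpha h. alg_t h m) \<le> 2 * (\<Sum>m=1..alpha h. (q + 5) div 2 - m)"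
    by (intro mult_left_mono sum_mono) (use t_up in auto)
  \<comment> \<open>the additional summands make the range long enough for the closed form\<close>
  also have "\<dots> \<le> 2 * (\<Sum>m=1..alpha h + (q + 5). (q + 5) div 2 - m)"
    by (intro mult_left_mono sum_mono2) auto
  also have "\<dots> = (q + 5) div 2 * ((q + 5) div 2 - 1)"
    by (rule sum_truncated_differences) linarith
  finally show "2 * (\<Sum>m=1..alpha h. alg_t h m) \<le> (q + 5) div 2 * ((q + 5) div 2 - 1)" .
qed

lemma double_points_bounds:
  assumes t: "t \<ge> 6"
  defines "s \<equiv> double_points_produced TYPE('k::field_char_0) (generic_double_hilbert TYPE('k) t)"
  shows "(sqrt (6 * real t) - 3) * (sqrt (6 * real t) - 5) / 8 \<le> real s"
    and "real s \<le> (sqrt (6 * real t) + 5)\<^sup>2 / 8"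
proof -
  define r where "r = sqrt (6 * real t)"
  define q where "q = nat \<lfloor>r\<rfloor>"
  have r0: "r \<ge> 0" and rr: "r * r = 6 * real t" by (auto simp: r_def)
  \<comment> \<open>from here on \<open>q \<ge> 5\<close>, and both factors of the lower bound are positive\<close>
  have r6: "r \<ge> 6" unfolding r_def by (rule real_le_rsqrt) (use t in simp)
  have qr: "real q \<le> r" "r < real q + 1" using r0 unfolding q_def by linarith+
  have q5: "q \<ge> 5" using r6 qr by linarith
  have "real q * real q \<le> 6 * real t" unfolding rr[symmetric] using qr by (intro mult_mono) auto
  then have q1: "q * q \<le> 6 * t" by (metis (no_types) of_nat_le_iff of_nat_mult of_nat_numeral)
  have "6 * real t < (real q + 1) * (real q + 1)"
    unfolding rr[symmetric] using qr r0 by (intro mult_strict_mono) auto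
  then have "real (6 * t) < real ((q + 1) * (q + 1))"
    by (simp only: of_nat_mult of_nat_add of_nat_1 of_nat_numeral)
  then have q2: "6 * t < (q + 1) * (q + 1)" by (simp only: of_nat_less_iff)
  have "t \<ge> 1" using t by simp
  note diff = generic_first_difference[OF this q1 q2, where 'k = 'k]
  note stair = staircase_double_points[OF q5 diff]
  have s: "s = (\<Sum>m=1..alpha (first_difference (generic_double_hilbert TYPE('k) t)).
      alg_t (first_difference (generic_double_hilbert TYPE('k) t)) m)"
    unfolding s_def by (rule double_points_produced_eq[OF stair(3)])
  define K where "K = (q - 1) div 2"
  define L where "L = (q + 5) div 2"
  have KL: "K * (K - 1) \<le> 2 * s" "2 * s \<le> L * (L - 1)"
    using stair(1,2) by (simp_all add: s K_def L_def)
  have K: "real K \<ge> (r - 3) / 2" "K \<ge> 1"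
  proof -
    have "q \<le> 2 * K + 2" unfolding K_def by linarith
    then have "real q \<le> 2 * real K + 2" by linarith
    then show "real K \<ge> (r - 3) / 2" using qr by (simp add: field_simps)
    show "K \<ge> 1" unfolding K_def using q5 by linarith
  qed
  have "(r - 3) * (r - 5) / 4 = (r - 3) / 2 * ((r - 5) / 2)" by simp
  also have "\<dots> \<le> real K * (real K - 1)" using K r6 by (intro mult_mono) auto
  also have "\<dots> = real (K * (K - 1))" using K(2) by (simp add: of_nat_diff)
  also have "\<dots> \<le> real (2 * s)" using KL(1) by (simp only: of_nat_le_iff)
  finally show "(sqrt (6 * real t) - 3) * (sqrt (6 * real t) - 5) / 8 \<le> real s"
    by (simp add: r_def)
  have L: "real L \<le> (r + 5) / 2"
  proof -
    have "2 * L \<le> q + 5" unfolding L_def by linarith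
    then have "2 * real L \<le> real q + 5" by linarith
    then show ?thesis using qr by (simp add: field_simps)
  qed
  have "real (2 * s) \<le> real (L * (L - 1))" using KL(2) by (simp only: of_nat_le_iff)
  also have "\<dots> \<le> real L * real L" by (simp add: mult_left_mono)
  also have "\<dots> \<le> ((r + 5) / 2) * ((r + 5) / 2)" using L r0 by (intro mult_mono) auto
  finally show "real s \<le> (sqrt (6 * real t) + 5)\<^sup>2 / 8"
    by (simp add: r_def power2_eq_square)
qed

theorem proposition5p1:
  shows "(\<lambda>t. real (double_points_produced TYPE('k::{alg_closed_field,field_char_0})
            (generic_double_hilbert TYPE('k) t)) / real t) \<longlonglongrightarrow> 3 / 4"
proof (rule tendsto_sandwich)
  show "\<forall>\<^sub>F t in sequentially. (sqrt (6 * real t) - 3) * (sqrt (6 * real t) - 5) / 8 / real t \<le>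
      real (double_points_produced TYPE('k) (generic_double_hilbert TYPE('k) t)) / real t"
    using eventually_ge_at_top[of 6]
    by eventually_elim (intro divide_right_mono double_points_bounds, auto)
  show "\<forall>\<^sub>F t in sequentially. real (double_points_produced TYPE('k) (generic_double_hilbert TYPE('k) t)) / real t
      \<le> (sqrt (6 * real t) + 5)\<^sup>2 / 8 / real t"
    using eventually_ge_at_top[of 6]
    by eventually_elim (intro divide_right_mono double_points_bounds, auto)
  show "(\<lambda>t. (sqrt (6 * real t) - 3) * (sqrt (6 * real t) - 5) / 8 / real t) \<longlonglongrightarrow> 3 / 4"
    by real_asymp (simp add: powr_half_sqrt)
  show "(\<lambda>t. (sqrt (6 * real t) + 5)\<^sup>2 / 8 / real t) \<longlonglongrightarrow> 3 / 4"
    by real_asymp (simp add: powr_half_sqrt)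
qed

end
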